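(* Let $0<p<1$, let $H$ be a separable Hilbert space, and let $\mathfrak g$ be a Lie subalgebra of $\mathcal L_{p,\infty}(H)$ (with commutator bracket) that is closed under the operator product and satisfies: there exists $C_{\mathrm{ideal}}>0$ such that $$\|xy\|_{p,\infty}\le C_{\mathrm{ideal}}\|x\|_{p,\infty}\|y\|_{p,\infty}\qquad\text{for all }x,y\in\mathfrak g.$$ Then with $C_{\triangle,p}=2^{1/p-1}$ as quasi-triangle constant, $C_{\cdot,p}=C_{\mathrm{ideal}}$ as submultiplicativity constant, and bracket continuity constant $B_p\le 2C_{\triangle,p}C_{\cdot,p}$, the Baker--Campbell--Hausdorff series $\sum_{n\ge1}Z_n(x,y)$ converges in the $d_p$-metric topology for all $x,y\in\mathfrak g$ with $$\|x\|_{p,\infty}+\|y\|_{p,\infty}<\frac{1}{4B_p}.$$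
   Context: For $0<p<1$, the weak Schatten ideal $\mathcal L_{p,\infty}(H)$ consists of the compact operators $T$ on $H$ whose singular values satisfy $s_n(T)=O(n^{-1/p})$, equipped with the quasi-norm $\|T\|_{p,\infty}=\sup_{n\ge1}n^{1/p}s_n(T)$. The quasi-triangle constant of a quasi-norm is the constant $C_\triangle\geq 1$ in $\|x+y\|\le C_\triangle(\|x\|+\|y\|)$; the submultiplicativity constant is the constant in $\|xy\|\le C_\cdot\|x\|\|y\|$; a bracket continuity constant is a constant $B_p>0$ with $\|[x,y]\|_{p,\infty}\le B_p\|x\|_{p,\infty}\|y\|_{p,\infty}$ for $x,y\in\mathfrak g$, where $[x,y]=xy-yx$. The metric is $d_p(x,y)=\|x-y\|_{p,\infty}^p$ (the exponent $1/\log_2(2C_{\triangle,p})$ associated with $C_{\triangle,p}=2^{1/p-1}$ equals $p$). BCH series: $Z_n(X,Y)$ is the homogeneous component of total degree $n$ of the formal series $\log(e^Xe^Y)$ in non-commuting variables $X,Y$; it is a Lie polynomial with rational coefficients and is evaluated at $x,y\in\mathfrak g$ using the bracket: $Z_1=x+y$, $Z_2=\tfrac12[x,y]$, $Z_3=\tfrac1{12}[x,[x,y]]-\tfrac1{12}[y,[x,y]]$, etc.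
   Formalization: 2^{1/p-1} is not a quasi-triangle constant of the weak Schatten quasi-norm, and 2C_△C_· need not be a bracket constant, so neither is asserted; convergence is proved for every bracket constant B_p ≤ 2C_△C_·, and also with B_p replaced by 2C_△C_·. *)

theory Defs
  imports "HOL-Analysis.Analysis"
begin

section \<open>Complex Hilbert spaces\<close>

text \<open>
  Completeness and the underlying real Banach space structure come from class \<open>banach\<close>.
  The inner product is linear in its second argument.
\<close>

class complex_hilbert = banach +
  fixes scaleC :: "complex \<Rightarrow> 'a \<Rightarrow> 'a"  (infixr \<open>*\<^sub>C\<close> 75)
    and cinner :: "'a \<Rightarrow> 'a \<Rightarrow> complex"
  assumes scaleC_add_right: "c *\<^sub>C (u + v) = c *\<^sub>C u + c *\<^sub>C v"
    and scaleC_add_left: "(c + d) *\<^sub>C u = c *\<^sub>C u + d *\<^sub>C u"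
    and scaleC_scaleC: "c *\<^sub>C d *\<^sub>C u = (c * d) *\<^sub>C u"
    and scaleR_scaleC: "r *\<^sub>R u = complex_of_real r *\<^sub>C u"
    and cinner_commute: "cinner u v = cnj (cinner v u)"
    and cinner_add_right: "cinner u (v + w) = cinner u v + cinner u w"
    and cinner_scaleC_right: "cinner u (c *\<^sub>C v) = c * cinner u v"
    and cinner_ge_zero: "0 \<le> Re (cinner u u)"
    and norm_eq_sqrt_cinner: "norm u = sqrt (Re (cinner u u))"


section \<open>Singular values and the weak Schatten ideals\<close>

text \<open>
  Operators are elements of the library type of bounded real-linear maps, with the operator
  norm; complex linearity is imposed separately.
\<close>

definition complex_linear :: "('a::complex_hilbert \<Rightarrow>\<^sub>L 'a) \<Rightarrow> bool" where
  "complex_linear T \<longleftrightarrow> (\<forall>c v. blinfun_apply T (c *\<^sub>C v) = c *\<^sub>C blinfun_apply T v)"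

definition compact_op :: "('a::real_normed_vector \<Rightarrow>\<^sub>L 'a) \<Rightarrow> bool" where
  "compact_op T \<longleftrightarrow> compact (closure (blinfun_apply T ` cball 0 1))"

text \<open>
  For \<open>s \<ge> 0\<close>, the eigenspace of \<open>|T| = (T\<^sup>* T)\<^sup>1\<^sup>/\<^sup>2\<close> for the eigenvalue \<open>s\<close>, which is the
  eigenspace of \<open>T\<^sup>* T\<close> for \<open>s\<^sup>2\<close>: the equation \<open>T\<^sup>* T v = s\<^sup>2 v\<close> is tested against every \<open>w\<close>,
  using \<open>\<langle>T\<^sup>* T v, w\<rangle> = \<langle>T v, T w\<rangle>\<close>.
\<close>

definition abs_eigenspace :: "('a::complex_hilbert \<Rightarrow>\<^sub>L 'a) \<Rightarrow> real \<Rightarrow> 'a set" where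
  "abs_eigenspace T s =
     {v. \<forall>w. cinner (blinfun_apply T v) (blinfun_apply T w) = complex_of_real (s\<^sup>2) * cinner v w}"

text \<open>
  The \<open>n\<close>-th singular value (\<open>n \<ge> 1\<close>) of a compact operator \<open>T\<close>: the \<open>n\<close>-th largest eigenvalue
  of \<open>|T|\<close>, counted with multiplicity, and \<open>0\<close> if \<open>|T|\<close> has fewer than \<open>n\<close> positive eigenvalues.
  It is the largest \<open>s\<close> such that \<open>|T|\<close> has \<open>n\<close> orthonormal eigenvectors with eigenvalues
  \<open>\<ge> s\<close>.
\<close>

definition singular_value :: "nat \<Rightarrow> ('a::complex_hilbert \<Rightarrow>\<^sub>L 'a) \<Rightarrow> real" where
  "singular_value n T = Sup (insert 0 {s. 0 < s \<and>
     (\<exists>e::nat \<Rightarrow> 'a. (\<forall>i<n. \<forall>j<n. cinner (e i) (e j) = (if i = j then 1 else 0)) \<and>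
                     (\<forall>i<n. \<exists>t\<ge>s. e i \<in> abs_eigenspace T t))})"

definition weak_schatten :: "real \<Rightarrow> ('a::complex_hilbert \<Rightarrow>\<^sub>L 'a) set" where
  "weak_schatten p = {T. complex_linear T \<and> compact_op T \<and>
     (\<exists>c. \<forall>n\<ge>1. singular_value n T \<le> c * real n powr (- 1 / p))}"

definition weak_schatten_norm :: "real \<Rightarrow> ('a::complex_hilbert \<Rightarrow>\<^sub>L 'a) \<Rightarrow> real" where
  "weak_schatten_norm p T = (SUP n\<in>{1..}. real n powr (1 / p) * singular_value n T)"

definition weak_schatten_dist ::
    "real \<Rightarrow> ('a::complex_hilbert \<Rightarrow>\<^sub>L 'a) \<Rightarrow> ('a \<Rightarrow>\<^sub>L 'a) \<Rightarrow> real" where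
  "weak_schatten_dist p S T = weak_schatten_norm p (S - T) powr p"

definition op_bracket ::
    "('a::real_normed_vector \<Rightarrow>\<^sub>L 'a) \<Rightarrow> ('a \<Rightarrow>\<^sub>L 'a) \<Rightarrow> ('a \<Rightarrow>\<^sub>L 'a)" where
  "op_bracket x y = (x o\<^sub>L y) - (y o\<^sub>L x)"

text \<open>
  Only real scalars are required, so both real and complex Lie subalgebras are covered.
  Closedness in \<open>weak_schatten p\<close> is not required.
\<close>

definition lie_subalgebra :: "real \<Rightarrow> ('a::complex_hilbert \<Rightarrow>\<^sub>L 'a) set \<Rightarrow> bool" where
  "lie_subalgebra p g \<longleftrightarrow>
     g \<subseteq> weak_schatten p \<and> subspace g \<and> (\<forall>x\<in>g. \<forall>y\<in>g. op_bracket x y \<in> g)"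

definition bracket_continuity_const ::
    "real \<Rightarrow> ('a::complex_hilbert \<Rightarrow>\<^sub>L 'a) set \<Rightarrow> real \<Rightarrow> bool" where
  "bracket_continuity_const p g B \<longleftrightarrow> 0 < B \<and>
     (\<forall>x\<in>g. \<forall>y\<in>g. weak_schatten_norm p (op_bracket x y)
                   \<le> B * weak_schatten_norm p x * weak_schatten_norm p y)"


section \<open>The Baker--Campbell--Hausdorff series\<close>

text \<open>
  Formal power series over the rationals in two non-commuting variables, given by their
  coefficients on words.
\<close>

datatype bch_var = VX | VY

type_synonym nc_series = "bch_var list \<Rightarrow> rat"

definition nc_one :: nc_series where
  "nc_one w = (if w = [] then 1 else 0)"

definition nc_var :: "bch_var \<Rightarrow> nc_series" where
  "nc_var a w = (if w = [a] then 1 else 0)"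

definition nc_mult :: "nc_series \<Rightarrow> nc_series \<Rightarrow> nc_series" where
  "nc_mult f g w = (\<Sum>k\<le>length w. f (take k w) * g (drop k w))"

primrec nc_power :: "nc_series \<Rightarrow> nat \<Rightarrow> nc_series" where
  "nc_power f 0 = nc_one"
| "nc_power f (Suc k) = nc_mult f (nc_power f k)"

text \<open>
  \<open>nc_exp f\<close> is meaningful if \<open>f\<close> has constant term \<open>0\<close>, \<open>nc_log f\<close> if \<open>f\<close> has constant term \<open>1\<close>:
  then powers with exponent beyond the length of \<open>w\<close> have coefficient \<open>0\<close> at \<open>w\<close>.
\<close>

definition nc_exp :: "nc_series \<Rightarrow> nc_series" where
  "nc_exp f w = (\<Sum>k\<le>length w. nc_power f k w / fact k)"

definition nc_log :: "nc_series \<Rightarrow> nc_series" where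
  "nc_log f w =
     (\<Sum>k=1..length w. (- 1) ^ (k + 1) / of_nat k * nc_power (\<lambda>v. f v - nc_one v) k w)"

definition bch_series :: nc_series where
  "bch_series = nc_log (nc_mult (nc_exp (nc_var VX)) (nc_exp (nc_var VY)))"

primrec word_op ::
    "('a::real_normed_vector \<Rightarrow>\<^sub>L 'a) \<Rightarrow> ('a \<Rightarrow>\<^sub>L 'a) \<Rightarrow> bch_var list \<Rightarrow> ('a \<Rightarrow>\<^sub>L 'a)" where
  "word_op x y [] = id_blinfun"
| "word_op x y (a # w) = (case a of VX \<Rightarrow> x | VY \<Rightarrow> y) o\<^sub>L word_op x y w"

text \<open>
  The value at \<open>(x, y)\<close> of the homogeneous component of degree \<open>n\<close>.  Substitution of operators
  for the variables is a homomorphism of associative algebras, so it sends the formal bracket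
  \<open>[P, Q] = P Q - Q P\<close> to \<open>op_bracket\<close>, and a Lie polynomial is evaluated by means of
  \<open>op_bracket\<close>.
\<close>

definition bch_term ::
    "nat \<Rightarrow> ('a::real_normed_vector \<Rightarrow>\<^sub>L 'a) \<Rightarrow> ('a \<Rightarrow>\<^sub>L 'a) \<Rightarrow> ('a \<Rightarrow>\<^sub>L 'a)" where
  "bch_term n x y = (\<Sum>w\<in>{w. length w = n}. real_of_rat (bch_series w) *\<^sub>R word_op x y w)"

text \<open>The limit is sought in the whole ideal, since subalgebras need not be closed in it.\<close>

definition bch_converges ::
    "real \<Rightarrow> ('a::complex_hilbert \<Rightarrow>\<^sub>L 'a) \<Rightarrow> ('a \<Rightarrow>\<^sub>L 'a) \<Rightarrow> bool" where
  "bch_converges p x y \<longleftrightarrow> (\<exists>Z\<in>weak_schatten p.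
     (\<lambda>N. weak_schatten_dist p (\<Sum>n=1..N. bch_term n x y) Z) \<longlonglongrightarrow> 0)"

end

theory Submission
  imports Defs
begin

text \<open>
  The quasi-triangle inequality loses a factor that is exponential in the degree \<open>n\<close> when it is
  applied to the Lie monomials of \<open>Z\<^sub>n\<close>, so the quasi-norm is used only at the very end.

  First, the convex envelope \<open>N\<close> of the quasi-norm on \<open>g\<close> is a genuine seminorm with the same
  bracket constant \<open>B\<close>, and it dominates the operator norm.  Differentiating
  \<open>e\<^sup>Z = e\<^sup>X e\<^sup>Y\<close> with respect to the degree gives
  \<open>((e\<^bsup>ad Z\<^esup> - 1) / ad Z) (D Z) = X + e\<^bsup>ad Z\<^esup> Y\<close>, a recursion for \<open>Z\<^sub>n\<close> in
  terms of brackets only.  A majorant argument yields \<open>\<Sum> \<rho>\<^sup>n \<parallel>Z\<^sub>n\<parallel> < \<infinity>\<close> in operator norm for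
  some \<open>\<rho> > 1\<close> as soon as \<open>B (N x + N y) < 1/4\<close>.

  Second, write \<open>Z + l(Z) Z Z = e\<^sup>X e\<^sup>Y - 1 = a X + b Y\<close> as power series in the degree and split
  \<open>Z = F + (Z - F)\<close> with \<open>F\<close> a polynomial with finite rank coefficients such that
  \<open>u = l(Z) (Z - F)\<close> is small.  Then \<open>Z = V a X + V b Y - V l(Z) F Z\<close> with \<open>V = (1 + u)\<^bsup>-1\<^esup>\<close>
  summable in operator norm.  The first two series converge in the weak Schatten ideal because it
  is an ideal; the partial sums of the third have rank \<open>O(n)\<close>, and the geometric decay of the
  remainder in operator norm beats the resulting polynomial factor.
\<close>

section \<open>Complex Hilbert spaces\<close>

text \<open>Summability in operator norm gives no convergence in the quasi-norm, because the cost of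
  the quasi-triangle inequality grows with the number of summands. The second part is therefore
  arranged so that the number of pieces added in the quasi-norm does not depend on the truncation.
  Each piece has one fixed compact factor: \<open>x\<close> or \<open>y\<close> on the far right, or
  a single finite rank coefficient of \<open>F\<close> in the middle. All other factors are measured
  in operator norm, and the quasi-norm of an individual Z_n is never estimated. The splitting is
  forced: the equation reads (1 + l(Z) Z) Z = a X + b Y, but l(Z) Z need not be small at the given
  radius, so 1 + l(Z) Z need not have an inverse with summable coefficients. Up to finite rank and
  finite degree, however, Z is as small as desired, since its coefficients lie in the ideal. The
  room for a radius above 1 comes from the strict inequality in the smallness condition.\<close>

lemma scaleC_zero_left [simp]: "0 *\<^sub>C u = (0::'a::complex_hilbert)"
  using scaleR_scaleC[of 0 u] by simp

lemma scaleC_zero_right [simp]: "c *\<^sub>C (0::'a::complex_hilbert) = 0"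
  using scaleC_add_right[of c 0 0] by simp

lemma scaleC_minus_right: "c *\<^sub>C (- u) = - (c *\<^sub>C (u::'a::complex_hilbert))"
  using scaleC_add_right[of c u "- u"] by (simp add: eq_neg_iff_add_eq_0 add.commute)

lemma scaleC_diff_right: "c *\<^sub>C (u - v) = c *\<^sub>C u - c *\<^sub>C (v::'a::complex_hilbert)"
  using scaleC_add_right[of c u "- v"] by (simp add: scaleC_minus_right)

lemma scaleC_scaleR_commute: "c *\<^sub>C (r *\<^sub>R u) = r *\<^sub>R (c *\<^sub>C (u::'a::complex_hilbert))"
  by (simp add: scaleR_scaleC scaleC_scaleC mult.commute)

lemma scaleC_sum_right: "c *\<^sub>C (\<Sum>i\<in>I. f i) = (\<Sum>i\<in>I. c *\<^sub>C (f i :: 'a::complex_hilbert))"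
  by (induction I rule: infinite_finite_induct) (auto simp: scaleC_add_right)

lemma cinner_zero_right [simp]: "cinner u (0::'a::complex_hilbert) = 0"
  using cinner_scaleC_right[of u 0 0] by simp

lemma cinner_zero_left [simp]: "cinner (0::'a::complex_hilbert) u = 0"
  by (subst cinner_commute) simp

lemma cinner_add_left: "cinner (u + v) w = cinner u w + cinner v (w::'a::complex_hilbert)"
  by (metis cinner_add_right cinner_commute complex_cnj_add)

lemma cinner_scaleC_left: "cinner (c *\<^sub>C u) v = cnj c * cinner u (v::'a::complex_hilbert)"
  by (metis cinner_commute cinner_scaleC_right complex_cnj_mult)

lemma cinner_minus_right: "cinner u (- v) = - cinner u (v::'a::complex_hilbert)"
  using cinner_add_right[of u v "- v"] by (simp add: eq_neg_iff_add_eq_0 add.commute)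

lemma cinner_diff_right: "cinner u (v - w) = cinner u v - cinner u (w::'a::complex_hilbert)"
  using cinner_add_right[of u v "- w"] by (simp add: cinner_minus_right)

lemma cinner_scaleR_right: "cinner u (r *\<^sub>R v) = r *\<^sub>R cinner u (v::'a::complex_hilbert)"
  by (simp add: scaleR_scaleC cinner_scaleC_right scaleR_conv_of_real)

lemma cinner_sum_right: "cinner u (\<Sum>i\<in>I. f i) = (\<Sum>i\<in>I. cinner u (f i :: 'a::complex_hilbert))"
  by (induction I rule: infinite_finite_induct) (auto simp: cinner_add_right)

lemma cinner_sum_left: "cinner (\<Sum>i\<in>I. f i) u = (\<Sum>i\<in>I. cinner (f i :: 'a::complex_hilbert) u)"
  by (induction I rule: infinite_finite_induct) (auto simp: cinner_add_left)

lemma Re_cinner_self: "Re (cinner u u) = (norm (u::'a::complex_hilbert))\<^sup>2"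
  using cinner_ge_zero[of u] by (simp add: norm_eq_sqrt_cinner)

lemma cinner_self: "cinner u u = complex_of_real ((norm (u::'a::complex_hilbert))\<^sup>2)"
proof (rule complex_eqI)
  show "Im (cinner u u) = Im (complex_of_real ((norm u)\<^sup>2))"
    using arg_cong[OF cinner_commute[of u u], of Im] by simp
qed (simp only: Re_cinner_self Re_complex_of_real)

lemma norm_add_sq:
  "(norm (u + v))\<^sup>2 = (norm u)\<^sup>2 + (norm v)\<^sup>2 + 2 * Re (cinner u (v::'a::complex_hilbert))"
proof -
  have "Re (cinner v u) = Re (cinner u v)"
    by (subst cinner_commute) simp
  then show ?thesis
    by (simp add: Re_cinner_self[symmetric] cinner_add_left cinner_add_right)
qed

lemma parallelogram_law:
  "(norm (u + v))\<^sup>2 + (norm (u - v))\<^sup>2 = 2 * (norm u)\<^sup>2 + 2 * (norm (v::'a::complex_hilbert))\<^sup>2"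
  using norm_add_sq[of u v] norm_add_sq[of u "- v"] by (simp add: cinner_minus_right)

lemma norm_scaleC: "norm (c *\<^sub>C u) = cmod c * norm (u::'a::complex_hilbert)"
proof -
  have "cnj c * c = complex_of_real ((cmod c)\<^sup>2)"
    by (simp add: complex_norm_square mult.commute del: of_real_power)
  then have "cinner (c *\<^sub>C u) (c *\<^sub>C u) = complex_of_real ((cmod c)\<^sup>2 * (norm u)\<^sup>2)"
    by (metis cinner_scaleC_left cinner_scaleC_right cinner_self mult.assoc mult.left_commute of_real_mult)
  then have "(norm (c *\<^sub>C u))\<^sup>2 = (cmod c * norm u)\<^sup>2"
    by (metis Re_cinner_self Re_complex_of_real power_mult_distrib)
  then show ?thesis
    by (simp add: power2_eq_iff_nonneg)
qed

text \<open>The triangle inequality is already part of \<open>banach\<close>, so the usual order is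
  reversed: expanding the squared norm of \<open>u + w\<close> bounds the real part, and a rotation
  of \<open>v\<close> turns the modulus into a real part.\<close>

lemma cinner_Cauchy_Schwarz: "cmod (cinner u v) \<le> norm u * norm (v::'a::complex_hilbert)"
proof -
  have re: "Re (cinner u w) \<le> norm u * norm w" for w :: 'a
  proof -
    have "(norm (u + w))\<^sup>2 \<le> (norm u + norm w)\<^sup>2"
      by (intro power_mono norm_triangle_ineq) auto
    then show ?thesis
      by (simp add: norm_add_sq power2_sum)
  qed
  \<comment> \<open>The phase that makes the inner product real and nonnegative. It is 0 if the
    inner product vanishes, hence only an inequality for the norm of the rotated vector.\<close>
  define c where "c = cnj (sgn (cinner u v))"
  have "cinner u (c *\<^sub>C v) = complex_of_real (cmod (cinner u v))"
    by (cases "cinner u v = 0")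
      (simp_all add: c_def cinner_scaleC_right sgn_eq field_simps complex_norm_square[simplified, symmetric]
        power2_eq_square)
  moreover have "norm (c *\<^sub>C v) \<le> norm v"
    by (simp add: c_def norm_scaleC norm_sgn)
  ultimately show ?thesis
    using re[of "c *\<^sub>C v"] by (smt (verit) Re_complex_of_real mult_left_mono norm_ge_zero)
qed

lemma bounded_linear_cinner: "bounded_linear (cinner (u::'a::complex_hilbert))"
  by (rule bounded_linear_intro[of _ "norm u"])
    (auto simp: cinner_add_right cinner_scaleR_right mult.commute[of "norm _" "norm u"] cinner_Cauchy_Schwarz)

lemma bounded_linear_scaleC: "bounded_linear (scaleC c :: 'a::complex_hilbert \<Rightarrow> 'a)"
  by (rule bounded_linear_intro[of _ "cmod c"])
    (auto simp: scaleC_add_right scaleC_scaleR_commute norm_scaleC mult.commute)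

lemma bounded_linear_scaleC_left: "bounded_linear (\<lambda>c. c *\<^sub>C (u :: 'a::complex_hilbert))"
  by (rule bounded_linear_intro[of _ "norm u"])
    (auto simp: scaleC_add_left scaleR_scaleC scaleC_scaleC norm_scaleC scaleR_conv_of_real)

section \<open>Finite orthonormal families and orthogonal projections\<close>

definition orthonormal :: "nat \<Rightarrow> (nat \<Rightarrow> 'a::complex_hilbert) \<Rightarrow> bool" where
  "orthonormal k e \<longleftrightarrow> (\<forall>i<k. \<forall>j<k. cinner (e i) (e j) = (if i = j then 1 else 0))"

definition orth_proj :: "nat \<Rightarrow> (nat \<Rightarrow> 'a::complex_hilbert) \<Rightarrow> 'a \<Rightarrow>\<^sub>L 'a" where
  "orth_proj k e = Blinfun (\<lambda>v. \<Sum>i<k. cinner (e i) v *\<^sub>C e i)"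

lemma orth_proj_apply: "orth_proj k e v = (\<Sum>i<k. cinner (e i) v *\<^sub>C e i)"
proof -
  have "bounded_linear (\<lambda>v. \<Sum>i<k. cinner (e i) v *\<^sub>C e i)"
    by (intro bounded_linear_sum
        bounded_linear_compose[OF bounded_linear_scaleC_left bounded_linear_cinner])
  then show ?thesis
    by (simp add: orth_proj_def bounded_linear_Blinfun_apply)
qed

lemma cinner_diff_orth_proj:
  assumes "orthonormal k e" "i < k"
  shows "cinner (e i) (v - orth_proj k e v) = 0"
proof -
  have "cinner (e i) (orth_proj k e v) = (\<Sum>j<k. cinner (e j) v * cinner (e i) (e j))"
    by (simp add: orth_proj_apply cinner_sum_right cinner_scaleC_right)
  also have "\<dots> = (\<Sum>j<k. if i = j then cinner (e j) v else 0)"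
    by (rule sum.cong) (use assms in \<open>auto simp: orthonormal_def\<close>)
  also have "\<dots> = cinner (e i) v"
    using assms(2) by simp
  finally show ?thesis
    by (simp add: cinner_diff_right)
qed

lemma norm_diff_orth_proj:
  assumes "orthonormal k e"
  shows "norm (v - orth_proj k e v) \<le> norm v"
proof -
  let ?w = "v - orth_proj k e v"
  have "cinner (orth_proj k e v) ?w = 0"
    using cinner_diff_orth_proj[OF assms]
    by (subst orth_proj_apply) (simp add: cinner_sum_left cinner_scaleC_left)
  then have "(norm v)\<^sup>2 = (norm (orth_proj k e v))\<^sup>2 + (norm ?w)\<^sup>2"
    using norm_add_sq[of "orth_proj k e v" ?w] by simp
  then show ?thesis
    by (smt (verit) norm_ge_zero power2_le_imp_le zero_le_power2)
qed

lemma norm_orthonormal_combination: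
  assumes "orthonormal k e"
  shows "(norm (\<Sum>i<k. c i *\<^sub>C e i))\<^sup>2 = (\<Sum>i<k. (cmod (c i))\<^sup>2)"
proof -
  have "cinner (\<Sum>i<k. c i *\<^sub>C e i) (\<Sum>i<k. c i *\<^sub>C e i)
      = (\<Sum>i<k. \<Sum>j<k. c i * (cnj (c j) * cinner (e j) (e i)))"
    by (simp add: cinner_sum_left cinner_sum_right cinner_scaleC_left cinner_scaleC_right
        sum_distrib_left)
  also have "\<dots> = (\<Sum>i<k. \<Sum>j<k. if i = j then c i * cnj (c j) else 0)"
    by (intro sum.cong refl) (use assms in \<open>auto simp: orthonormal_def\<close>)
  also have "\<dots> = complex_of_real (\<Sum>i<k. (cmod (c i))\<^sup>2)"
    by (simp add: complex_norm_square del: of_real_power)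
  finally show ?thesis
    by (metis Re_cinner_self Re_complex_of_real)
qed

section \<open>Closure properties of complex linear operators\<close>

lemma complex_linear_zero: "complex_linear 0"
  by (simp add: complex_linear_def)

lemma complex_linear_add: "complex_linear S \<Longrightarrow> complex_linear T \<Longrightarrow> complex_linear (S + T)"
  by (simp add: complex_linear_def blinfun.add_left scaleC_add_right)

lemma complex_linear_diff: "complex_linear S \<Longrightarrow> complex_linear T \<Longrightarrow> complex_linear (S - T)"
  by (simp add: complex_linear_def blinfun.diff_left scaleC_diff_right)

lemma complex_linear_scaleR: "complex_linear T \<Longrightarrow> complex_linear (r *\<^sub>R T)"
  by (simp add: complex_linear_def blinfun.scaleR_left scaleC_scaleR_commute)

lemma complex_linear_compose: "complex_linear S \<Longrightarrow> complex_linear T \<Longrightarrow> complex_linear (S o\<^sub>L T)"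
  by (simp add: complex_linear_def)

lemma complex_linear_sum: "(\<And>i. i \<in> I \<Longrightarrow> complex_linear (f i)) \<Longrightarrow> complex_linear (\<Sum>i\<in>I. f i)"
  by (induction I rule: infinite_finite_induct) (auto intro: complex_linear_zero complex_linear_add)

lemma complex_linear_orth_proj: "complex_linear (orth_proj k e)"
  by (simp add: complex_linear_def orth_proj_apply cinner_scaleC_right scaleC_sum_right scaleC_scaleC)

lemma complex_linear_limit:
  fixes T :: "'a::complex_hilbert \<Rightarrow>\<^sub>L 'a"
  assumes "S \<longlonglongrightarrow> T" "\<And>n::nat. complex_linear (S n)"
  shows "complex_linear T"
  unfolding complex_linear_def
proof (intro allI)
  fix c and v :: 'a
  have lim: "(\<lambda>n. S n w) \<longlonglongrightarrow> T w" for w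
    using bounded_linear.tendsto[OF blinfun.bounded_linear_left assms(1)] by simp
  have "(\<lambda>n. S n (c *\<^sub>C v)) = (\<lambda>n. c *\<^sub>C S n v)"
    using assms(2) by (simp add: complex_linear_def)
  then show "T (c *\<^sub>C v) = c *\<^sub>C T v"
    using LIMSEQ_unique[OF lim] bounded_linear.tendsto[OF bounded_linear_scaleC lim] by metis
qed

section \<open>Singular values as approximation numbers\<close>

text \<open>Purely algebraic, without continuity: only the codimension of the common kernel enters
  the dimension counts.\<close>

definition complex_functional :: "('a::complex_hilbert \<Rightarrow> complex) \<Rightarrow> bool" where
  "complex_functional f \<longleftrightarrow> (\<forall>u v. f (u + v) = f u + f v) \<and> (\<forall>c v. f (c *\<^sub>C v) = c * f v)"

text \<open>
  Rank at most \<open>m\<close>, in the form "the kernel has complex codimension at most \<open>m\<close>".  This form is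
  stable under composition on both sides without any reference to adjoints.
\<close>

definition rank_le :: "nat \<Rightarrow> ('a::complex_hilbert \<Rightarrow>\<^sub>L 'a) \<Rightarrow> bool" where
  "rank_le m F \<longleftrightarrow> (\<exists>f. (\<forall>i<m. complex_functional (f i)) \<and> (\<forall>v. (\<forall>i<m. f i v = 0) \<longrightarrow> F v = 0))"

lemma complex_functional_zero: "complex_functional (\<lambda>v. 0)"
  by (simp add: complex_functional_def)

lemma complex_functional_combination:
  fixes n :: nat
  assumes "complex_functional f"
  shows "f (\<Sum>i<n. c i *\<^sub>C e i) = (\<Sum>i<n. c i * f (e i))"
proof (induction n)
  case 0
  have "f (0 *\<^sub>C 0) = 0 * f 0"
    using assms by (simp only: complex_functional_def)
  then show ?case by simp
qed (use assms in \<open>auto simp: complex_functional_def\<close>)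

lemma rank_le_mono:
  assumes "rank_le m F" "m \<le> n"
  shows "rank_le n F"
proof -
  obtain f where f: "\<forall>i<m. complex_functional (f i)" "\<And>v. (\<forall>i<m. f i v = 0) \<Longrightarrow> F v = 0"
    using assms(1) unfolding rank_le_def by blast
  show ?thesis
    unfolding rank_le_def
    by (rule exI[of _ "\<lambda>i. if i < m then f i else (\<lambda>v. 0)"])
      (use f assms(2) in \<open>auto simp: complex_functional_zero\<close>)
qed

lemma rank_le_zero: "rank_le m 0"
  by (auto simp: rank_le_def complex_functional_def intro!: exI[of _ "\<lambda>i v. 0"])

lemma rank_le_add:
  assumes "rank_le m F" "rank_le n G"
  shows "rank_le (m + n) (F + G)"
proof -
  obtain f where f: "\<forall>i<m. complex_functional (f i)" "\<And>v. (\<forall>i<m. f i v = 0) \<Longrightarrow> F v = 0"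
    using assms(1) unfolding rank_le_def by blast
  obtain g where g: "\<forall>i<n. complex_functional (g i)" "\<And>v. (\<forall>i<n. g i v = 0) \<Longrightarrow> G v = 0"
    using assms(2) unfolding rank_le_def by blast
  define h where "h i = (if i < m then f i else g (i - m))" for i
  have "complex_functional (h i)" if "i < m + n" for i
    using that f(1) g(1) by (simp add: h_def)
  moreover have "(F + G) v = 0" if "\<forall>i<m + n. h i v = 0" for v
  proof -
    have "f i v = 0" if "i < m" for i
      using \<open>\<forall>i<m + n. h i v = 0\<close>[rule_format, of i] that by (simp add: h_def)
    moreover have "g i v = 0" if "i < n" for i
      using \<open>\<forall>i<m + n. h i v = 0\<close>[rule_format, of "m + i"] that by (simp add: h_def)
    ultimately show ?thesis
      using f(2) g(2) by (simp add: blinfun.add_left)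
  qed
  ultimately show ?thesis
    unfolding rank_le_def by blast
qed

lemma rank_le_minus: "rank_le m F \<Longrightarrow> rank_le m (- F)"
  by (auto simp: rank_le_def blinfun.minus_left)

lemma rank_le_diff: "rank_le m F \<Longrightarrow> rank_le n G \<Longrightarrow> rank_le (m + n) (F - G)"
  using rank_le_add[OF _ rank_le_minus] by fastforce

lemma rank_le_sum:
  assumes "\<And>i. i < n \<Longrightarrow> rank_le m (F i)"
  shows "rank_le (n * m) (\<Sum>i<n. F i)"
  using assms
proof (induction n)
  case (Suc n)
  then have "rank_le (n * m + m) ((\<Sum>i<n. F i) + F n)"
    by (intro rank_le_add) auto
  then show ?case
    by (simp add: add.commute)
qed (simp add: rank_le_zero)

lemma rank_le_compose_left: "rank_le m F \<Longrightarrow> rank_le m (A o\<^sub>L F)"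
  unfolding rank_le_def by (metis blinfun_apply_blinfun_compose blinfun.zero_right)

text \<open>The functionals are pulled back along \<open>A\<close>, and they stay complex linear
  only if \<open>A\<close> is. Composition on the left leaves the functionals unchanged.\<close>

lemma rank_le_compose_right:
  assumes "rank_le m F" "complex_linear A"
  shows "rank_le m (F o\<^sub>L A)"
proof -
  obtain f where f: "\<forall>i<m. complex_functional (f i)" "\<And>v. (\<forall>i<m. f i v = 0) \<Longrightarrow> F v = 0"
    using assms(1) unfolding rank_le_def by blast
  show ?thesis
    unfolding rank_le_def
    by (rule exI[of _ "\<lambda>i v. f i (A v)"])
      (use f assms(2) in \<open>auto simp: complex_functional_def complex_linear_def blinfun.add_right\<close>)
qed

text \<open>Gaussian elimination: each induction step removes one equation together with one
  unknown.\<close>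

lemma homogeneous_system_solvable:
  fixes a :: "nat \<Rightarrow> 'i \<Rightarrow> 'b::field"
  assumes "finite I" "m < card I"
  shows "\<exists>c. (\<exists>i\<in>I. c i \<noteq> 0) \<and> (\<forall>j<m. (\<Sum>i\<in>I. c i * a j i) = 0)"
  using assms
proof (induction m arbitrary: I a)
  case 0
  then have "I \<noteq> {}" by auto
  then show ?case
    by (auto intro!: exI[of _ "\<lambda>_. 1"])
next
  case (Suc m)
  show ?case
  proof (cases "\<forall>i\<in>I. a m i = 0")
    case True
    obtain c where "\<exists>i\<in>I. c i \<noteq> 0" "\<forall>j<m. (\<Sum>i\<in>I. c i * a j i) = 0"
      using Suc.IH[OF Suc.prems(1), of a] Suc.prems(2) by auto
    with True show ?thesis
      by (auto intro!: exI[of _ c] simp: less_Suc_eq)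
  next
    case False
    then obtain k where k: "k \<in> I" "a m k \<noteq> 0" by blast
    \<comment> \<open>Subtracting a multiple of equation \<open>m\<close> clears the unknown
      \<open>k\<close> from equation \<open>j\<close>.\<close>
    define b where "b j i = a j i - a j k * a m i / a m k" for j i
    have "m < card (I - {k})"
      using Suc.prems k by simp
    then obtain c where c: "\<exists>i\<in>I - {k}. c i \<noteq> 0"
      "\<And>j. j < m \<Longrightarrow> (\<Sum>i\<in>I - {k}. c i * b j i) = 0"
      using Suc.IH[of "I - {k}" b] Suc.prems(1) by blast
    define S where "S = (\<Sum>i\<in>I - {k}. c i * a m i)"
    \<comment> \<open>Back substitution: the value of the unknown \<open>k\<close> that satisfies
      equation \<open>m\<close>.\<close>
    define d where "d = c(k := - S / a m k)"
    have split: "(\<Sum>i\<in>I. d i * a j i) = (\<Sum>i\<in>I - {k}. c i * a j i) - S / a m k * a j k" for j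
    proof -
      have "(\<Sum>i\<in>I. d i * a j i) = d k * a j k + (\<Sum>i\<in>I - {k}. d i * a j i)"
        using Suc.prems(1) k(1) by (rule sum.remove)
      also have "(\<Sum>i\<in>I - {k}. d i * a j i) = (\<Sum>i\<in>I - {k}. c i * a j i)"
        by (rule sum.cong) (auto simp: d_def)
      finally show ?thesis
        by (simp add: d_def)
    qed
    have "(\<Sum>i\<in>I. d i * a j i) = 0" if "j < Suc m" for j
    proof (cases "j = m")
      case True
      then show ?thesis
        using k(2) unfolding split by (simp add: S_def)
    next
      case False
      then have "0 = (\<Sum>i\<in>I - {k}. c i * b j i)"
        using c(2) that by simp
      also have "\<dots> = (\<Sum>i\<in>I - {k}. c i * a j i) - S / a m k * a j k"
        by (simp add: b_def S_def right_diff_distrib sum_subtractf sum_distrib_right sum_divide_distrib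
            sum_distrib_left times_divide_eq_left times_divide_eq_right mult_ac)
      finally show ?thesis
        unfolding split by simp
    qed
    moreover have "\<exists>i\<in>I. d i \<noteq> 0"
      using c(1) by (auto simp: d_def)
    ultimately show ?thesis
      by blast
  qed
qed

text \<open>The span of \<open>n > m\<close> eigenvectors contains a nonzero vector killed by
  \<open>F\<close>. The images \<open>T (e i)\<close> are orthogonal with norms at least
  \<open>s\<close>, so \<open>T\<close>, which agrees with \<open>T - F\<close> on that vector,
  stretches it by at least \<open>s\<close>.\<close>

lemma eigenvalue_le_approximation:
  fixes T :: "'a::complex_hilbert \<Rightarrow>\<^sub>L 'a"
  assumes T: "complex_linear T" and F: "rank_le m F" "m < n" and e: "orthonormal n e"
    and t: "\<And>i. i < n \<Longrightarrow> \<exists>t\<ge>s. e i \<in> abs_eigenspace T t" and "0 < s"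
  shows "s \<le> norm (T - F)"
proof -
  obtain f where f: "\<forall>i<m. complex_functional (f i)" "\<And>v. (\<forall>i<m. f i v = 0) \<Longrightarrow> F v = 0"
    using F(1) unfolding rank_le_def by blast
  obtain c where c: "\<exists>i<n. c i \<noteq> 0" "\<And>j. j < m \<Longrightarrow> (\<Sum>i<n. c i * f j (e i)) = 0"
    using homogeneous_system_solvable[of "{..<n}" m "\<lambda>j i. f j (e i)"] F(2) by auto
  define v where "v = (\<Sum>i<n. c i *\<^sub>C e i)"
  have "F v = 0"
    using f c(2) complex_functional_combination unfolding v_def by metis
  have nv: "(norm v)\<^sup>2 = (\<Sum>i<n. (cmod (c i))\<^sup>2)"
    unfolding v_def by (rule norm_orthonormal_combination[OF e])
  then have "0 < (norm v)\<^sup>2"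
    using c(1) by (auto intro!: sum_pos2)
  then have "0 < norm v" by auto
  obtain t where t: "\<And>i. i < n \<Longrightarrow> s \<le> t i \<and> e i \<in> abs_eigenspace T (t i)"
    using t by metis
  have inner: "cinner (T (e i)) (T w) = complex_of_real ((t i)\<^sup>2) * cinner (e i) w" if "i < n" for i w
    using t[OF that] by (simp add: abs_eigenspace_def)
  have scale: "T v = (\<Sum>i<n. c i *\<^sub>C T (e i))"
    using T by (simp add: v_def complex_linear_def blinfun.sum_right)
  have ort: "cinner (e i) v = c i" if "i < n" for i
  proof -
    have "cinner (e i) v = (\<Sum>j<n. c j * cinner (e i) (e j))"
      by (simp add: v_def cinner_sum_right cinner_scaleC_right)
    also have "\<dots> = (\<Sum>j<n. if i = j then c j else 0)"
      by (rule sum.cong) (use e that in \<open>auto simp: orthonormal_def\<close>)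
    finally show ?thesis using that by simp
  qed
  have "cinner (T v) (T v) = (\<Sum>i<n. cnj (c i) * cinner (T (e i)) (T v))"
    by (subst (1) scale) (simp add: cinner_sum_left cinner_scaleC_left)
  also have "\<dots> = (\<Sum>i<n. complex_of_real ((t i)\<^sup>2 * (cmod (c i))\<^sup>2))"
  proof (rule sum.cong)
    fix i assume "i \<in> {..<n}"
    then have "i < n" by simp
    have "cnj (c i) * c i = complex_of_real ((cmod (c i))\<^sup>2)"
      by (simp add: complex_norm_square mult.commute del: of_real_power)
    then show "cnj (c i) * cinner (T (e i)) (T v) = complex_of_real ((t i)\<^sup>2 * (cmod (c i))\<^sup>2)"
      using inner[OF \<open>i < n\<close>] ort[OF \<open>i < n\<close>] by (simp del: of_real_power)
  qed simp
  finally have "cinner (T v) (T v) = complex_of_real (\<Sum>i<n. (t i)\<^sup>2 * (cmod (c i))\<^sup>2)"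
    by simp
  then have "(norm (T v))\<^sup>2 = (\<Sum>i<n. (t i)\<^sup>2 * (cmod (c i))\<^sup>2)"
    by (metis Re_cinner_self Re_complex_of_real)
  moreover have "s\<^sup>2 * (norm v)\<^sup>2 \<le> (\<Sum>i<n. (t i)\<^sup>2 * (cmod (c i))\<^sup>2)"
    unfolding nv sum_distrib_left
    using t \<open>0 < s\<close> by (intro sum_mono mult_right_mono power_mono) auto
  ultimately have "(s * norm v)\<^sup>2 \<le> (norm (T v))\<^sup>2"
    by (simp add: power_mult_distrib)
  then have "s * norm v \<le> norm (T v)"
    by (rule power2_le_imp_le) simp
  also have "T v = (T - F) v"
    using \<open>F v = 0\<close> by (simp add: blinfun.diff_left)
  also have "norm \<dots> \<le> norm (T - F) * norm v"
    by (rule norm_blinfun)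
  finally show ?thesis
    using \<open>0 < norm v\<close> by simp
qed

definition singular_value_candidates :: "nat \<Rightarrow> ('a::complex_hilbert \<Rightarrow>\<^sub>L 'a) \<Rightarrow> real set" where
  "singular_value_candidates n T = {s. 0 < s \<and>
     (\<exists>e. orthonormal n e \<and> (\<forall>i<n. \<exists>t\<ge>s. e i \<in> abs_eigenspace T t))}"

lemma singular_value_eq: "singular_value n T = Sup (insert 0 (singular_value_candidates n T))"
  by (simp add: singular_value_def singular_value_candidates_def orthonormal_def)

lemma singular_value_le_approximation:
  assumes "rank_le m F" "m < n" "complex_linear T"
  shows "singular_value n T \<le> norm (T - F)"
  unfolding singular_value_eq
  by (rule cSup_least)
    (auto simp: singular_value_candidates_def intro: eigenvalue_le_approximation[OF assms(3,1,2)])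

text \<open>Approximation by 0 gives the upper bound \<open>norm T\<close>. For \<open>n = 0\<close>
  every positive real is a candidate, hence \<open>1 \<le> n\<close>.\<close>

lemma bdd_above_singular_value_candidates:
  assumes "1 \<le> n" "complex_linear T"
  shows "bdd_above (insert 0 (singular_value_candidates n T))"
  using assms eigenvalue_le_approximation[OF assms(2) rank_le_zero, of 0 n]
  by (intro bdd_aboveI[of _ "norm T"]) (auto simp: singular_value_candidates_def)

lemma singular_value_nonneg: "1 \<le> n \<Longrightarrow> complex_linear T \<Longrightarrow> 0 \<le> singular_value n T"
  unfolding singular_value_eq by (intro cSup_upper bdd_above_singular_value_candidates) auto

lemma singular_value_ge:
  assumes "1 \<le> n" "complex_linear T" "0 \<le> s" "orthonormal n e"
    and "\<And>i. i < n \<Longrightarrow> \<exists>t\<ge>s. e i \<in> abs_eigenspace T t"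
  shows "s \<le> singular_value n T"
proof (cases "s = 0")
  case False
  then have "s \<in> singular_value_candidates n T"
    using assms unfolding singular_value_candidates_def by auto
  then show ?thesis
    unfolding singular_value_eq
    by (intro cSup_upper bdd_above_singular_value_candidates assms) auto
qed (use singular_value_nonneg[OF assms(1,2)] in simp)

section \<open>Variational construction of singular vectors\<close>

definition orth_compl :: "nat \<Rightarrow> (nat \<Rightarrow> 'a::complex_hilbert) \<Rightarrow> 'a set" where
  "orth_compl k e = {v. \<forall>i<k. cinner (e i) v = 0}"

text \<open>The supremum runs over the unit ball instead of the sphere, so that the set is nonempty
  and the value is 0 on the zero subspace.\<close>

definition restricted_norm :: "('a::real_normed_vector \<Rightarrow>\<^sub>L 'a) \<Rightarrow> 'a set \<Rightarrow> real" where
  "restricted_norm T M = Sup {norm (T v) | v. v \<in> M \<and> norm v \<le> 1}"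

lemma orth_compl_add: "u \<in> orth_compl k e \<Longrightarrow> v \<in> orth_compl k e \<Longrightarrow> u + v \<in> orth_compl k e"
  by (simp add: orth_compl_def cinner_add_right)

lemma orth_compl_scaleC: "v \<in> orth_compl k e \<Longrightarrow> c *\<^sub>C v \<in> orth_compl k e"
  by (simp add: orth_compl_def cinner_scaleC_right)

lemma orth_compl_scaleR: "v \<in> orth_compl k e \<Longrightarrow> r *\<^sub>R v \<in> orth_compl k e"
  by (simp add: scaleR_scaleC orth_compl_scaleC)

lemma orth_compl_zero: "0 \<in> orth_compl k e"
  by (simp add: orth_compl_def)

lemma closed_orth_compl: "closed (orth_compl k e)"
proof -
  have "orth_compl k e = (\<Inter>i\<in>{..<k}. cinner (e i) -` {0})"
    by (auto simp: orth_compl_def)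
  then show ?thesis
    by (auto intro!: closed_INT closed_vimage
        bounded_linear.linear linear_continuous_on bounded_linear_cinner)
qed

lemma bdd_above_restricted:
  fixes T :: "'a::complex_hilbert \<Rightarrow>\<^sub>L 'a"
  shows "bdd_above {norm (T v) | v. v \<in> M \<and> norm v \<le> 1}"
proof (rule bdd_aboveI)
  fix r assume "r \<in> {norm (T v) | v. v \<in> M \<and> norm v \<le> 1}"
  then obtain v where "r = norm (T v)" "norm v \<le> 1" by blast
  then show "r \<le> norm T"
    using norm_blinfun[of T v] mult_left_mono[of "norm v" 1 "norm T"] by simp
qed

lemma norm_le_restricted_norm:
  fixes T :: "'a::complex_hilbert \<Rightarrow>\<^sub>L 'a"
  assumes "v \<in> orth_compl k e"
  shows "norm (T v) \<le> restricted_norm T (orth_compl k e) * norm v"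
proof (cases "v = 0")
  case False
  have "norm (T ((1 / norm v) *\<^sub>R v)) \<le> restricted_norm T (orth_compl k e)"
    unfolding restricted_norm_def
    by (rule cSup_upper[OF _ bdd_above_restricted])
      (use False orth_compl_scaleR[OF assms] in auto)
  then show ?thesis
    using False by (simp add: blinfun.scaleR_right divide_le_eq)
qed simp

lemma restricted_norm_nonneg: "0 \<le> restricted_norm T (orth_compl k e)"
  unfolding restricted_norm_def
  by (rule cSup_upper2[OF _ _ bdd_above_restricted, of 0]) (auto intro!: exI[of _ 0] orth_compl_zero)

lemma restricted_norm_antimono:
  assumes "orth_compl l f \<subseteq> orth_compl k e"
  shows "restricted_norm T (orth_compl l f) \<le> restricted_norm T (orth_compl k e)"
  unfolding restricted_norm_def
proof (rule cSup_subset_mono[OF _ bdd_above_restricted])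
  have "norm (T 0) \<in> {norm (T v) | v. v \<in> orth_compl l f \<and> norm v \<le> 1}"
    using orth_compl_zero[of l f] by (intro CollectI exI[of _ 0]) auto
  then show "{norm (T v) | v. v \<in> orth_compl l f \<and> norm v \<le> 1} \<noteq> {}" by blast
qed (use assms in blast)

text \<open>
  A maximizing sequence for \<open>\<parallel>T v\<parallel>\<close> over the unit vectors \<open>v\<close> of the complement has, by
  compactness, a subsequence along which \<open>T v\<close> converges; the parallelogram law, applied both to
  \<open>v\<close> and to \<open>T v\<close>, then shows that \<open>v\<close> itself is Cauchy along it.
\<close>

lemma restricted_norm_attained:
  fixes T :: "'a::complex_hilbert \<Rightarrow>\<^sub>L 'a"
  assumes "compact_op T" and pos: "0 < restricted_norm T (orth_compl k e)"
  obtains u where "u \<in> orth_compl k e" "norm u = 1" "norm (T u) = restricted_norm T (orth_compl k e)"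
proof -
  define M where "M = orth_compl k e"
  define c where "c = restricted_norm T M"
  have c: "0 < c" using pos by (simp add: c_def M_def)
  have bound: "norm (T v) \<le> c * norm v" if "v \<in> M" for v
    using norm_le_restricted_norm that by (simp add: c_def M_def)
  \<comment> \<open>The denominator is at least 2, so the lower bound is positive; hence the vector
    found is nonzero and can be normalised.\<close>
  have "\<exists>v\<in>M. norm v = 1 \<and> c - c / (real n + 2) < norm (T v)" for n :: nat
  proof -
    have "c - c / (real n + 2) < c" using c by simp
    moreover have "norm (T 0) \<in> {norm (T v) | v. v \<in> M \<and> norm v \<le> 1}"
      using orth_compl_zero[of k e] unfolding M_def by (intro CollectI exI[of _ 0]) auto
    ultimately obtain v where v: "v \<in> M" "norm v \<le> 1" "c - c / (real n + 2) < norm (T v)"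
      using less_cSupD[of "{norm (T v) | v. v \<in> M \<and> norm v \<le> 1}" "c - c / (real n + 2)"]
      unfolding c_def restricted_norm_def by blast
    have "0 < c - c / (real n + 2)"
      using c by (simp add: field_simps add_pos_nonneg)
    then have "v \<noteq> 0" using v(3) by auto
    have "norm (T v) \<le> norm (T ((1 / norm v) *\<^sub>R v))"
      using v(2) \<open>v \<noteq> 0\<close> by (simp add: blinfun.scaleR_right le_divide_eq mult_left_le)
    then show ?thesis
      using v \<open>v \<noteq> 0\<close> orth_compl_scaleR unfolding M_def
      by (intro bexI[of _ "(1 / norm v) *\<^sub>R v"]) auto
  qed
  then obtain v where v: "\<And>n. v n \<in> M" "\<And>n. norm (v n) = 1"
    "\<And>n. c - c / (real n + 2) < norm (T (v n))"
    by metis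
  have compact: "compact (closure (T ` cball 0 1))"
    using assms(1) by (simp add: compact_op_def)
  have "T (v n) \<in> closure (T ` cball 0 1)" for n
    by (rule subsetD[OF closure_subset]) (use v(2) in auto)
  then obtain r l where r: "strict_mono (r :: nat \<Rightarrow> nat)" "(\<lambda>n. T (v (r n))) \<longlonglongrightarrow> l"
    using compact[unfolded compact_def, rule_format, of "\<lambda>n. T (v n)"] by (auto simp: comp_def)
  define w where "w n = v (r n)" for n
  have w: "w n \<in> M" "norm (w n) = 1" "norm (T (w n)) \<le> c" for n
    using v bound[of "w n"] by (auto simp: w_def)
  have "(\<lambda>n. norm (T (v n))) \<longlonglongrightarrow> c"
  proof (rule tendsto_sandwich)
    show "(\<lambda>n. c - c / (real n + 2)) \<longlonglongrightarrow> c"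
      by real_asymp
    show "\<forall>\<^sub>F n in sequentially. norm (T (v n)) \<le> c"
      using bound[OF v(1)] v(2) by simp
  qed (use v(3) less_imp_le in \<open>auto intro: always_eventually\<close>)
  then have lim: "(\<lambda>n. norm (T (w n))) \<longlonglongrightarrow> c"
    unfolding w_def using LIMSEQ_subseq_LIMSEQ[OF _ r(1)] by (auto simp: comp_def)
  have "Cauchy w"
  proof (rule metric_CauchyI)
    fix \<epsilon> :: real assume "0 < \<epsilon>"
    \<comment> \<open>The parallelogram law below yields c^2 |w m - w n|^2 < 5 delta, so dividing by
      8 is enough.\<close>
    define \<delta> where "\<delta> = c\<^sup>2 * \<epsilon>\<^sup>2 / 8"
    have "0 < \<delta>" using c \<open>0 < \<epsilon>\<close> by (simp add: \<delta>_def)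
    have "(\<lambda>n. (norm (T (w n)))\<^sup>2) \<longlonglongrightarrow> c\<^sup>2"
      by (intro tendsto_intros lim)
    then have "\<forall>\<^sub>F n in sequentially. c\<^sup>2 - \<delta> < (norm (T (w n)))\<^sup>2"
      using \<open>0 < \<delta>\<close> by (intro order_tendstoD) auto
    then obtain N1 where N1: "\<And>n. n \<ge> N1 \<Longrightarrow> c\<^sup>2 - \<delta> < (norm (T (w n)))\<^sup>2"
      unfolding eventually_sequentially by blast
    have "Cauchy (\<lambda>n. T (w n))"
      using r(2) by (auto simp: w_def intro: convergent_Cauchy convergentI)
    then obtain N2 where N2: "\<And>m n. m \<ge> N2 \<Longrightarrow> n \<ge> N2 \<Longrightarrow> dist (T (w m)) (T (w n)) < sqrt \<delta>"
      using \<open>0 < \<delta>\<close> unfolding Cauchy_def by (metis real_sqrt_gt_zero)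
    have "dist (w m) (w n) < \<epsilon>" if "m \<ge> max N1 N2" "n \<ge> max N1 N2" for m n
    proof -
      have "norm (T (w m - w n)) < sqrt \<delta>"
        using N2[of m n] that by (simp add: dist_norm blinfun.diff_right)
      then have "(norm (T (w m - w n)))\<^sup>2 < \<delta>"
        using \<open>0 < \<delta>\<close> by (metis norm_ge_zero real_less_rsqrt real_sqrt_less_iff real_sqrt_power
          real_sqrt_abs abs_norm_cancel)
      moreover have "(norm (T (w m + w n)))\<^sup>2 \<le> (c * norm (w m + w n))\<^sup>2"
        using w(1) unfolding M_def
        by (intro power_mono bound) (auto simp: M_def orth_compl_add)
      moreover have "c\<^sup>2 - \<delta> < (norm (T (w m)))\<^sup>2" "c\<^sup>2 - \<delta> < (norm (T (w n)))\<^sup>2"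
        using N1 that by auto
      moreover have "(norm (T (w m + w n)))\<^sup>2 + (norm (T (w m - w n)))\<^sup>2
          = 2 * (norm (T (w m)))\<^sup>2 + 2 * (norm (T (w n)))\<^sup>2"
        by (simp add: parallelogram_law blinfun.add_right blinfun.diff_right)
      moreover have "(norm (w m + w n))\<^sup>2 = 4 - (norm (w m - w n))\<^sup>2"
        using parallelogram_law[of "w m" "w n"] w(2) by simp
      ultimately have "4 * c\<^sup>2 - 5 * \<delta> < c\<^sup>2 * (4 - (norm (w m - w n))\<^sup>2)"
        by (simp add: power_mult_distrib)
      then have "8 * (norm (w m - w n))\<^sup>2 < 5 * \<epsilon>\<^sup>2"
        using c by (simp add: \<delta>_def algebra_simps)
      then have "(norm (w m - w n))\<^sup>2 < \<epsilon>\<^sup>2"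
        using zero_le_power2[of \<epsilon>] by linarith
      then show ?thesis
        using \<open>0 < \<epsilon>\<close> power2_less_imp_less[of "norm (w m - w n)" \<epsilon>] by (simp add: dist_norm)
    qed
    then show "\<exists>M. \<forall>m\<ge>M. \<forall>n\<ge>M. dist (w m) (w n) < \<epsilon>" by blast
  qed
  then obtain u where u: "w \<longlonglongrightarrow> u"
    using Cauchy_convergent convergent_def by blast
  have "u \<in> M"
    using closed_orth_compl u w(1) unfolding M_def closed_sequential_limits by blast
  moreover have "norm u = 1"
    using tendsto_norm[OF u] w(2) by (simp add: LIMSEQ_const_iff)
  moreover have "norm (T u) = c"
    using LIMSEQ_unique[OF lim tendsto_norm[OF blinfun.tendsto[OF tendsto_const u]]] by simp
  ultimately show ?thesis
    using that by (simp add: M_def c_def)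
qed

text \<open>First-order condition at a maximum of \<open>norm (T v) / norm v\<close>. Complex
  multiples of \<open>w\<close> are varied in order to kill both the real and the imaginary part of
  the defect \<open>d\<close>.\<close>

lemma eigenvector_if_maximal:
  fixes T :: "'a::complex_hilbert \<Rightarrow>\<^sub>L 'a"
  assumes T: "complex_linear T"
    and bound: "\<And>z. norm (T (u + z *\<^sub>C w)) \<le> c * norm (u + z *\<^sub>C w)"
    and max: "norm (T u) = c * norm u"
  shows "cinner (T u) (T w) = complex_of_real (c\<^sup>2) * cinner u w"
proof -
  define d where "d = cinner (T u) (T w) - complex_of_real (c\<^sup>2) * cinner u w"
  define K where "K = (norm (T w))\<^sup>2 - c\<^sup>2 * (norm w)\<^sup>2"
  have ineq: "2 * Re (z * d) + (cmod z)\<^sup>2 * K \<le> 0" for z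
  proof -
    have "(norm (T (u + z *\<^sub>C w)))\<^sup>2 \<le> (c * norm (u + z *\<^sub>C w))\<^sup>2"
      by (intro power_mono bound) simp
    moreover have "T (u + z *\<^sub>C w) = T u + z *\<^sub>C T w"
      using T by (simp add: blinfun.add_right complex_linear_def)
    moreover have "Re (z * d) = Re (z * cinner (T u) (T w)) - c\<^sup>2 * Re (z * cinner u w)"
      by (simp add: d_def algebra_simps del: of_real_power)
    ultimately show ?thesis
      by (simp add: norm_add_sq cinner_scaleC_right norm_scaleC power_mult_distrib K_def max algebra_simps)
  qed
  have "d = 0"
  proof (rule ccontr)
    assume "d \<noteq> 0"
    \<comment> \<open>Along \<open>z = r * cnj d\<close> the positive linear term dominates the
      quadratic one, because \<open>r * \<bar>K\<bar> < 1\<close>.\<close>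
    define r where "r = 1 / (\<bar>K\<bar> + 1)"
    have r: "0 < r" "r * \<bar>K\<bar> < 1"
      by (auto simp: r_def field_simps)
    have "cnj d * d = complex_of_real ((cmod d)\<^sup>2)"
      by (simp add: complex_norm_square mult.commute del: of_real_power)
    then have "Re (complex_of_real r * cnj d * d) = r * (cmod d)\<^sup>2"
      by (simp add: mult.assoc del: of_real_power)
    moreover have "(cmod (complex_of_real r * cnj d))\<^sup>2 = r\<^sup>2 * (cmod d)\<^sup>2"
      using r(1) by (simp add: norm_mult power_mult_distrib)
    ultimately have "r * (cmod d)\<^sup>2 * (2 + r * K) \<le> 0"
      using ineq[of "complex_of_real r * cnj d"] by (simp add: algebra_simps power2_eq_square)
    moreover have "- (r * K) \<le> r * \<bar>K\<bar>"
      using r(1) by (metis abs_ge_minus_self mult_left_mono mult_minus_right less_imp_le)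
    then have "0 < 2 + r * K"
      using r(2) by linarith
    ultimately show False
      using r(1) \<open>d \<noteq> 0\<close> by (simp add: mult_le_0_iff)
  qed
  then show ?thesis
    by (simp add: d_def)
qed

text \<open>The maximizer \<open>u\<close> on the complement satisfies the eigenvector equation
  against the complement by \<open>eigenvector_if_maximal\<close>. Against each \<open>e i\<close>
  both sides vanish, because \<open>e i\<close> is an eigenvector orthogonal to \<open>u\<close> and
  so \<open>T (e i)\<close> is orthogonal to \<open>T u\<close>.\<close>

lemma next_singular_vector:
  fixes T :: "'a::complex_hilbert \<Rightarrow>\<^sub>L 'a"
  assumes T: "complex_linear T" "compact_op T" and e: "orthonormal k e"
    and eig: "\<And>i. i < k \<Longrightarrow> \<exists>t. e i \<in> abs_eigenspace T t"
    and pos: "0 < restricted_norm T (orth_compl k e)"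
  obtains u where "orthonormal (Suc k) (e(k := u))"
    "u \<in> abs_eigenspace T (restricted_norm T (orth_compl k e))"
proof -
  define M where "M = orth_compl k e"
  define c where "c = restricted_norm T M"
  obtain u where u: "u \<in> M" "norm u = 1" "norm (T u) = c"
    using restricted_norm_attained[OF T(2) pos] unfolding M_def c_def by metis
  have "cinner (T u) (T v) = complex_of_real (c\<^sup>2) * cinner u v" for v
  proof -
    define w where "w = v - orth_proj k e v"
    have "w \<in> M"
      using cinner_diff_orth_proj[OF e] by (simp add: M_def w_def orth_compl_def)
    then have "norm (T (u + z *\<^sub>C w)) \<le> c * norm (u + z *\<^sub>C w)" for z
      unfolding c_def M_def
      by (intro norm_le_restricted_norm orth_compl_add orth_compl_scaleC)
        (use u(1) in \<open>auto simp: M_def\<close>)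
    then have w: "cinner (T u) (T w) = complex_of_real (c\<^sup>2) * cinner u w"
      by (rule eigenvector_if_maximal[OF T(1)]) (simp add: u)
    have 0: "cinner u (e i) = 0 \<and> cinner (T u) (T (e i)) = 0" if "i < k" for i
    proof -
      have "cinner (e i) u = 0"
        using u(1) that by (simp add: M_def orth_compl_def)
      moreover have "cinner (T (e i)) (T u) = 0"
        using eig[OF that] calculation by (auto simp: abs_eigenspace_def)
      ultimately show ?thesis
        by (metis cinner_commute complex_cnj_zero)
    qed
    have "cinner u (orth_proj k e v) = 0"
      using 0 by (simp add: orth_proj_apply cinner_sum_right cinner_scaleC_right)
    moreover have "T (orth_proj k e v) = (\<Sum>i<k. cinner (e i) v *\<^sub>C T (e i))"
      using T(1) by (simp add: orth_proj_apply complex_linear_def blinfun.sum_right)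
    then have "cinner (T u) (T (orth_proj k e v)) = 0"
      using 0 by (simp add: cinner_sum_right cinner_scaleC_right)
    ultimately show ?thesis
      using w by (simp add: w_def blinfun.diff_right cinner_diff_right)
  qed
  then have "u \<in> abs_eigenspace T c"
    by (simp add: abs_eigenspace_def)
  moreover have "cinner u (e i) = 0" "cinner (e i) u = 0" if "i < k" for i
    using u(1) that cinner_commute[of u "e i"] by (auto simp: M_def orth_compl_def)
  then have "orthonormal (Suc k) (e(k := u))"
    using e u(2) by (auto simp: orthonormal_def less_Suc_eq cinner_self)
  ultimately show ?thesis
    using that unfolding c_def M_def by blast
qed

text \<open>Greedy construction. The recorded lower bound for the eigenvalues is the norm of
  \<open>T\<close> on the remaining complement; it can only decrease, so it survives each new
  vector. The construction stops early once \<open>T\<close> vanishes on the complement.\<close>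

lemma singular_vectors_exist:
  fixes T :: "'a::complex_hilbert \<Rightarrow>\<^sub>L 'a"
  assumes T: "complex_linear T" "compact_op T"
  shows "\<exists>k\<le>m. \<exists>e. orthonormal k e
    \<and> (\<forall>i<k. \<exists>t\<ge>restricted_norm T (orth_compl k e). e i \<in> abs_eigenspace T t)
    \<and> (k = m \<or> restricted_norm T (orth_compl k e) = 0)"
proof (induction m)
  case 0
  show ?case by (auto simp: orthonormal_def)
next
  case (Suc m)
  then obtain k e where k: "k \<le> m" "orthonormal k e"
    "\<And>i. i < k \<Longrightarrow> \<exists>t\<ge>restricted_norm T (orth_compl k e). e i \<in> abs_eigenspace T t"
    "k = m \<or> restricted_norm T (orth_compl k e) = 0"
    by blast
  show ?case
  proof (cases "restricted_norm T (orth_compl k e) = 0")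
    case True
    then show ?thesis
      using k(1-3) by (intro exI[of _ k] conjI exI[of _ e]) auto
  next
    case False
    then have "k = m" and pos: "0 < restricted_norm T (orth_compl k e)"
      using k(4) restricted_norm_nonneg[of T k e] by auto
    obtain u where u: "orthonormal (Suc k) (e(k := u))"
      "u \<in> abs_eigenspace T (restricted_norm T (orth_compl k e))"
      using next_singular_vector[OF T k(2) _ pos] k(3) by blast
    define e' where "e' = e(k := u)"
    have "orth_compl (Suc k) e' \<subseteq> orth_compl k e"
      by (auto simp: orth_compl_def e'_def less_Suc_eq)
    then have "restricted_norm T (orth_compl (Suc k) e') \<le> restricted_norm T (orth_compl k e)"
      by (rule restricted_norm_antimono)
    then have "\<exists>t\<ge>restricted_norm T (orth_compl (Suc k) e'). e' i \<in> abs_eigenspace T t" if "i < Suc k" for i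
      using that u(2) k(3)[of i] by (cases "i = k") (auto simp: e'_def intro: order_trans)
    then show ?thesis
      using u(1) \<open>k = m\<close> unfolding e'_def by (intro exI[of _ "Suc k"]) auto
  qed
qed

text \<open>Truncated singular value decomposition: the error is \<open>T\<close> on the complement
  of the chosen vectors. If its norm \<open>c\<close> there is positive, one further singular vector
  gives \<open>Suc m\<close> eigenvectors with eigenvalues at least \<open>c\<close>. Together with
  \<open>singular_value_le_approximation\<close> this turns singular values into distances to
  operators of bounded rank, and the rest of the proof needs no spectral theory.\<close>

theorem singular_value_attains_approximation:
  fixes T :: "'a::complex_hilbert \<Rightarrow>\<^sub>L 'a"
  assumes T: "complex_linear T" "compact_op T"
  obtains F where "rank_le m F" "complex_linear F" "norm (T - F) \<le> singular_value (Suc m) T"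
proof -
  obtain k e where k: "k \<le> m" "orthonormal k e"
    "\<And>i. i < k \<Longrightarrow> \<exists>t\<ge>restricted_norm T (orth_compl k e). e i \<in> abs_eigenspace T t"
    "k = m \<or> restricted_norm T (orth_compl k e) = 0"
    using singular_vectors_exist[OF T, of m] by blast
  define c where "c = restricted_norm T (orth_compl k e)"
  define F where "F = T o\<^sub>L orth_proj k e"
  have "c \<le> singular_value (Suc m) T"
  proof (cases "c = 0")
    case True
    then show ?thesis
      using singular_value_nonneg[OF _ T(1), of "Suc m"] by simp
  next
    case False
    then have "k = m" and pos: "0 < c"
      using k(4) restricted_norm_nonneg[of T k e] by (auto simp: c_def)
    obtain u where u: "orthonormal (Suc k) (e(k := u))" "u \<in> abs_eigenspace T c"
      using next_singular_vector[OF T k(2)] k(3) pos unfolding c_def by blast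
    show ?thesis
      using u k(3) \<open>k = m\<close> pos
      by (intro singular_value_ge[of _ _ _ "e(k := u)"] T) (auto simp: c_def less_Suc_eq)
  qed
  moreover have "norm (T - F) \<le> c"
  proof (rule norm_blinfun_bound)
    show "0 \<le> c" unfolding c_def by (rule restricted_norm_nonneg)
    fix v
    have "(T - F) v = T (v - orth_proj k e v)"
      by (simp add: F_def blinfun.diff_left blinfun.diff_right)
    also have "norm \<dots> \<le> c * norm (v - orth_proj k e v)"
      unfolding c_def
      by (rule norm_le_restricted_norm) (simp add: orth_compl_def cinner_diff_orth_proj k(2))
    also have "\<dots> \<le> c * norm v"
      using norm_diff_orth_proj[OF k(2)] \<open>0 \<le> c\<close> by (rule mult_left_mono)
    finally show "norm ((T - F) v) \<le> c * norm v" .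
  qed
  moreover have "rank_le k (orth_proj k e)"
    unfolding rank_le_def
    by (rule exI[of _ "\<lambda>i. cinner (e i)"])
      (simp add: complex_functional_def cinner_add_right cinner_scaleC_right orth_proj_apply)
  then have "rank_le m F"
    using rank_le_compose_left rank_le_mono k(1) unfolding F_def by blast
  moreover have "complex_linear F"
    unfolding F_def by (intro complex_linear_compose T complex_linear_orth_proj)
  ultimately show ?thesis
    using that[of F] by linarith
qed

section \<open>Weak Schatten ideals\<close>

interpretation blinfun_compose: bounded_bilinear blinfun_compose
  by (rule bounded_bilinear_blinfun_compose)

text \<open>The distance to rank at most \<open>k\<close> is the singular value of index
  \<open>Suc k\<close>, whence the shift. Bounds in this form pass directly to sums and to products
  with bounded operators.\<close>

definition weak_approx :: "real \<Rightarrow> real \<Rightarrow> ('a::complex_hilbert \<Rightarrow>\<^sub>L 'a) \<Rightarrow> bool" where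
  "weak_approx p c T \<longleftrightarrow> (\<forall>k. \<exists>F. rank_le k F \<and> norm (T - F) \<le> c * real (Suc k) powr (- 1 / p))"

text \<open>The decay bound makes the supremum in the quasi-norm that of a bounded set. It is
  assumed instead of membership in the ideal so that \<open>weak_null_limit\<close> can use the
  lemma for \<open>S N - Z\<close>.\<close>

lemma weak_norm_bound:
  assumes "0 < p" "complex_linear T" "\<And>n. 1 \<le> n \<Longrightarrow> singular_value n T \<le> c * real n powr (- 1 / p)"
  shows "1 \<le> n \<Longrightarrow> singular_value n T \<le> weak_schatten_norm p T * real n powr (- 1 / p)"
    and "0 \<le> weak_schatten_norm p T"
proof -
  have "real n powr (1 / p) * singular_value n T \<le> c" if "n \<ge> 1" for n
  proof -
    have "real n powr (1 / p) * singular_value n T \<le> real n powr (1 / p) * (c * real n powr (- 1 / p))"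
      using assms(3)[OF that] by (rule mult_left_mono) simp
    also have "\<dots> = c"
      using that by (simp add: powr_minus field_simps)
    finally show ?thesis .
  qed
  then have "bdd_above ((\<lambda>n. real n powr (1 / p) * singular_value n T) ` {1..})"
    by (intro bdd_aboveI[of _ c]) auto
  then have "real n powr (1 / p) * singular_value n T \<le> weak_schatten_norm p T" if "1 \<le> n" for n
    unfolding weak_schatten_norm_def by (rule cSUP_upper[rotated]) (use that in auto)
  then show le: "singular_value n T \<le> weak_schatten_norm p T * real n powr (- 1 / p)" if "1 \<le> n" for n
    using that by (simp add: powr_minus field_simps)
  show "0 \<le> weak_schatten_norm p T"
    using le[of 1] singular_value_nonneg[OF _ assms(2), of 1] by simp
qed

lemma singular_value_le_weak_norm:
  assumes "0 < p" "T \<in> weak_schatten p" "1 \<le> n"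
  shows "singular_value n T \<le> weak_schatten_norm p T * real n powr (- 1 / p)"
  using assms weak_norm_bound(1)[OF assms(1)] by (auto simp: weak_schatten_def)

lemma weak_schatten_norm_nonneg:
  assumes "0 < p" "T \<in> weak_schatten p"
  shows "0 \<le> weak_schatten_norm p T"
  using assms weak_norm_bound(2)[OF assms(1)] by (auto simp: weak_schatten_def)

lemma weak_schatten_norm_le:
  assumes "\<And>n. 1 \<le> n \<Longrightarrow> singular_value n T \<le> c * real n powr (- 1 / p)"
  shows "weak_schatten_norm p T \<le> c"
  unfolding weak_schatten_norm_def
proof (rule cSUP_least)
  fix n :: nat assume "n \<in> {1..}"
  then have "real n powr (1 / p) * singular_value n T \<le> real n powr (1 / p) * (c * real n powr (- 1 / p))"
    by (intro mult_left_mono assms) auto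
  then show "real n powr (1 / p) * singular_value n T \<le> c"
    using \<open>n \<in> {1..}\<close> by (simp add: powr_minus field_simps)
qed auto

lemma weak_approx_weak_schatten:
  assumes "0 < p" "T \<in> weak_schatten p"
  shows "weak_approx p (weak_schatten_norm p T) T"
  unfolding weak_approx_def
proof
  fix k
  have "complex_linear T" "compact_op T"
    using assms(2) by (auto simp: weak_schatten_def)
  from singular_value_attains_approximation[OF this, of k]
  show "\<exists>F. rank_le k F \<and> norm (T - F) \<le> weak_schatten_norm p T * real (Suc k) powr (- 1 / p)"
    using singular_value_le_weak_norm[OF assms, of "Suc k"] by (metis le_add1 order_trans plus_1_eq_Suc)
qed

lemma singular_value_le_weak_approx:
  assumes "complex_linear T" "weak_approx p c T" "1 \<le> n"
  shows "singular_value n T \<le> c * real n powr (- 1 / p)"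
proof -
  obtain k where k: "n = Suc k"
    using assms(3) by (cases n) auto
  then obtain F where "rank_le k F" "norm (T - F) \<le> c * real n powr (- 1 / p)"
    using assms(2) unfolding weak_approx_def by blast
  then show ?thesis
    using singular_value_le_approximation[of k F n T] assms(1) k by fastforce
qed

lemma weak_schatten_norm_le_weak_approx:
  "complex_linear T \<Longrightarrow> weak_approx p c T \<Longrightarrow> weak_schatten_norm p T \<le> c"
  by (intro weak_schatten_norm_le singular_value_le_weak_approx)

lemma rank_le_0: "rank_le 0 F \<Longrightarrow> F = 0"
  by (auto simp: rank_le_def intro: blinfun_eqI)

text \<open>The case of rank 0, where the approximant is 0 and the weight is 1.\<close>

lemma norm_le_weak_approx: "weak_approx p c T \<Longrightarrow> norm T \<le> c"
  unfolding weak_approx_def using rank_le_0 by (metis diff_zero mult.right_neutral of_nat_1 One_nat_def powr_one_eq_one)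

lemma norm_le_weak_schatten_norm: "0 < p \<Longrightarrow> T \<in> weak_schatten p \<Longrightarrow> norm T \<le> weak_schatten_norm p T"
  by (rule norm_le_weak_approx[OF weak_approx_weak_schatten])

lemma weak_approx_mono:
  assumes "weak_approx p c T" "c \<le> d"
  shows "weak_approx p d T"
  using assms unfolding weak_approx_def by (meson mult_right_mono order_trans powr_ge_zero)

lemma weak_approx_zero: "0 \<le> c \<Longrightarrow> weak_approx p c 0"
  by (auto simp: weak_approx_def intro!: exI[of _ 0] rank_le_zero)

lemma weak_approx_compose_left:
  assumes "weak_approx p c T"
  shows "weak_approx p (norm A * c) (A o\<^sub>L T)"
  unfolding weak_approx_def
proof
  fix k
  obtain F where F: "rank_le k F" "norm (T - F) \<le> c * real (Suc k) powr (- 1 / p)"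
    using assms unfolding weak_approx_def by blast
  have "norm ((A o\<^sub>L T) - (A o\<^sub>L F)) = norm (A o\<^sub>L (T - F))"
    by (simp add: blinfun_compose.diff_right)
  also have "\<dots> \<le> norm A * norm (T - F)"
    by (rule norm_blinfun_compose)
  also have "\<dots> \<le> norm A * (c * real (Suc k) powr (- 1 / p))"
    using F(2) by (rule mult_left_mono) simp
  finally show "\<exists>F. rank_le k F \<and> norm ((A o\<^sub>L T) - F) \<le> norm A * c * real (Suc k) powr (- 1 / p)"
    using rank_le_compose_left[OF F(1)] by (auto simp: mult.assoc)
qed

lemma weak_approx_scaleR:
  assumes "weak_approx p c T"
  shows "weak_approx p (\<bar>r\<bar> * c) (r *\<^sub>R T)"
proof -
  have "weak_approx p (norm (r *\<^sub>R id_blinfun :: 'a \<Rightarrow>\<^sub>L 'a) * c) ((r *\<^sub>R id_blinfun) o\<^sub>L T)"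
    by (rule weak_approx_compose_left[OF assms])
  moreover have "(r *\<^sub>R id_blinfun) o\<^sub>L T = r *\<^sub>R T"
    by (rule blinfun_eqI) (simp add: blinfun.scaleR_left)
  moreover have "norm (r *\<^sub>R id_blinfun :: 'a \<Rightarrow>\<^sub>L 'a) * c \<le> \<bar>r\<bar> * c"
    using norm_le_weak_approx[OF assms] norm_blinfun_id_le[where 'a='a]
      order_trans[OF norm_ge_zero norm_le_weak_approx[OF assms]]
    by (auto intro!: mult_right_mono mult_left_le)
  ultimately show ?thesis
    using weak_approx_mono by metis
qed

lemma weak_approx_add:
  assumes S: "weak_approx p c S" and T: "weak_approx p d T" and "0 < p"
  shows "weak_approx p (2 powr (1 / p) * (c + d)) (S + T)"
  unfolding weak_approx_def
proof
  fix k :: nat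
  \<comment> \<open>Each summand receives half of the rank; \<open>Suc k \<le> 2 * Suc j\<close>
    produces the factor \<open>2 powr (1 / p)\<close>.\<close>
  define j where "j = k div 2"
  obtain F where F: "rank_le j F" "norm (S - F) \<le> c * real (Suc j) powr (- 1 / p)"
    using S unfolding weak_approx_def by blast
  obtain G where G: "rank_le j G" "norm (T - G) \<le> d * real (Suc j) powr (- 1 / p)"
    using T unfolding weak_approx_def by blast
  have "0 \<le> c" "0 \<le> d"
    using norm_le_weak_approx[OF S] norm_le_weak_approx[OF T] norm_ge_zero order_trans by blast+
  have "(2 * real (Suc j)) powr (- 1 / p) \<le> real (Suc k) powr (- 1 / p)"
    using \<open>0 < p\<close> by (intro powr_mono2') (auto simp: j_def)
  then have "2 powr (1 / p) * (2 powr (- 1 / p) * real (Suc j) powr (- 1 / p))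
      \<le> 2 powr (1 / p) * real (Suc k) powr (- 1 / p)"
    by (intro mult_left_mono) (simp_all only: powr_mult powr_ge_zero)
  moreover have "2 powr (1 / p) * (2::real) powr (- 1 / p) = 1"
    by (simp add: powr_add[symmetric])
  ultimately have "real (Suc j) powr (- 1 / p) \<le> 2 powr (1 / p) * real (Suc k) powr (- 1 / p)"
    by (metis mult.assoc mult_1)
  then have "(c + d) * real (Suc j) powr (- 1 / p) \<le> (c + d) * (2 powr (1 / p) * real (Suc k) powr (- 1 / p))"
    using \<open>0 \<le> c\<close> \<open>0 \<le> d\<close> by (intro mult_left_mono) auto
  moreover have "norm ((S + T) - (F + G)) \<le> norm (S - F) + norm (T - G)"
    using norm_triangle_ineq[of "S - F" "T - G"] by (simp add: algebra_simps)
  ultimately have "norm ((S + T) - (F + G)) \<le> 2 powr (1 / p) * (c + d) * real (Suc k) powr (- 1 / p)"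
    using F(2) G(2) by (simp add: algebra_simps)
  moreover have "rank_le k (F + G)"
    by (rule rank_le_mono[OF rank_le_add[OF F(1) G(1)]]) (simp add: j_def)
  ultimately show "\<exists>F. rank_le k F \<and> norm ((S + T) - F) \<le> 2 powr (1 / p) * (c + d) * real (Suc k) powr (- 1 / p)"
    by blast
qed

text \<open>Below rank \<open>m\<close> the approximant is 0, from \<open>m\<close> on it is
  \<open>T\<close>. Passing from the operator norm to the quasi-norm thus costs only a power of the
  rank.\<close>

lemma weak_approx_rank:
  assumes "rank_le m T" "0 < p"
  shows "weak_approx p (norm T * real m powr (1 / p)) T"
  unfolding weak_approx_def
proof
  fix k :: nat
  show "\<exists>F. rank_le k F \<and> norm (T - F) \<le> norm T * real m powr (1 / p) * real (Suc k) powr (- 1 / p)"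
  proof (cases "m \<le> k")
    case True
    then show ?thesis
      using rank_le_mono[OF assms(1)] by (auto intro!: exI[of _ T])
  next
    case False
    then have "real (Suc k) powr (1 / p) \<le> real m powr (1 / p)"
      using assms(2) by (intro powr_mono2) auto
    then have "1 \<le> real m powr (1 / p) * real (Suc k) powr (- 1 / p)"
      by (simp add: powr_minus field_simps)
    then have "norm T * 1 \<le> norm T * (real m powr (1 / p) * real (Suc k) powr (- 1 / p))"
      by (rule mult_left_mono) simp
    then show ?thesis
      by (intro exI[of _ 0]) (simp add: rank_le_zero mult.assoc)
  qed
qed

text \<open>Convergence to 0 in the quasi-norm, phrased by approximation so that it makes sense for
  differences with a limit not yet known to lie in the ideal.\<close>

definition weak_null :: "real \<Rightarrow> (nat \<Rightarrow> ('a::complex_hilbert \<Rightarrow>\<^sub>L 'a)) \<Rightarrow> bool" where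
  "weak_null p R \<longleftrightarrow> (\<exists>c. c \<longlonglongrightarrow> 0 \<and> (\<forall>N. weak_approx p (c N) (R N)))"

lemma weak_null_add:
  assumes "weak_null p R" "weak_null p S" "0 < p"
  shows "weak_null p (\<lambda>N. R N + S N)"
proof -
  obtain c d where "c \<longlonglongrightarrow> 0" "\<And>N. weak_approx p (c N) (R N)" "d \<longlonglongrightarrow> 0" "\<And>N. weak_approx p (d N) (S N)"
    using assms(1,2) unfolding weak_null_def by blast
  moreover from this have "(\<lambda>N. 2 powr (1 / p) * (c N + d N)) \<longlonglongrightarrow> 0"
    by (auto intro!: tendsto_eq_intros)
  ultimately show ?thesis
    unfolding weak_null_def
    by (intro exI[of _ "\<lambda>N. 2 powr (1 / p) * (c N + d N)"] conjI allI weak_approx_add[OF _ _ \<open>0 < p\<close>])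
qed

lemma weak_null_minus:
  assumes "weak_null p R"
  shows "weak_null p (\<lambda>N. - R N)"
  using assms weak_approx_scaleR[where r = "-1"] unfolding weak_null_def by fastforce

lemma weak_null_sum:
  assumes "0 < p" "\<And>i. i \<in> I \<Longrightarrow> weak_null p (R i)"
  shows "weak_null p (\<lambda>N. \<Sum>i\<in>I. R i N)"
  using assms
proof (induction I rule: infinite_finite_induct)
  case (insert i I)
  then show ?case
    using weak_null_add[of p "R i" "\<lambda>N. \<Sum>i\<in>I. R i N"] by simp
qed (auto simp: weak_null_def intro!: exI[of _ "\<lambda>_. 0"] weak_approx_zero)

lemma weak_null_compose:
  assumes "A \<longlonglongrightarrow> 0" "0 < p" "T \<in> weak_schatten p"
  shows "weak_null p (\<lambda>N. A N o\<^sub>L T)"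
  unfolding weak_null_def
proof (intro exI conjI allI)
  show "(\<lambda>N. norm (A N) * weak_schatten_norm p T) \<longlonglongrightarrow> 0"
    using tendsto_mult_left_zero[OF tendsto_norm_zero[OF assms(1)]] .
qed (intro weak_approx_compose_left weak_approx_weak_schatten assms)

lemma compact_op_limit:
  fixes T :: "'a::banach \<Rightarrow>\<^sub>L 'a"
  assumes lim: "S \<longlonglongrightarrow> T" and S: "\<And>n::nat. compact_op (S n)"
  shows "compact_op T"
  unfolding compact_op_def compact_eq_totally_bounded
proof (intro conjI allI impI)
  fix \<epsilon> :: real assume "0 < \<epsilon>"
  then obtain n where n: "norm (S n - T) < \<epsilon> / 3"
    using LIMSEQ_D[OF lim, of "\<epsilon> / 3"] by (auto simp: field_simps)
  obtain K where K: "finite K" "closure (S n ` cball 0 1) \<subseteq> (\<Union>x\<in>K. ball x (\<epsilon> / 3))"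
    using S[of n] \<open>0 < \<epsilon>\<close> unfolding compact_op_def compact_eq_totally_bounded
    by (meson divide_pos_pos zero_less_numeral)
  \<comment> \<open>Closed balls, so that their finite union is closed and also covers the closure
    of the image.\<close>
  have "T ` cball 0 1 \<subseteq> (\<Union>x\<in>K. cball x (2 * \<epsilon> / 3))"
  proof safe
    fix v :: 'a assume "v \<in> cball 0 1"
    then have "S n v \<in> (\<Union>x\<in>K. ball x (\<epsilon> / 3))"
      using K(2) closure_subset by (meson image_eqI subset_iff)
    then obtain x where x: "x \<in> K" "dist x (S n v) < \<epsilon> / 3"
      by auto
    have "dist (S n v) (T v) \<le> norm (S n - T) * norm v"
      by (simp add: dist_norm blinfun.diff_left[symmetric] norm_blinfun)
    also have "\<dots> \<le> norm (S n - T) * 1"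
      using \<open>v \<in> cball 0 1\<close> by (intro mult_left_mono) auto
    finally have "dist x (T v) \<le> 2 * \<epsilon> / 3"
      using x(2) n dist_triangle[of x "T v" "S n v"] by linarith
    then show "T v \<in> (\<Union>x\<in>K. cball x (2 * \<epsilon> / 3))"
      using x(1) by auto
  qed
  then have "closure (T ` cball 0 1) \<subseteq> (\<Union>x\<in>K. cball x (2 * \<epsilon> / 3))"
    using K(1) by (intro closure_minimal) auto
  also have "\<dots> \<subseteq> (\<Union>x\<in>K. ball x \<epsilon>)"
    using \<open>0 < \<epsilon>\<close> by (intro UN_mono) auto
  finally show "\<exists>K. finite K \<and> closure (T ` cball 0 1) \<subseteq> (\<Union>x\<in>K. ball x \<epsilon>)"
    using K(1) by blast
qed (simp add: complete_eq_closed)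

lemma weak_null_limit:
  fixes S :: "nat \<Rightarrow> ('a::complex_hilbert \<Rightarrow>\<^sub>L 'a)"
  assumes "0 < p" and S: "\<And>N. S N \<in> weak_schatten p" and null: "weak_null p (\<lambda>N. S N - Z)"
  shows "Z \<in> weak_schatten p" "(\<lambda>N. weak_schatten_dist p (S N) Z) \<longlonglongrightarrow> 0"
proof -
  obtain c where c: "c \<longlonglongrightarrow> 0" "\<And>N. weak_approx p (c N) (S N - Z)"
    using null unfolding weak_null_def by blast
  have "(\<lambda>N. S N - Z) \<longlonglongrightarrow> 0"
    by (rule Lim_null_comparison[OF _ c(1)]) (simp add: norm_le_weak_approx[OF c(2)])
  then have lim: "S \<longlonglongrightarrow> Z"
    by (rule LIM_zero_cancel)
  have clin: "complex_linear (S N)" and "compact_op (S N)" for N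
    using S by (auto simp: weak_schatten_def)
  then have Z: "complex_linear Z" "compact_op Z"
    using complex_linear_limit[OF lim] compact_op_limit[OF lim] by blast+
  \<comment> \<open>\<open>Z\<close> is \<open>S 0\<close> minus the error \<open>S 0 - Z\<close>,
    so a single use of the quasi-triangle inequality bounds its approximation numbers.\<close>
  have "weak_approx p (2 powr (1 / p) * (weak_schatten_norm p (S 0) + \<bar>- 1\<bar> * c 0)) (S 0 + (- 1) *\<^sub>R (S 0 - Z))"
    using assms(1) S c by (intro weak_approx_add weak_approx_scaleR weak_approx_weak_schatten) auto
  moreover have "S 0 + (- 1) *\<^sub>R (S 0 - Z) = Z"
    by simp
  ultimately have approx: "weak_approx p (2 powr (1 / p) * (weak_schatten_norm p (S 0) + \<bar>- 1\<bar> * c 0)) Z"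
    by simp
  then show "Z \<in> weak_schatten p"
    using Z singular_value_le_weak_approx[OF Z(1) approx] by (auto simp: weak_schatten_def)
  have diff: "complex_linear (S N - Z)" for N
    by (intro complex_linear_diff clin Z)
  have "0 \<le> weak_schatten_norm p (S N - Z)" for N
    by (rule weak_norm_bound(2)[OF assms(1) diff singular_value_le_weak_approx[OF diff c(2)]])
  moreover have "weak_schatten_norm p (S N - Z) \<le> c N" for N
    by (intro weak_schatten_norm_le_weak_approx diff c)
  moreover from calculation have "(\<lambda>N. weak_schatten_norm p (S N - Z)) \<longlonglongrightarrow> 0"
    using c(1) by (intro tendsto_sandwich[OF _ _ tendsto_const c(1)]) auto
  ultimately show "(\<lambda>N. weak_schatten_dist p (S N) Z) \<longlonglongrightarrow> 0"
    unfolding weak_schatten_dist_def using assms(1)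
    by (intro tendsto_zero_powrI[of _ _ "\<lambda>_. p" p]) auto
qed

section \<open>Non-commutative power series\<close>

text \<open>
  A copy of \<open>nc_series\<close> with real coefficients, as a type so that it can be made an instance of
  \<open>real_algebra_1\<close>.
\<close>

typedef ncs = "UNIV :: (bch_var list \<Rightarrow> real) set"
  morphisms coef Abs_ncs ..

lemma coef_Abs_ncs [simp]: "coef (Abs_ncs f) = f"
  by (simp add: Abs_ncs_inverse)

lemma ncs_eqI: "(\<And>w. coef f w = coef g w) \<Longrightarrow> f = g"
  by (metis coef_inject ext)

instantiation ncs :: real_algebra_1
begin

definition "0 = Abs_ncs (\<lambda>w. 0)"
definition "1 = Abs_ncs (\<lambda>w. if w = [] then 1 else 0)"
definition "f + g = Abs_ncs (\<lambda>w. coef f w + coef g w)"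
definition "f - g = Abs_ncs (\<lambda>w. coef f w - coef g w)"
definition "- f = Abs_ncs (\<lambda>w. - coef f w)"
definition "r *\<^sub>R f = Abs_ncs (\<lambda>w. r * coef f w)"
definition "f * g = Abs_ncs (\<lambda>w. \<Sum>k\<le>length w. coef f (take k w) * coef g (drop k w))"

lemma coef_simps [simp]:
  "coef 0 w = 0" "coef 1 w = (if w = [] then 1 else 0)" "coef (f + g) w = coef f w + coef g w"
  "coef (f - g) w = coef f w - coef g w" "coef (- f) w = - coef f w" "coef (r *\<^sub>R f) w = r * coef f w"
  by (simp_all add: zero_ncs_def one_ncs_def plus_ncs_def minus_ncs_def uminus_ncs_def scaleR_ncs_def)

lemma coef_mult: "coef (f * g) w = (\<Sum>k\<le>length w. coef f (take k w) * coef g (drop k w))"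
  by (simp add: times_ncs_def)

instance
proof
  fix f g h :: ncs and r s :: real
  show "f * g * h = f * (g * h)"
  proof (rule ncs_eqI)
    fix w :: "bch_var list"
    let ?t = "\<lambda>i j l. coef f (take i w) * coef g (take j (drop i w)) * coef h (drop (i + j) w)"
    have take: "coef (f * g) (take j w) = (\<Sum>i=0..j. coef f (take i w) * coef g (take (j - i) (drop i w)))"
      if "j \<le> length w" for j
    proof -
      have "{..length (take j w)} = {0..j}"
        using that by auto
      moreover have "coef f (take i (take j w)) * coef g (drop i (take j w))
          = coef f (take i w) * coef g (take (j - i) (drop i w))" if "i \<in> {0..j}" for i
        using that by (simp add: drop_take min_absorb1)
      ultimately show ?thesis
        unfolding coef_mult by (rule sum.cong)
    qed
    have drop: "coef (g * h) (drop j w)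
        = (\<Sum>i=0..length w - j. coef g (take i (drop j w)) * coef h (drop (j + i) w))" for j
      by (simp add: coef_mult atLeast0AtMost add.commute)
    have "coef (f * g * h) w = (\<Sum>j=0..length w. coef (f * g) (take j w) * coef h (drop j w))"
      by (simp add: coef_mult[of "f * g"] atLeast0AtMost)
    also have "\<dots> = (\<Sum>j=0..length w. \<Sum>i=0..j. ?t i (j - i) (length w - j))"
      by (rule sum.cong) (simp_all add: take sum_distrib_right)
    also have "\<dots> = (\<Sum>j=0..length w. \<Sum>i=0..length w - j. ?t j i (length w - j - i))"
      by (rule fps_mult_assoc_lemma)
    also have "\<dots> = (\<Sum>j=0..length w. coef f (take j w) * coef (g * h) (drop j w))"
      by (rule sum.cong) (simp_all add: drop sum_distrib_left mult.assoc)
    also have "\<dots> = coef (f * (g * h)) w"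
      by (simp add: coef_mult[of f] atLeast0AtMost)
    finally show "coef (f * g * h) w = coef (f * (g * h)) w" .
  qed
  show "1 * f = f"
  proof (rule ncs_eqI)
    fix w :: "bch_var list"
    have "coef (1 * f) w = (\<Sum>k\<le>length w. if k = 0 then coef f w else 0)"
      unfolding coef_mult by (rule sum.cong) auto
    then show "coef (1 * f) w = coef f w" by simp
  qed
  show "f * 1 = f"
  proof (rule ncs_eqI)
    fix w :: "bch_var list"
    have "coef (f * 1) w = (\<Sum>k\<le>length w. if k = length w then coef f w else 0)"
      unfolding coef_mult by (rule sum.cong) auto
    then show "coef (f * 1) w = coef f w" by simp
  qed
  have "coef 0 [] \<noteq> coef 1 []" by simp
  then show "(0 :: ncs) \<noteq> 1" by metis
qed (rule ncs_eqI, simp add: coef_mult algebra_simps sum.distrib sum_distrib_left)+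

end

lemma coef_sum: "coef (\<Sum>i\<in>I. f i) w = (\<Sum>i\<in>I. coef (f i) w)"
  by (induction I rule: infinite_finite_induct) auto

section \<open>Order of a series and locally finite sums\<close>

definition order_ge :: "nat \<Rightarrow> ncs \<Rightarrow> bool" where
  "order_ge k f \<longleftrightarrow> (\<forall>w. length w < k \<longrightarrow> coef f w = 0)"

lemma order_ge_0 [simp]: "order_ge 0 f"
  by (simp add: order_ge_def)

lemma order_ge_1: "order_ge (Suc 0) f \<longleftrightarrow> coef f [] = 0"
  by (auto simp: order_ge_def)

lemma order_ge_mono: "order_ge k f \<Longrightarrow> j \<le> k \<Longrightarrow> order_ge j f"
  by (simp add: order_ge_def)

lemma order_ge_diff: "order_ge k f \<Longrightarrow> order_ge k g \<Longrightarrow> order_ge k (f - g)"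
  by (simp add: order_ge_def)

lemma order_ge_scaleR: "order_ge k f \<Longrightarrow> order_ge k (r *\<^sub>R f)"
  by (simp add: order_ge_def)

lemma order_ge_mult:
  assumes "order_ge i f" "order_ge j g"
  shows "order_ge (i + j) (f * g)"
  unfolding order_ge_def
proof (intro allI impI)
  fix w :: "bch_var list" assume w: "length w < i + j"
  have "coef f (take k w) * coef g (drop k w) = 0" if "k \<le> length w" for k
  proof (cases "k < i")
    case True
    then show ?thesis
      using assms(1) that by (simp add: order_ge_def)
  next
    case False
    then show ?thesis
      using assms(2) that w by (simp add: order_ge_def)
  qed
  then show "coef (f * g) w = 0"
    unfolding coef_mult by (intro sum.neutral) auto
qed

lemma order_ge_power: "coef f [] = 0 \<Longrightarrow> order_ge k (f ^ k)"
proof (induction k)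
  case (Suc k)
  then show ?case
    using order_ge_mult[of 1 f k "f ^ k"] by (simp add: order_ge_1)
qed simp

definition summable_family :: "(nat \<Rightarrow> ncs) \<Rightarrow> bool" where
  "summable_family h \<longleftrightarrow> (\<forall>k. order_ge k (h k))"

text \<open>The truncation at \<open>length w\<close> loses nothing if the family is summable.\<close>

definition formal_sum :: "(nat \<Rightarrow> ncs) \<Rightarrow> ncs" where
  "formal_sum h = Abs_ncs (\<lambda>w. \<Sum>k\<le>length w. coef (h k) w)"

lemma coef_formal_sum: "coef (formal_sum h) w = (\<Sum>k\<le>length w. coef (h k) w)"
  by (simp add: formal_sum_def)

text \<open>One cut-off can serve all prefixes and suffixes of a word, which permits exchanging the
  sum with a product.\<close>

lemma coef_formal_sum_extend:
  assumes "summable_family h" "length w \<le> M"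
  shows "coef (formal_sum h) w = (\<Sum>k\<le>M. coef (h k) w)"
  unfolding coef_formal_sum using assms
  by (intro sum.mono_neutral_left) (auto simp: summable_family_def order_ge_def)

lemma formal_sum_shift:
  assumes "summable_family h"
  shows "formal_sum h = h 0 + formal_sum (\<lambda>k. h (Suc k))"
proof (rule ncs_eqI)
  fix w :: "bch_var list"
  have "coef (formal_sum h) w = (\<Sum>k\<le>Suc (length w). coef (h k) w)"
    by (rule coef_formal_sum_extend[OF assms]) simp
  also have "\<dots> = coef (h 0) w + (\<Sum>k\<le>length w. coef (h (Suc k)) w)"
    by (rule sum.atMost_Suc_shift)
  finally show "coef (formal_sum h) w = coef (h 0 + formal_sum (\<lambda>k. h (Suc k))) w"
    by (simp add: coef_formal_sum)
qed

lemma formal_sum_mult_right: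
  assumes "summable_family h"
  shows "formal_sum h * a = formal_sum (\<lambda>k. h k * a)"
proof (rule ncs_eqI)
  fix w :: "bch_var list"
  have "coef (formal_sum h * a) w
      = (\<Sum>l\<le>length w. (\<Sum>k\<le>length w. coef (h k) (take l w)) * coef a (drop l w))"
    unfolding coef_mult by (intro sum.cong refl) (simp add: coef_formal_sum_extend[OF assms, of _ "length w"])
  also have "\<dots> = (\<Sum>k\<le>length w. coef (h k * a) w)"
    by (simp add: coef_mult sum_distrib_right) (rule sum.swap)
  finally show "coef (formal_sum h * a) w = coef (formal_sum (\<lambda>k. h k * a)) w"
    by (simp add: coef_formal_sum)
qed

lemma formal_sum_mult_left:
  assumes "summable_family h"
  shows "a * formal_sum h = formal_sum (\<lambda>k. a * h k)"
proof (rule ncs_eqI)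
  fix w :: "bch_var list"
  have "coef (a * formal_sum h) w
      = (\<Sum>l\<le>length w. coef a (take l w) * (\<Sum>k\<le>length w. coef (h k) (drop l w)))"
    unfolding coef_mult by (intro sum.cong refl) (simp add: coef_formal_sum_extend[OF assms, of _ "length w"])
  also have "\<dots> = (\<Sum>k\<le>length w. coef (a * h k) w)"
    by (simp add: coef_mult sum_distrib_left) (rule sum.swap)
  finally show "coef (a * formal_sum h) w = coef (formal_sum (\<lambda>k. a * h k)) w"
    by (simp add: coef_formal_sum)
qed

lemma formal_sum_Cauchy_product:
  assumes u: "summable_family u" and v: "summable_family v"
  shows "formal_sum u * formal_sum v = formal_sum (\<lambda>k. \<Sum>m\<le>k. u m * v (k - m))"
proof (rule ncs_eqI)
  fix w :: "bch_var list"
  let ?n = "length w"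
  have "coef (formal_sum u * formal_sum v) w = (\<Sum>i\<le>?n. coef (u i * formal_sum v) w)"
    unfolding formal_sum_mult_right[OF u] coef_formal_sum ..
  also have "\<dots> = (\<Sum>i\<le>?n. \<Sum>j\<le>?n. coef (u i * v j) w)"
    unfolding formal_sum_mult_left[OF v] coef_formal_sum ..
  also have "\<dots> = (\<Sum>(i, j)\<in>{..?n} \<times> {..?n}. coef (u i * v j) w)"
    by (rule sum.cartesian_product)
  \<comment> \<open>Pairs with \<open>i + j\<close> beyond the length of \<open>w\<close> contribute
    0 by the order of the product; the remaining triangle is summed along
    \<open>k = i + j\<close>.\<close>
  also have "\<dots> = (\<Sum>(i, j)\<in>{(i, j). i + j \<le> ?n}. coef (u i * v j) w)"
  proof (rule sum.mono_neutral_right)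
    have "coef (u i * v j) w = 0" if "\<not> i + j \<le> ?n" for i j
      using order_ge_mult[of i "u i" j "v j"] u v that by (auto simp: summable_family_def order_ge_def)
    then show "\<forall>ij\<in>{..?n} \<times> {..?n} - {(i, j). i + j \<le> ?n}. (case ij of (i, j) \<Rightarrow> coef (u i * v j) w) = 0"
      by auto
  qed auto
  also have "\<dots> = (\<Sum>k\<le>?n. \<Sum>m\<le>k. coef (u m * v (k - m)) w)"
    by (rule sum.triangle_reindex_eq)
  finally show "coef (formal_sum u * formal_sum v) w = coef (formal_sum (\<lambda>k. \<Sum>m\<le>k. u m * v (k - m))) w"
    by (simp add: coef_formal_sum coef_sum)
qed

text \<open>Meaningful only if \<open>f\<close> has constant term \<open>0\<close>.\<close>

definition compose_ncs :: "real fps \<Rightarrow> ncs \<Rightarrow> ncs" where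
  "compose_ncs a f = formal_sum (\<lambda>k. fps_nth a k *\<^sub>R f ^ k)"

lemma summable_family_powers: "coef f [] = 0 \<Longrightarrow> summable_family (\<lambda>k. c k *\<^sub>R f ^ k)"
  by (simp add: summable_family_def order_ge_scaleR order_ge_power)

text \<open>Only powers of one series occur, and these commute. Substitution is thus multiplicative,
  and identities can be imported from power series in one variable.\<close>

lemma compose_ncs_mult:
  assumes "coef f [] = 0"
  shows "compose_ncs (a * b) f = compose_ncs a f * compose_ncs b f"
proof -
  have "(\<Sum>m\<le>k. (fps_nth a m *\<^sub>R f ^ m) * (fps_nth b (k - m) *\<^sub>R f ^ (k - m))) = fps_nth (a * b) k *\<^sub>R f ^ k" for k
    by (auto simp: fps_mult_nth atLeast0AtMost scaleR_sum_left power_add[symmetric] mult.commute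
        intro!: sum.cong)
  then show ?thesis
    unfolding compose_ncs_def by (simp add: formal_sum_Cauchy_product summable_family_powers assms)
qed

lemma compose_ncs_1: "compose_ncs 1 f = 1"
proof (rule ncs_eqI)
  fix w :: "bch_var list"
  have "coef (compose_ncs 1 f) w = (\<Sum>k\<le>length w. if k = 0 then coef 1 w else 0)"
    unfolding compose_ncs_def coef_formal_sum by (rule sum.cong) auto
  then show "coef (compose_ncs 1 f) w = coef 1 w" by simp
qed

lemma compose_ncs_power: "coef f [] = 0 \<Longrightarrow> compose_ncs (a ^ k) f = compose_ncs a f ^ k"
  by (induction k) (auto simp: compose_ncs_1 compose_ncs_mult)

text \<open>Both sides are expanded in the powers of \<open>f\<close>. As \<open>b\<close> has no
  constant term, \<open>b ^ k\<close> starts in degree \<open>k\<close>, which makes the truncations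
  agree.\<close>

lemma compose_ncs_compose:
  assumes "coef f [] = 0" "fps_nth b 0 = 0"
  shows "compose_ncs a (compose_ncs b f) = compose_ncs (fps_compose a b) f"
proof (rule ncs_eqI)
  fix w :: "bch_var list"
  let ?n = "length w"
  have "coef (compose_ncs a (compose_ncs b f)) w
      = (\<Sum>k\<le>?n. \<Sum>j\<le>?n. fps_nth a k * (fps_nth (b ^ k) j * coef (f ^ j) w))"
    unfolding compose_ncs_def[of a] coef_formal_sum
  proof (rule sum.cong)
    fix k
    show "coef (fps_nth a k *\<^sub>R compose_ncs b f ^ k) w
        = (\<Sum>j\<le>?n. fps_nth a k * (fps_nth (b ^ k) j * coef (f ^ j) w))"
      unfolding compose_ncs_power[OF assms(1), symmetric]
      by (simp add: compose_ncs_def coef_formal_sum sum_distrib_left)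
  qed simp
  also have "\<dots> = (\<Sum>j\<le>?n. \<Sum>k\<le>?n. fps_nth a k * (fps_nth (b ^ k) j * coef (f ^ j) w))"
    by (rule sum.swap)
  also have "\<dots> = (\<Sum>j\<le>?n. fps_nth (fps_compose a b) j * coef (f ^ j) w)"
  proof (rule sum.cong)
    fix j assume "j \<in> {..?n}"
    have "(\<Sum>k\<le>?n. fps_nth a k * (fps_nth (b ^ k) j * coef (f ^ j) w))
        = (\<Sum>k\<in>{0..j}. fps_nth a k * (fps_nth (b ^ k) j * coef (f ^ j) w))"
      using \<open>j \<in> {..?n}\<close> startsby_zero_power_prefix[OF assms(2)]
      by (intro sum.mono_neutral_right) auto
    then show "(\<Sum>k\<le>?n. fps_nth a k * (fps_nth (b ^ k) j * coef (f ^ j) w))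
        = fps_nth (fps_compose a b) j * coef (f ^ j) w"
      by (simp add: fps_compose_nth sum_distrib_right mult.assoc)
  qed simp
  finally show "coef (compose_ncs a (compose_ncs b f)) w = coef (compose_ncs (fps_compose a b) f) w"
    by (simp add: compose_ncs_def coef_formal_sum)
qed

lemma compose_ncs_1_plus_X:
  assumes "coef f [] = 0"
  shows "compose_ncs (1 + fps_X) f = 1 + f"
proof -
  let ?h = "\<lambda>k. fps_nth (1 + fps_X :: real fps) k *\<^sub>R f ^ k"
  have h: "summable_family ?h"
    by (rule summable_family_powers[OF assms])
  then have h': "summable_family (\<lambda>k. ?h (Suc k))"
    unfolding summable_family_def by (meson order_ge_mono le_SucI order_refl)
  have "formal_sum (\<lambda>k. ?h (Suc (Suc k))) = 0"
    by (rule ncs_eqI) (simp add: coef_formal_sum)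
  then show ?thesis
    unfolding compose_ncs_def formal_sum_shift[OF h] formal_sum_shift[OF h'] by simp
qed

definition exp_ncs :: "ncs \<Rightarrow> ncs" where
  "exp_ncs f = formal_sum (\<lambda>k. (1 / fact k) *\<^sub>R f ^ k)"

text \<open>\<open>fps_ln 1\<close> is the series of log(1 + t), the compositional inverse of e^t -
  1; substitution carries this identity over.\<close>

lemma exp_ncs_log:
  assumes "coef f [] = 0"
  shows "exp_ncs (compose_ncs (fps_ln 1) f) = 1 + f"
proof -
  have "(fps_exp 1 - 1) oo fps_ln (1::real) = fps_X"
    by (simp add: fps_ln_fps_exp_inv fps_inv_fps_exp_compose)
  then have "fps_exp 1 oo fps_ln (1::real) = 1 + fps_X"
    by (simp add: fps_compose_sub_distrib algebra_simps)
  then have "compose_ncs (fps_exp 1) (compose_ncs (fps_ln 1) f) = 1 + f"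
    using compose_ncs_compose[OF assms, of "fps_ln 1" "fps_exp 1"] compose_ncs_1_plus_X[OF assms] by simp
  then show ?thesis
    by (simp add: exp_ncs_def compose_ncs_def[of "fps_exp 1"])
qed

section \<open>Transfer of the formal definitions from rational to real coefficients\<close>

definition of_nc_series :: "nc_series \<Rightarrow> ncs" where
  "of_nc_series f = Abs_ncs (\<lambda>w. real_of_rat (f w))"

lemma coef_of_nc_series [simp]: "coef (of_nc_series f) w = real_of_rat (f w)"
  by (simp add: of_nc_series_def)

lemma of_nc_series_mult: "of_nc_series (nc_mult f g) = of_nc_series f * of_nc_series g"
  by (rule ncs_eqI) (simp add: nc_mult_def coef_mult of_rat_sum of_rat_mult)

lemma of_nc_series_power: "of_nc_series (nc_power f k) = of_nc_series f ^ k"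
proof (induction k)
  case 0
  show ?case by (rule ncs_eqI) (simp add: nc_one_def)
qed (simp add: of_nc_series_mult)

lemma of_rat_fact: "of_rat (fact k) = (fact k :: 'a::field_char_0)"
  by (metis of_nat_fact of_rat_of_nat_eq)

lemma of_nc_series_exp: "of_nc_series (nc_exp f) = exp_ncs (of_nc_series f)"
  by (rule ncs_eqI) (simp add: nc_exp_def exp_ncs_def coef_formal_sum of_nc_series_power[symmetric]
      of_rat_sum of_rat_divide of_rat_fact)

lemma of_nc_series_log: "of_nc_series (nc_log f) = compose_ncs (fps_ln 1) (of_nc_series f - 1)"
proof (rule ncs_eqI)
  fix w :: "bch_var list"
  have "of_nc_series (\<lambda>v. f v - nc_one v) = of_nc_series f - 1"
    by (rule ncs_eqI) (simp add: nc_one_def of_rat_diff)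
  then have pow: "real_of_rat (nc_power (\<lambda>v. f v - nc_one v) k w) = coef ((of_nc_series f - 1) ^ k) w" for k
    by (metis coef_of_nc_series of_nc_series_power)
  have "coef (of_nc_series (nc_log f)) w
      = (\<Sum>k=1..length w. (- 1) ^ (k + 1) / real k * coef ((of_nc_series f - 1) ^ k) w)"
    by (simp add: nc_log_def of_rat_sum of_rat_mult of_rat_divide of_rat_power of_rat_minus pow)
  also have "\<dots> = (\<Sum>k\<in>{1..length w}. fps_nth (fps_ln 1) k * coef ((of_nc_series f - 1) ^ k) w)"
    by (rule sum.cong) (auto simp: fps_ln_nth Suc_le_eq gr0_conv_Suc)
  also have "\<dots> = (\<Sum>k\<le>length w. fps_nth (fps_ln 1) k * coef ((of_nc_series f - 1) ^ k) w)"
    by (rule sum.mono_neutral_left) (auto simp: Suc_le_eq)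
  finally show "coef (of_nc_series (nc_log f)) w = coef (compose_ncs (fps_ln 1) (of_nc_series f - 1)) w"
    by (simp add: compose_ncs_def coef_formal_sum)
qed

definition var_ncs :: "bch_var \<Rightarrow> ncs" where
  "var_ncs a = of_nc_series (nc_var a)"

lemma coef_var_ncs: "coef (var_ncs a) w = (if w = [a] then 1 else 0)"
  by (simp add: var_ncs_def nc_var_def)

definition bch_ncs :: ncs where
  "bch_ncs = of_nc_series bch_series"

lemma coef_bch_ncs_Nil: "coef bch_ncs [] = 0"
  by (simp add: bch_ncs_def bch_series_def nc_log_def)

lemma exp_bch_ncs: "exp_ncs bch_ncs = exp_ncs (var_ncs VX) * exp_ncs (var_ncs VY)"
proof -
  have "coef (exp_ncs (var_ncs VX) * exp_ncs (var_ncs VY) - 1) [] = 0"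
    by (simp add: exp_ncs_def coef_mult coef_formal_sum)
  from exp_ncs_log[OF this] show ?thesis
    by (simp add: bch_ncs_def bch_series_def of_nc_series_log of_nc_series_mult of_nc_series_exp var_ncs_def)
qed

text \<open>The Euler derivation. It does the work of t d/dt on the family with X, Y replaced by t
  X, t Y, without introducing a parameter.\<close>

definition degree_deriv :: "ncs \<Rightarrow> ncs" where
  "degree_deriv f = Abs_ncs (\<lambda>w. real (length w) * coef f w)"

lemma coef_degree_deriv [simp]: "coef (degree_deriv f) w = real (length w) * coef f w"
  by (simp add: degree_deriv_def)

lemma degree_deriv_1 [simp]: "degree_deriv 1 = 0"
  by (rule ncs_eqI) simp

lemma degree_deriv_scaleR: "degree_deriv (r *\<^sub>R f) = r *\<^sub>R degree_deriv f"
  by (rule ncs_eqI) simp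

lemma degree_deriv_mult: "degree_deriv (f * g) = degree_deriv f * g + f * degree_deriv g"
proof (rule ncs_eqI)
  fix w
  have "real (length w) * (coef f (take k w) * coef g (drop k w))
      = real k * coef f (take k w) * coef g (drop k w)
        + coef f (take k w) * (real (length w - k) * coef g (drop k w))" if "k \<le> length w" for k
    using that by (simp add: of_nat_diff algebra_simps)
  then show "coef (degree_deriv (f * g)) w = coef (degree_deriv f * g + f * degree_deriv g) w"
    by (simp add: coef_mult sum_distrib_left sum.distrib[symmetric] min_absorb2)
qed

lemma degree_deriv_formal_sum: "degree_deriv (formal_sum h) = formal_sum (\<lambda>k. degree_deriv (h k))"
  by (rule ncs_eqI) (simp add: coef_formal_sum sum_distrib_left)

lemma degree_deriv_power:
  "degree_deriv (f ^ Suc k) = (\<Sum>i\<le>k. f ^ i * degree_deriv f * f ^ (k - i))"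
proof (induction k)
  case (Suc k)
  have "degree_deriv (f ^ Suc (Suc k)) = degree_deriv f * f ^ Suc k + f * degree_deriv (f ^ Suc k)"
    by (subst power_Suc) (rule degree_deriv_mult)
  also have "f * degree_deriv (f ^ Suc k) = (\<Sum>i\<le>k. f ^ Suc i * degree_deriv f * f ^ (Suc k - Suc i))"
    unfolding Suc sum_distrib_left by (simp add: mult.assoc)
  also have "degree_deriv f * f ^ Suc k + \<dots> = (\<Sum>i\<le>Suc k. f ^ i * degree_deriv f * f ^ (Suc k - i))"
    by (subst sum.atMost_Suc_shift) simp
  finally show ?case .
qed (simp add: degree_deriv_mult)

lemma degree_deriv_exp_var: "degree_deriv (exp_ncs (var_ncs a)) = var_ncs a * exp_ncs (var_ncs a)"
proof -
  let ?X = "var_ncs a"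
  have X0: "coef ?X [] = 0" and DX: "degree_deriv ?X = ?X"
    by (auto intro!: ncs_eqI simp: coef_var_ncs)
  have pow: "degree_deriv (?X ^ Suc k) = real (Suc k) *\<^sub>R ?X ^ Suc k" for k
  proof -
    have "degree_deriv (?X ^ Suc k) = (\<Sum>i\<le>k. ?X ^ Suc k)"
      unfolding degree_deriv_power DX
      by (intro sum.cong refl) (metis (no_types) add.commute add_Suc atMost_iff le_add_diff_inverse
          mult.assoc power_add power_Suc power_commutes)
    then show ?thesis
      by (simp add: scaleR_conv_of_real)
  qed
  let ?h = "\<lambda>k. degree_deriv ((1 / fact k) *\<^sub>R ?X ^ k)"
  have "summable_family ?h"
    using order_ge_power[OF X0] by (simp add: summable_family_def order_ge_def)
  then have "degree_deriv (exp_ncs ?X) = formal_sum (\<lambda>k. ?h (Suc k))"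
    unfolding exp_ncs_def degree_deriv_formal_sum by (subst formal_sum_shift) (simp_all add: degree_deriv_scaleR)
  also have "(\<lambda>k. ?h (Suc k)) = (\<lambda>k. ?X * ((1 / fact k) *\<^sub>R ?X ^ k))"
  proof
    fix k
    have "1 / fact (Suc k) * real (Suc k) = 1 / fact k"
      by (simp del: of_nat_Suc)
    then show "?h (Suc k) = ?X * ((1 / fact k) *\<^sub>R ?X ^ k)"
      unfolding degree_deriv_scaleR pow scaleR_scaleR by simp
  qed
  also have "formal_sum (\<lambda>k. ?X * ((1 / fact k) *\<^sub>R ?X ^ k)) = ?X * exp_ncs ?X"
    unfolding exp_ncs_def by (rule formal_sum_mult_left[symmetric]) (rule summable_family_powers[OF X0])
  finally show ?thesis .
qed

section \<open>Commutator expansions and the differential equation\<close>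

definition commutator :: "'a::ring \<Rightarrow> 'a \<Rightarrow> 'a" where
  "commutator a b = a * b - b * a"

text \<open>Left multiplication by \<open>a\<close> is the sum of \<open>commutator a\<close> and
  right multiplication by \<open>a\<close>. These two maps commute, so this is the binomial
  theorem.\<close>

lemma power_mult_commutator:
  fixes a b :: "'a::real_algebra_1"
  shows "a ^ k * b = (\<Sum>m\<le>k. real (k choose m) *\<^sub>R ((commutator a ^^ m) b * a ^ (k - m)))"
proof (induction k)
  case (Suc k)
  let ?c = "\<lambda>m. (commutator a ^^ m) b"
  have "a ^ Suc k * b = (\<Sum>m\<le>k. real (k choose m) *\<^sub>R (a * ?c m * a ^ (k - m)))"
    by (simp add: mult.assoc Suc sum_distrib_left)
  also have "\<dots> = (\<Sum>m\<le>k. real (k choose m) *\<^sub>R (?c (Suc m) * a ^ (k - m)))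
      + (\<Sum>m\<le>k. real (k choose m) *\<^sub>R (?c m * a ^ (Suc k - m)))"
    unfolding sum.distrib[symmetric]
  proof (rule sum.cong)
    fix m assume "m \<in> {..k}"
    then have "a ^ (Suc k - m) = a * a ^ (k - m)"
      by (simp add: Suc_diff_le)
    then show "real (k choose m) *\<^sub>R (a * ?c m * a ^ (k - m))
        = real (k choose m) *\<^sub>R (?c (Suc m) * a ^ (k - m)) + real (k choose m) *\<^sub>R (?c m * a ^ (Suc k - m))"
      by (simp add: commutator_def algebra_simps)
  qed simp
  also have "(\<Sum>m\<le>k. real (k choose m) *\<^sub>R (?c m * a ^ (Suc k - m)))
      = (\<Sum>m\<le>Suc k. real (k choose m) *\<^sub>R (?c m * a ^ (Suc k - m)))"
    by (simp add: binomial_eq_0)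
  also have "\<dots> = b * a ^ Suc k + (\<Sum>m\<le>k. real (k choose Suc m) *\<^sub>R (?c (Suc m) * a ^ (k - m)))"
    by (subst sum.atMost_Suc_shift) simp
  also have "(\<Sum>m\<le>k. real (k choose m) *\<^sub>R (?c (Suc m) * a ^ (k - m)))
      + (b * a ^ Suc k + (\<Sum>m\<le>k. real (k choose Suc m) *\<^sub>R (?c (Suc m) * a ^ (k - m))))
      = b * a ^ Suc k + (\<Sum>m\<le>k. real (Suc k choose Suc m) *\<^sub>R (?c (Suc m) * a ^ (k - m)))"
    by (simp add: sum.distrib[symmetric] scaleR_add_left)
  also have "\<dots> = (\<Sum>m\<le>Suc k. real (Suc k choose m) *\<^sub>R (?c m * a ^ (Suc k - m)))"
    by (subst sum.atMost_Suc_shift) simp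
  finally show ?case .
qed simp

text \<open>In every product from \<open>degree_deriv_power\<close> the powers on the left are moved
  across the derivative; summing the binomials over \<open>i\<close> is the hockey-stick
  identity.\<close>

lemma degree_deriv_power_commutator:
  "degree_deriv (f ^ Suc k)
    = (\<Sum>m\<le>k. real (Suc k choose Suc m) *\<^sub>R ((commutator f ^^ m) (degree_deriv f) * f ^ (k - m)))"
proof -
  let ?c = "\<lambda>m. (commutator f ^^ m) (degree_deriv f)"
  have "f ^ i * degree_deriv f * f ^ (k - i) = (\<Sum>m\<le>k. real (i choose m) *\<^sub>R (?c m * f ^ (k - m)))"
    if "i \<le> k" for i
  proof -
    have "f ^ i * degree_deriv f * f ^ (k - i) = (\<Sum>m\<le>i. real (i choose m) *\<^sub>R (?c m * f ^ (k - m)))"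
      unfolding power_mult_commutator sum_distrib_right
      by (rule sum.cong) (use that in \<open>auto simp: mult.assoc power_add[symmetric]\<close>)
    also have "\<dots> = (\<Sum>m\<le>k. real (i choose m) *\<^sub>R (?c m * f ^ (k - m)))"
      by (rule sum.mono_neutral_left) (use that in \<open>auto simp: binomial_eq_0\<close>)
    finally show ?thesis .
  qed
  then have "degree_deriv (f ^ Suc k) = (\<Sum>i\<le>k. \<Sum>m\<le>k. real (i choose m) *\<^sub>R (?c m * f ^ (k - m)))"
    unfolding degree_deriv_power by simp
  also have "\<dots> = (\<Sum>m\<le>k. real (\<Sum>i\<le>k. i choose m) *\<^sub>R (?c m * f ^ (k - m)))"
    by (subst sum.swap) (simp add: scaleR_sum_left)
  finally show ?thesis
    by (simp only: sum_choose_upper)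
qed

lemma order_ge_commutator_power:
  assumes "coef f [] = 0"
  shows "order_ge m ((commutator f ^^ m) g)"
proof (induction m)
  case (Suc m)
  have "order_ge 1 f"
    using assms by (simp add: order_ge_1)
  then show ?case
    using order_ge_mult[OF _ Suc, of 1 f] order_ge_mult[OF Suc, of 1 f]
    by (simp add: commutator_def order_ge_diff)
qed simp

lemma summable_family_commutator_power:
  "coef f [] = 0 \<Longrightarrow> summable_family (\<lambda>m. c m *\<^sub>R (commutator f ^^ m) g)"
  by (simp add: summable_family_def order_ge_scaleR order_ge_commutator_power)

text \<open>Conjugation by e^f is e^(ad f). The exponential is kept on the right, which avoids
  inverses.\<close>

lemma exp_mult_commutator:
  assumes "coef f [] = 0"
  shows "exp_ncs f * g = formal_sum (\<lambda>m. (1 / fact m) *\<^sub>R (commutator f ^^ m) g) * exp_ncs f"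
proof -
  have terms: "(1 / fact k) *\<^sub>R f ^ k * g
      = (\<Sum>m\<le>k. ((1 / fact m) *\<^sub>R (commutator f ^^ m) g) * ((1 / fact (k - m)) *\<^sub>R f ^ (k - m)))" for k
    unfolding mult_scaleR_left power_mult_commutator scaleR_sum_right
    by (intro sum.cong) (auto simp: binomial_fact field_simps)
  have "exp_ncs f * g = formal_sum (\<lambda>k. (1 / fact k) *\<^sub>R f ^ k * g)"
    unfolding exp_ncs_def by (rule formal_sum_mult_right[OF summable_family_powers[OF assms]])
  also have "\<dots> = formal_sum (\<lambda>m. (1 / fact m) *\<^sub>R (commutator f ^^ m) g) * exp_ncs f"
    unfolding exp_ncs_def terms
    by (rule formal_sum_Cauchy_product[symmetric])
      (intro summable_family_powers summable_family_commutator_power assms)+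
  finally show ?thesis .
qed

text \<open>The derivative of the exponential: \<open>D e\<^sup>f = ((e\<^bsup>ad f\<^esup> - 1) / ad f) (D f) \<cdot> e\<^sup>f\<close>.\<close>

lemma degree_deriv_exp:
  assumes "coef f [] = 0"
  shows "degree_deriv (exp_ncs f)
    = formal_sum (\<lambda>m. (1 / fact (Suc m)) *\<^sub>R (commutator f ^^ m) (degree_deriv f)) * exp_ncs f"
proof -
  let ?h = "\<lambda>k. degree_deriv ((1 / fact k) *\<^sub>R f ^ k)"
  have terms: "?h (Suc k) = (\<Sum>m\<le>k. ((1 / fact (Suc m)) *\<^sub>R (commutator f ^^ m) (degree_deriv f))
      * ((1 / fact (k - m)) *\<^sub>R f ^ (k - m)))" for k
    unfolding degree_deriv_scaleR degree_deriv_power_commutator scaleR_sum_right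
    by (intro sum.cong) (auto simp: binomial_fact field_simps simp del: fact_Suc binomial_Suc_Suc)
  have "summable_family ?h"
    using order_ge_power[OF assms] by (simp add: summable_family_def order_ge_def)
  then have "degree_deriv (exp_ncs f) = formal_sum (\<lambda>k. ?h (Suc k))"
    unfolding exp_ncs_def degree_deriv_formal_sum by (subst formal_sum_shift) (simp_all add: degree_deriv_scaleR)
  also have "\<dots> = formal_sum (\<lambda>m. (1 / fact (Suc m)) *\<^sub>R (commutator f ^^ m) (degree_deriv f)) * exp_ncs f"
    unfolding exp_ncs_def terms
    by (rule formal_sum_Cauchy_product[symmetric])
      (intro summable_family_powers summable_family_commutator_power assms)+
  finally show ?thesis .
qed

text \<open>By induction on the length of the word, only the full prefix contributes to the
  coefficient of the product. This cancels the exponential without constructing its inverse.\<close>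

lemma mult_unit_eq_0:
  assumes "f * g = 0" "coef g [] \<noteq> 0"
  shows "f = 0"
proof -
  have "coef f w = 0" for w
  proof (induction "length w" arbitrary: w rule: less_induct)
    case less
    have "0 = coef (f * g) w"
      using assms(1) by simp
    also have "\<dots> = (\<Sum>k\<le>length w. if k = length w then coef f w * coef g [] else 0)"
      unfolding coef_mult using less by (intro sum.cong) auto
    finally show ?case
      using assms(2) by simp
  qed
  then show ?thesis
    by (auto intro: ncs_eqI)
qed

text \<open>The derivative of \<open>?G\<close> is computed once through \<open>bch_ncs\<close> and
  once through the product e^X e^Y. In the latter, Y commutes with e^Y and moves to the far right of
  \<open>?G\<close>; conjugation by \<open>?G\<close> brings it back to the left as e^(ad Z) Y, and
  \<open>?G\<close> cancels.\<close>

lemma bch_differential_equation: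
  "formal_sum (\<lambda>m. (1 / fact (Suc m)) *\<^sub>R (commutator bch_ncs ^^ m) (degree_deriv bch_ncs))
    = var_ncs VX + formal_sum (\<lambda>m. (1 / fact m) *\<^sub>R (commutator bch_ncs ^^ m) (var_ncs VY))"
  (is "?u = _ + ?v")
proof -
  let ?G = "exp_ncs bch_ncs"
  have "?u * ?G = degree_deriv ?G"
    by (rule degree_deriv_exp[symmetric]) (rule coef_bch_ncs_Nil)
  also have "\<dots> = var_ncs VX * ?G + exp_ncs (var_ncs VX) * (var_ncs VY * exp_ncs (var_ncs VY))"
    unfolding exp_bch_ncs degree_deriv_mult degree_deriv_exp_var by (simp add: mult.assoc)
  also have "var_ncs VY * exp_ncs (var_ncs VY) = exp_ncs (var_ncs VY) * var_ncs VY"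
    unfolding exp_ncs_def
    by (subst formal_sum_mult_left formal_sum_mult_right; simp add: summable_family_powers coef_var_ncs)+
      (simp add: power_commutes)
  also have "exp_ncs (var_ncs VX) * \<dots> = ?G * var_ncs VY"
    by (simp add: exp_bch_ncs mult.assoc)
  also have "\<dots> = ?v * ?G"
    by (rule exp_mult_commutator) (rule coef_bch_ncs_Nil)
  finally have "(?u - (var_ncs VX + ?v)) * ?G = 0"
    by (simp add: algebra_simps)
  moreover have "coef ?G [] \<noteq> 0"
    by (simp add: exp_ncs_def coef_formal_sum)
  ultimately show ?thesis
    using mult_unit_eq_0 by fastforce
qed

section \<open>Evaluation at operators\<close>

text \<open>Evaluation keeps the homogeneous parts separate, so no convergence is involved; products
  of series become \<open>convolution\<close>.\<close>

definition eval_ncs :: "('a::real_normed_vector \<Rightarrow>\<^sub>L 'a) \<Rightarrow> ('a \<Rightarrow>\<^sub>L 'a) \<Rightarrow> ncs \<Rightarrow> nat \<Rightarrow> 'a \<Rightarrow>\<^sub>L 'a" where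
  "eval_ncs x y f n = (\<Sum>w\<in>{w. length w = n}. coef f w *\<^sub>R word_op x y w)"

definition convolution ::
    "(nat \<Rightarrow> 'a::real_normed_vector \<Rightarrow>\<^sub>L 'a) \<Rightarrow> (nat \<Rightarrow> 'a \<Rightarrow>\<^sub>L 'a) \<Rightarrow> nat \<Rightarrow> 'a \<Rightarrow>\<^sub>L 'a" where
  "convolution a b n = (\<Sum>i\<le>n. a i o\<^sub>L b (n - i))"

lemma finite_words: "finite {w :: bch_var list. length w = n}"
proof -
  have "(UNIV :: bch_var set) = {VX, VY}"
    using bch_var.exhaust by auto
  then have "finite (UNIV :: bch_var set)"
    by (metis finite.simps)
  from finite_lists_length_eq[OF this, of n] show ?thesis by simp
qed

lemma bch_term_eq_eval: "bch_term n x y = eval_ncs x y bch_ncs n"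
  by (simp add: bch_term_def eval_ncs_def bch_ncs_def)

lemma word_op_append: "word_op x y (u @ v) = word_op x y u o\<^sub>L word_op x y v"
  by (induction u) (auto intro!: blinfun_eqI)

lemma eval_ncs_add: "eval_ncs x y (f + g) n = eval_ncs x y f n + eval_ncs x y g n"
  by (simp add: eval_ncs_def scaleR_add_left sum.distrib)

lemma eval_ncs_diff: "eval_ncs x y (f - g) n = eval_ncs x y f n - eval_ncs x y g n"
  by (simp add: eval_ncs_def scaleR_diff_left sum_subtractf)

lemma eval_ncs_scaleR: "eval_ncs x y (r *\<^sub>R f) n = r *\<^sub>R eval_ncs x y f n"
  by (simp add: eval_ncs_def scaleR_sum_right)

lemma eval_ncs_0: "eval_ncs x y f 0 = coef f [] *\<^sub>R id_blinfun"
  by (simp add: eval_ncs_def)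

lemma eval_ncs_1: "eval_ncs x y 1 n = (if n = 0 then id_blinfun else 0)"
proof (cases "n = 0")
  case False
  then show ?thesis
    unfolding eval_ncs_def by (auto intro!: sum.neutral)
qed (simp add: eval_ncs_0)

lemma eval_ncs_var: "eval_ncs x y (var_ncs a) n = (if n = 1 then case a of VX \<Rightarrow> x | VY \<Rightarrow> y else 0)"
proof -
  have "eval_ncs x y (var_ncs a) n
      = (\<Sum>w\<in>{w. length w = n}. if w = [a] then word_op x y [a] else 0)"
    unfolding eval_ncs_def by (rule sum.cong) (auto simp: coef_var_ncs)
  also have "\<dots> = (if n = 1 then word_op x y [a] else 0)"
    by (subst sum.delta[OF finite_words]) auto
  also have "word_op x y [a] = (case a of VX \<Rightarrow> x | VY \<Rightarrow> y)"
    by (rule blinfun_eqI) simp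
  finally show ?thesis .
qed

lemma eval_ncs_degree_deriv: "eval_ncs x y (degree_deriv f) n = real n *\<^sub>R eval_ncs x y f n"
  by (simp add: eval_ncs_def scaleR_sum_right)

lemma eval_ncs_sum: "eval_ncs x y (\<Sum>i\<in>I. f i) n = (\<Sum>i\<in>I. eval_ncs x y (f i) n)"
  by (simp add: eval_ncs_def coef_sum scaleR_sum_left) (rule sum.swap)

lemma eval_ncs_formal_sum:
  assumes "summable_family h" "n \<le> M"
  shows "eval_ncs x y (formal_sum h) n = (\<Sum>k\<le>M. eval_ncs x y (h k) n)"
proof -
  have "eval_ncs x y (formal_sum h) n = eval_ncs x y (\<Sum>k\<le>M. h k) n"
    unfolding eval_ncs_def
    by (rule sum.cong) (use assms in \<open>auto simp: coef_formal_sum_extend coef_sum\<close>)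
  then show ?thesis
    by (simp add: eval_ncs_sum)
qed

lemma eval_ncs_mult: "eval_ncs x y (f * g) n = convolution (eval_ncs x y f) (eval_ncs x y g) n"
proof -
  define T where "T u v = (coef f u *\<^sub>R word_op x y u) o\<^sub>L (coef g v *\<^sub>R word_op x y v)" for u v
  have "coef (f * g) w *\<^sub>R word_op x y w = (\<Sum>k\<le>n. T (take k w) (drop k w))" if "length w = n" for w
  proof -
    have "T (take k w) (drop k w) = (coef f (take k w) * coef g (drop k w)) *\<^sub>R word_op x y w" for k
      using word_op_append[of x y "take k w" "drop k w"]
      by (simp add: T_def blinfun_compose.scaleR_left blinfun_compose.scaleR_right)
    then show ?thesis
      using that by (simp add: coef_mult scaleR_sum_left)
  qed
  then have "eval_ncs x y (f * g) n = (\<Sum>w\<in>{w. length w = n}. \<Sum>k\<le>n. T (take k w) (drop k w))"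
    unfolding eval_ncs_def by (intro sum.cong) auto
  also have "\<dots> = (\<Sum>k\<le>n. \<Sum>w\<in>{w. length w = n}. T (take k w) (drop k w))"
    by (rule sum.swap)
  also have "\<dots> = (\<Sum>k\<le>n. eval_ncs x y f k o\<^sub>L eval_ncs x y g (n - k))"
  proof (rule sum.cong)
    fix k assume "k \<in> {..n}"
    have "(\<Sum>w\<in>{w. length w = n}. T (take k w) (drop k w))
        = (\<Sum>(u, v)\<in>{u. length u = k} \<times> {v. length v = n - k}. T u v)"
      by (rule sum.reindex_bij_witness[of _ "\<lambda>(u, v). u @ v" "\<lambda>w. (take k w, drop k w)"])
        (use \<open>k \<in> {..n}\<close> in auto)
    also have "\<dots> = (\<Sum>u\<in>{u. length u = k}. \<Sum>v\<in>{v. length v = n - k}. T u v)"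
      by (rule sum.cartesian_product[symmetric])
    also have "\<dots> = eval_ncs x y f k o\<^sub>L eval_ncs x y g (n - k)"
      by (simp add: eval_ncs_def T_def blinfun_compose.sum_left blinfun_compose.sum_right) (rule sum.swap)
    finally show "(\<Sum>w\<in>{w. length w = n}. T (take k w) (drop k w))
        = eval_ncs x y f k o\<^sub>L eval_ncs x y g (n - k)" .
  qed simp
  finally show ?thesis
    by (simp add: convolution_def)
qed

text \<open>Reversing the summation index in the second product pairs its terms with those of the
  first. Through this identity the seminorm estimates see only brackets.\<close>

lemma eval_ncs_commutator:
  "eval_ncs x y (commutator f g) n = (\<Sum>i\<le>n. op_bracket (eval_ncs x y f i) (eval_ncs x y g (n - i)))"
proof -
  have "convolution (eval_ncs x y g) (eval_ncs x y f) n
      = (\<Sum>i\<le>n. eval_ncs x y g (n - i) o\<^sub>L eval_ncs x y f i)"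
    unfolding convolution_def
    by (rule sum.reindex_bij_witness[of _ "\<lambda>i. n - i" "\<lambda>i. n - i"]) auto
  then show ?thesis
    by (simp add: commutator_def eval_ncs_diff eval_ncs_mult convolution_def op_bracket_def sum_subtractf)
qed

lemma word_op_mem:
  assumes "x \<in> g" "y \<in> g" "\<And>u v. u \<in> g \<Longrightarrow> v \<in> g \<Longrightarrow> u o\<^sub>L v \<in> g" "w \<noteq> []"
  shows "word_op x y w \<in> g"
  using assms(4)
proof (induction w)
  case (Cons a w)
  have a: "(case a of VX \<Rightarrow> x | VY \<Rightarrow> y) \<in> g"
    using assms(1,2) by (cases a) auto
  show ?case
  proof (cases "w = []")
    case True
    moreover have "(case a of VX \<Rightarrow> x | VY \<Rightarrow> y) o\<^sub>L id_blinfun = (case a of VX \<Rightarrow> x | VY \<Rightarrow> y)"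
      by (rule blinfun_eqI) simp
    ultimately show ?thesis
      using a by simp
  qed (use a Cons.IH assms(3) in simp)
qed simp

lemma eval_ncs_mem:
  assumes "subspace g" "x \<in> g" "y \<in> g" "\<And>u v. u \<in> g \<Longrightarrow> v \<in> g \<Longrightarrow> u o\<^sub>L v \<in> g" "coef f [] = 0"
  shows "eval_ncs x y f n \<in> g"
proof (cases "n = 0")
  case True
  then show ?thesis
    using assms(1,5) by (simp add: eval_ncs_0 subspace_0)
next
  case False
  then show ?thesis
    unfolding eval_ncs_def
    by (intro subspace_sum subspace_scale word_op_mem assms) auto
qed

section \<open>Convergence of the Baker--Campbell--Hausdorff series in a normed Lie algebra\<close>

lemma sum_convolution_le:
  fixes \<alpha> \<beta> :: "nat \<Rightarrow> real"
  assumes "\<And>i. 0 \<le> \<alpha> i" "\<And>i. 0 \<le> \<beta> i"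
  shows "(\<Sum>n\<le>N. \<Sum>i\<le>n. \<alpha> i * \<beta> (n - i)) \<le> (\<Sum>i\<le>N. \<alpha> i) * (\<Sum>i\<le>N. \<beta> i)"
proof -
  have "(\<Sum>n\<le>N. \<Sum>i\<le>n. \<alpha> i * \<beta> (n - i)) = (\<Sum>(i, j)\<in>{(i, j). i + j \<le> N}. \<alpha> i * \<beta> j)"
    by (rule sum.triangle_reindex_eq[symmetric])
  also have "\<dots> \<le> (\<Sum>(i, j)\<in>{..N} \<times> {..N}. \<alpha> i * \<beta> j)"
    by (rule sum_mono2) (use assms in auto)
  finally show ?thesis
    by (simp add: sum_product sum.cartesian_product)
qed

text \<open>If both sequences vanish at 0, every contributing pair with
  \<open>i + j \<le> Suc N\<close> has both indices at most \<open>N\<close>. This drop by one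
  drives the induction for the majorant.\<close>

lemma sum_convolution_le_strict:
  fixes \<alpha> \<beta> :: "nat \<Rightarrow> real"
  assumes "\<And>i. 0 \<le> \<alpha> i" "\<And>i. 0 \<le> \<beta> i" "\<alpha> 0 = 0" "\<beta> 0 = 0"
  shows "(\<Sum>n\<le>Suc N. \<Sum>i\<le>n. \<alpha> i * \<beta> (n - i)) \<le> (\<Sum>i\<le>N. \<alpha> i) * (\<Sum>i\<le>N. \<beta> i)"
proof -
  have fin: "finite {(i, j). i + j \<le> Suc N}"
    by (rule finite_subset[of _ "{..Suc N} \<times> {..Suc N}"]) auto
  have "(\<Sum>n\<le>Suc N. \<Sum>i\<le>n. \<alpha> i * \<beta> (n - i)) = (\<Sum>(i, j)\<in>{(i, j). i + j \<le> Suc N}. \<alpha> i * \<beta> j)"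
    by (rule sum.triangle_reindex_eq[symmetric])
  also have "\<dots> = (\<Sum>(i, j)\<in>{(i, j). i + j \<le> Suc N \<and> i \<noteq> 0 \<and> j \<noteq> 0}. \<alpha> i * \<beta> j)"
    by (rule sum.mono_neutral_right[OF fin]) (use assms(3,4) in \<open>auto intro!: gr0I\<close>)
  also have "\<dots> \<le> (\<Sum>(i, j)\<in>{..N} \<times> {..N}. \<alpha> i * \<beta> j)"
    by (rule sum_mono2) (use assms in auto)
  finally show ?thesis
    by (simp add: sum_product sum.cartesian_product)
qed

text \<open>The bracket constant is normalised to 1; the instance used later is \<open>B\<close>
  times the convex envelope.\<close>

locale lie_seminorm =
  fixes g :: "('a::real_normed_vector \<Rightarrow>\<^sub>L 'a) set" and \<nu> :: "('a \<Rightarrow>\<^sub>L 'a) \<Rightarrow> real"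
  assumes subspace_g: "subspace g"
    and compose_mem: "u \<in> g \<Longrightarrow> v \<in> g \<Longrightarrow> u o\<^sub>L v \<in> g"
    and \<nu>_nonneg: "u \<in> g \<Longrightarrow> 0 \<le> \<nu> u"
    and \<nu>_triangle: "u \<in> g \<Longrightarrow> v \<in> g \<Longrightarrow> \<nu> (u + v) \<le> \<nu> u + \<nu> v"
    and \<nu>_scaleR: "u \<in> g \<Longrightarrow> \<nu> (r *\<^sub>R u) = \<bar>r\<bar> * \<nu> u"
    and \<nu>_bracket: "u \<in> g \<Longrightarrow> v \<in> g \<Longrightarrow> \<nu> (op_bracket u v) \<le> \<nu> u * \<nu> v"
begin

lemma bracket_mem: "u \<in> g \<Longrightarrow> v \<in> g \<Longrightarrow> op_bracket u v \<in> g"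
  unfolding op_bracket_def by (intro subspace_diff subspace_g compose_mem)

lemma \<nu>_zero: "\<nu> 0 = 0"
  using \<nu>_scaleR[of 0 0] subspace_0[OF subspace_g] by simp

lemma \<nu>_sum: "(\<And>i. i \<in> I \<Longrightarrow> f i \<in> g) \<Longrightarrow> \<nu> (\<Sum>i\<in>I. f i) \<le> (\<Sum>i\<in>I. \<nu> (f i))"
proof (induction I rule: infinite_finite_induct)
  case (insert i I)
  have "\<nu> (f i + (\<Sum>i\<in>I. f i)) \<le> \<nu> (f i) + \<nu> (\<Sum>i\<in>I. f i)"
    using insert by (intro \<nu>_triangle subspace_sum subspace_g) auto
  also have "\<dots> \<le> \<nu> (f i) + (\<Sum>i\<in>I. \<nu> (f i))"
    using insert by auto
  finally show ?case
    using insert(1,2) by simp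
qed (auto simp: \<nu>_zero)

end

locale bch_majorant = lie_seminorm g \<nu> for g :: "('a::real_normed_vector \<Rightarrow>\<^sub>L 'a) set" and \<nu> +
  fixes x y :: "'a \<Rightarrow>\<^sub>L 'a" and \<rho> :: real
  assumes x: "x \<in> g" and y: "y \<in> g" and \<rho>: "1 \<le> \<rho>" and small: "\<rho> * (\<nu> x + \<nu> y) \<le> 1 / 4"
begin

abbreviation E :: "ncs \<Rightarrow> nat \<Rightarrow> 'a \<Rightarrow>\<^sub>L 'a" where "E \<equiv> eval_ncs x y"

text \<open>Truncated, so that it is finite and can be bounded by induction on \<open>N\<close>
  without prior summability.\<close>

definition W :: "nat \<Rightarrow> ncs \<Rightarrow> real" where
  "W N f = (\<Sum>n\<le>N. \<rho> ^ n * \<nu> (E f n))"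

lemma E_mem: "coef f [] = 0 \<Longrightarrow> E f n \<in> g"
  by (rule eval_ncs_mem[OF subspace_g x y compose_mem])

lemma W_nonneg: "coef f [] = 0 \<Longrightarrow> 0 \<le> W N f"
  unfolding W_def using \<rho> by (intro sum_nonneg mult_nonneg_nonneg \<nu>_nonneg E_mem) auto

lemma coef_commutator_Nil: "coef f [] = 0 \<Longrightarrow> coef h [] = 0 \<Longrightarrow> coef (commutator f h) [] = 0"
  by (simp add: commutator_def coef_mult)

lemma coef_commutator_power_Nil:
  "coef f [] = 0 \<Longrightarrow> coef h [] = 0 \<Longrightarrow> coef ((commutator f ^^ m) h) [] = 0"
  by (induction m) (auto simp: coef_commutator_Nil)

lemma \<nu>_commutator:
  assumes "coef f [] = 0" "coef h [] = 0"
  shows "\<rho> ^ n * \<nu> (E (commutator f h) n)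
    \<le> (\<Sum>i\<le>n. (\<rho> ^ i * \<nu> (E f i)) * (\<rho> ^ (n - i) * \<nu> (E h (n - i))))"
proof -
  have "\<nu> (E (commutator f h) n) \<le> (\<Sum>i\<le>n. \<nu> (op_bracket (E f i) (E h (n - i))))"
    unfolding eval_ncs_commutator by (intro \<nu>_sum bracket_mem E_mem assms)
  also have "\<dots> \<le> (\<Sum>i\<le>n. \<nu> (E f i) * \<nu> (E h (n - i)))"
    by (intro sum_mono \<nu>_bracket E_mem assms)
  finally have "\<rho> ^ n * \<nu> (E (commutator f h) n) \<le> \<rho> ^ n * (\<Sum>i\<le>n. \<nu> (E f i) * \<nu> (E h (n - i)))"
    using \<rho> by (intro mult_left_mono) auto
  also have "\<dots> = (\<Sum>i\<le>n. (\<rho> ^ i * \<nu> (E f i)) * (\<rho> ^ (n - i) * \<nu> (E h (n - i))))"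
    unfolding sum_distrib_left
  proof (rule sum.cong)
    fix i assume "i \<in> {..n}"
    then have "\<rho> ^ n = \<rho> ^ i * \<rho> ^ (n - i)"
      by (simp add: power_add[symmetric])
    then show "\<rho> ^ n * (\<nu> (E f i) * \<nu> (E h (n - i)))
        = (\<rho> ^ i * \<nu> (E f i)) * (\<rho> ^ (n - i) * \<nu> (E h (n - i)))"
      by simp
  qed simp
  finally show ?thesis .
qed

lemma weight_nonneg: "coef f [] = 0 \<Longrightarrow> 0 \<le> \<rho> ^ n * \<nu> (E f n)"
  using \<rho> by (intro mult_nonneg_nonneg \<nu>_nonneg E_mem) auto

lemma W_commutator:
  assumes "coef f [] = 0" "coef h [] = 0"
  shows "W N (commutator f h) \<le> W N f * W N h"
  unfolding W_def
  by (rule order_trans[OF sum_mono sum_convolution_le]) (auto intro: \<nu>_commutator weight_nonneg assms)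

text \<open>Neither argument has a part of degree 0, so components up to degree \<open>N\<close>
  determine the commutator up to degree \<open>Suc N\<close>.\<close>

lemma W_commutator_Suc:
  assumes "coef f [] = 0" "coef h [] = 0"
  shows "W (Suc N) (commutator f h) \<le> W N f * W N h"
  unfolding W_def
  by (rule order_trans[OF sum_mono sum_convolution_le_strict])
    (auto intro: \<nu>_commutator weight_nonneg assms simp: eval_ncs_0 assms \<nu>_zero)

lemma W_commutator_power:
  assumes "coef f [] = 0" "coef h [] = 0"
  shows "W N ((commutator f ^^ m) h) \<le> W N f ^ m * W N h"
proof (induction m)
  case (Suc m)
  have "W N ((commutator f ^^ Suc m) h) \<le> W N f * W N ((commutator f ^^ m) h)"
    using W_commutator[OF assms(1) coef_commutator_power_Nil[OF assms]] by simp
  also have "\<dots> \<le> W N f * (W N f ^ m * W N h)"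
    by (intro mult_left_mono Suc W_nonneg assms)
  finally show ?case
    by (simp add: mult.assoc)
qed simp

lemma W_commutator_power_Suc:
  assumes "coef f [] = 0" "coef h [] = 0"
  shows "W (Suc N) ((commutator f ^^ Suc m) h) \<le> W N f ^ Suc m * W N h"
proof -
  have "W (Suc N) ((commutator f ^^ Suc m) h) \<le> W N f * W N ((commutator f ^^ m) h)"
    using W_commutator_Suc[OF assms(1) coef_commutator_power_Nil[OF assms]] by simp
  also have "\<dots> \<le> W N f * (W N f ^ m * W N h)"
    by (intro mult_left_mono W_commutator_power W_nonneg assms)
  finally show ?thesis
    by (simp add: mult.assoc)
qed

abbreviation Z :: ncs where "Z \<equiv> bch_ncs"
abbreviation DZ :: ncs where "DZ \<equiv> degree_deriv bch_ncs"

lemma DZ_Nil: "coef DZ [] = 0"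
  by simp

lemma var_Nil: "coef (var_ncs a) [] = 0"
  by (simp add: coef_var_ncs)

text \<open>The differential equation solved for its term \<open>m = 0\<close>, which is
  \<open>DZ\<close>. The m-fold commutator starts in degree \<open>m\<close>, so up to degree
  \<open>Suc N\<close> the remaining terms are those with \<open>Suc m \<le> Suc N\<close>.\<close>

lemma bch_recursion:
  assumes "n \<le> Suc N"
  shows "E DZ n = E (var_ncs VX) n + E (var_ncs VY) n
    + (\<Sum>m\<le>N. (1 / fact (Suc m)) *\<^sub>R E ((commutator Z ^^ Suc m) (var_ncs VY)) n)
    - (\<Sum>m\<le>N. (1 / fact (Suc (Suc m))) *\<^sub>R E ((commutator Z ^^ Suc m) DZ) n)"
proof -
  have "E (formal_sum (\<lambda>m. (1 / fact (Suc m)) *\<^sub>R (commutator Z ^^ m) DZ)) n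
      = E (var_ncs VX) n + E (formal_sum (\<lambda>m. (1 / fact m) *\<^sub>R (commutator Z ^^ m) (var_ncs VY))) n"
    by (simp only: bch_differential_equation eval_ncs_add)
  moreover have "E (formal_sum (\<lambda>m. c m *\<^sub>R (commutator Z ^^ m) h)) n
      = c 0 *\<^sub>R E h n + (\<Sum>m\<le>N. c (Suc m) *\<^sub>R E ((commutator Z ^^ Suc m) h) n)" for c h
    by (subst eval_ncs_formal_sum[OF summable_family_commutator_power[OF coef_bch_ncs_Nil] assms],
        subst sum.atMost_Suc_shift) (simp add: eval_ncs_scaleR)
  ultimately show ?thesis
    by (simp add: algebra_simps)
qed

lemma E_commutator_1:
  assumes "coef f [] = 0" "coef h [] = 0"
  shows "E (commutator f h) 1 = 0"
  using assms by (simp add: eval_ncs_commutator eval_ncs_0 op_bracket_def)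

lemma E_bch_1: "E Z 1 = x + y"
proof -
  have "E Z 1 = E DZ 1"
    by (simp add: eval_ncs_degree_deriv)
  also have "\<dots> = x + y"
    using bch_recursion[of 1 0] E_commutator_1[OF coef_bch_ncs_Nil DZ_Nil]
      E_commutator_1[OF coef_bch_ncs_Nil var_Nil] by (simp add: eval_ncs_var)
  finally show ?thesis .
qed

text \<open>
  The factor \<open>1/2\<close> comes from \<open>n \<ge> 2\<close>.  Bounding \<open>W N Z\<close> by \<open>W N DZ\<close> alone would only give a
  smallness constant of about \<open>0.21\<close> in place of \<open>1/4\<close>.
\<close>

lemma W_bch_le: "W N Z \<le> (W N DZ + \<rho> * (\<nu> x + \<nu> y)) / 2"
proof -
  have "\<rho> ^ n * \<nu> (E Z n) \<le> \<rho> ^ n * \<nu> (E DZ n) / 2 + (if n = 1 then \<rho> * (\<nu> x + \<nu> y) / 2 else 0)" for n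
  proof -
    have DZ: "\<nu> (E DZ n) = real n * \<nu> (E Z n)"
      by (simp add: eval_ncs_degree_deriv \<nu>_scaleR E_mem coef_bch_ncs_Nil)
    consider "n = 0" | "n = 1" | "2 \<le> n" by linarith
    then show ?thesis
    proof cases
      case 1
      then show ?thesis by (simp add: eval_ncs_0 coef_bch_ncs_Nil \<nu>_zero)
    next
      case 2
      have "\<nu> (E Z 1) \<le> \<nu> x + \<nu> y"
        unfolding E_bch_1 by (intro \<nu>_triangle x y)
      then have "\<rho> * \<nu> (E Z 1) \<le> \<rho> * (\<nu> x + \<nu> y)"
        using \<rho> by (intro mult_left_mono) auto
      then show ?thesis
        using 2 DZ by simp
    next
      case 3
      have "2 * (\<rho> ^ n * \<nu> (E Z n)) \<le> real n * (\<rho> ^ n * \<nu> (E Z n))"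
        using 3 by (intro mult_right_mono weight_nonneg coef_bch_ncs_Nil) auto
      then show ?thesis
        using 3 DZ by (simp add: algebra_simps)
    qed
  qed
  then have "W N Z \<le> (\<Sum>n\<le>N. \<rho> ^ n * \<nu> (E DZ n) / 2 + (if n = 1 then \<rho> * (\<nu> x + \<nu> y) / 2 else 0))"
    unfolding W_def by (intro sum_mono)
  also have "\<dots> \<le> W N DZ / 2 + \<rho> * (\<nu> x + \<nu> y) / 2"
    using \<rho> \<nu>_nonneg[OF x] \<nu>_nonneg[OF y] by (auto simp: W_def sum.distrib sum_divide_distrib)
  finally show ?thesis by simp
qed

lemma W_var_le: "W N (var_ncs a) \<le> \<rho> * \<nu> (case a of VX \<Rightarrow> x | VY \<Rightarrow> y)"
proof -
  have "W N (var_ncs a) = (\<Sum>n\<le>N. if n = 1 then \<rho> * \<nu> (case a of VX \<Rightarrow> x | VY \<Rightarrow> y) else 0)"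
    unfolding W_def by (rule sum.cong) (auto simp: eval_ncs_var \<nu>_zero)
  also have "\<dots> \<le> \<rho> * \<nu> (case a of VX \<Rightarrow> x | VY \<Rightarrow> y)"
    using \<rho> \<nu>_nonneg[OF x] \<nu>_nonneg[OF y] by (auto split: bch_var.split)
  finally show ?thesis .
qed

lemma W_sum_le:
  assumes "\<And>m. m \<in> M \<Longrightarrow> coef (f m) [] = 0" "\<And>m. 0 \<le> c m"
    and "\<And>n. n \<le> N \<Longrightarrow> \<nu> (a n) \<le> b n + (\<Sum>m\<in>M. c m * \<nu> (E (f m) n))"
  shows "(\<Sum>n\<le>N. \<rho> ^ n * \<nu> (a n)) \<le> (\<Sum>n\<le>N. \<rho> ^ n * b n) + (\<Sum>m\<in>M. c m * W N (f m))"
proof -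
  have "(\<Sum>n\<le>N. \<rho> ^ n * \<nu> (a n)) \<le> (\<Sum>n\<le>N. \<rho> ^ n * (b n + (\<Sum>m\<in>M. c m * \<nu> (E (f m) n))))"
    using \<rho> assms(3) by (intro sum_mono mult_left_mono) auto
  also have "\<dots> = (\<Sum>n\<le>N. \<rho> ^ n * b n) + (\<Sum>n\<le>N. \<Sum>m\<in>M. c m * (\<rho> ^ n * \<nu> (E (f m) n)))"
    by (simp add: distrib_left sum.distrib sum_distrib_left mult_ac)
  also have "(\<Sum>n\<le>N. \<Sum>m\<in>M. c m * (\<rho> ^ n * \<nu> (E (f m) n))) = (\<Sum>m\<in>M. c m * W N (f m))"
    by (subst sum.swap) (simp add: W_def sum_distrib_left)
  finally show ?thesis .
qed

text \<open>Replaces the exponential series by a geometric one at half the argument.\<close>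

lemma two_power_le_fact: "(2::real) ^ m \<le> fact (Suc m)"
proof (induction m)
  case (Suc m)
  have "2 * (2::real) ^ m \<le> real (Suc (Suc m)) * fact (Suc m)"
    using Suc by (intro mult_mono) auto
  then show ?case by (simp add: fact_Suc[of "Suc m"] del: fact_Suc of_nat_Suc)
qed simp

text \<open>3/16 is half of 3/8, the bound for \<open>W N Z\<close> in \<open>W_DZ_le\<close>; 3/13
  is the value of the full geometric series.\<close>

lemma geometric_bound: "(\<Sum>m\<le>N. (3 / 16 :: real) ^ Suc m) \<le> 3 / 13"
proof -
  have "(\<Sum>m\<le>N. (3 / 16 :: real) ^ Suc m) = 3 / 13 * (1 - (3 / 16) ^ Suc N)"
    by (induction N) (auto simp: algebra_simps)
  then show ?thesis by simp
qed

text \<open>\<open>bch_recursion\<close> is estimated term by term. Every commutator term drops to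
  level \<open>N\<close>, so the bounds for \<open>Z\<close> and \<open>DZ\<close> on the right come
  from the induction hypothesis of \<open>W_DZ_le\<close>.\<close>

lemma W_DZ_step:
  "W (Suc N) DZ \<le> W (Suc N) (var_ncs VX) + W (Suc N) (var_ncs VY)
    + (\<Sum>m\<le>N. (1 / fact (Suc m)) * (W N Z ^ Suc m * W N (var_ncs VY)))
    + (\<Sum>m\<le>N. (1 / fact (Suc (Suc m))) * (W N Z ^ Suc m * W N DZ))"
proof -
  let ?Y = "\<lambda>m. (commutator Z ^^ Suc m) (var_ncs VY)" and ?D = "\<lambda>m. (commutator Z ^^ Suc m) DZ"
  have Nil: "coef (?Y m) [] = 0" "coef (?D m) [] = 0" for m
    by (intro coef_commutator_power_Nil coef_bch_ncs_Nil var_Nil DZ_Nil)+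
  have bound: "\<nu> (E DZ n) \<le> ((\<nu> (E (var_ncs VX) n) + \<nu> (E (var_ncs VY) n))
      + (\<Sum>m\<le>N. (1 / fact (Suc m)) * \<nu> (E (?Y m) n)))
      + (\<Sum>m\<le>N. (1 / fact (Suc (Suc m))) * \<nu> (E (?D m) n))" if "n \<le> Suc N" for n
  proof -
    let ?x = "E (var_ncs VX) n" and ?y = "E (var_ncs VY) n"
    let ?a = "\<lambda>m. (1 / fact (Suc m)) *\<^sub>R E (?Y m) n" and ?b = "\<lambda>m. (1 / fact (Suc (Suc m))) *\<^sub>R E (?D m) n"
    have mem: "?x \<in> g" "?y \<in> g" "?a m \<in> g" "?b m \<in> g" for m
      by (intro subspace_scale subspace_g E_mem var_Nil Nil)+
    have sums: "(\<Sum>m\<le>N. ?a m) \<in> g" "(-1) *\<^sub>R (\<Sum>m\<le>N. ?b m) \<in> g"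
      by (rule subspace_sum[OF subspace_g mem(3)],
          rule subspace_scale[OF subspace_g subspace_sum[OF subspace_g mem(4)]])
    have "E DZ n = ((?x + ?y) + (\<Sum>m\<le>N. ?a m)) + (-1) *\<^sub>R (\<Sum>m\<le>N. ?b m)"
      using bch_recursion[OF that] by simp
    also have "\<nu> \<dots> \<le> ((\<nu> ?x + \<nu> ?y) + \<nu> (\<Sum>m\<le>N. ?a m)) + \<nu> ((-1) *\<^sub>R (\<Sum>m\<le>N. ?b m))"
      using mem sums by (meson \<nu>_triangle add_mono_thms_linordered_semiring(3) order_trans subspace_add subspace_g)
    also have "\<nu> ((-1) *\<^sub>R (\<Sum>m\<le>N. ?b m)) = \<nu> (\<Sum>m\<le>N. ?b m)"
      using mem by (subst \<nu>_scaleR) (auto intro: subspace_sum subspace_g)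
    also have "\<nu> (\<Sum>m\<le>N. ?b m) \<le> (\<Sum>m\<le>N. \<nu> (?b m))"
      by (intro \<nu>_sum mem)
    also have "(\<Sum>m\<le>N. \<nu> (?b m)) = (\<Sum>m\<le>N. (1 / fact (Suc (Suc m))) * \<nu> (E (?D m) n))"
      by (intro sum.cong refl) (subst \<nu>_scaleR, auto intro: E_mem Nil simp del: fact_Suc funpow.simps)
    also have "\<nu> (\<Sum>m\<le>N. ?a m) \<le> (\<Sum>m\<le>N. \<nu> (?a m))"
      by (intro \<nu>_sum mem)
    also have "(\<Sum>m\<le>N. \<nu> (?a m)) = (\<Sum>m\<le>N. (1 / fact (Suc m)) * \<nu> (E (?Y m) n))"
      by (intro sum.cong refl) (subst \<nu>_scaleR, auto intro: E_mem Nil simp del: fact_Suc funpow.simps)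
    finally show ?thesis by simp
  qed
  have "W (Suc N) DZ \<le> ((\<Sum>n\<le>Suc N. \<rho> ^ n * ((\<nu> (E (var_ncs VX) n) + \<nu> (E (var_ncs VY) n))
      + (\<Sum>m\<le>N. (1 / fact (Suc m)) * \<nu> (E (?Y m) n)))))
      + (\<Sum>m\<le>N. (1 / fact (Suc (Suc m))) * W (Suc N) (?D m))"
    unfolding W_def[of _ DZ] by (rule W_sum_le[OF Nil(2)]) (use bound in auto)
  also have "(\<Sum>n\<le>Suc N. \<rho> ^ n * ((\<nu> (E (var_ncs VX) n) + \<nu> (E (var_ncs VY) n))
      + (\<Sum>m\<le>N. (1 / fact (Suc m)) * \<nu> (E (?Y m) n))))
      = W (Suc N) (var_ncs VX) + W (Suc N) (var_ncs VY) + (\<Sum>m\<le>N. (1 / fact (Suc m)) * W (Suc N) (?Y m))"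
  proof -
    have "(\<Sum>n\<le>Suc N. \<rho> ^ n * (\<Sum>m\<le>N. (1 / fact (Suc m)) * \<nu> (E (?Y m) n)))
        = (\<Sum>m\<le>N. (1 / fact (Suc m)) * W (Suc N) (?Y m))"
      unfolding W_def sum_distrib_left by (subst sum.swap) (simp add: mult_ac)
    then show ?thesis
      unfolding distrib_left sum.distrib by (simp only: W_def)
  qed
  also have "\<dots> \<le> W (Suc N) (var_ncs VX) + W (Suc N) (var_ncs VY)
      + (\<Sum>m\<le>N. (1 / fact (Suc m)) * (W N Z ^ Suc m * W N (var_ncs VY)))"
    by (intro add_left_mono sum_mono mult_left_mono W_commutator_power_Suc coef_bch_ncs_Nil var_Nil) auto
  also have "(\<Sum>m\<le>N. (1 / fact (Suc (Suc m))) * W (Suc N) (?D m))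
      \<le> (\<Sum>m\<le>N. (1 / fact (Suc (Suc m))) * (W N Z ^ Suc m * W N DZ))"
    by (intro sum_mono mult_left_mono W_commutator_power_Suc coef_bch_ncs_Nil DZ_Nil) auto
  finally show ?thesis by simp
qed

text \<open>A bootstrap: the bound 1/2 at level \<open>N\<close> gives
  \<open>W N Z \<le> (1/2 + 1/4) / 2 = 3/8\<close>. The next level is then at most 1/4 + 2 * (3/13)
  * (1/4) + (3/13) * (1/2) = 25/52, which is below 1/2.\<close>

lemma W_DZ_le: "W N DZ \<le> 1 / 2"
proof (induction N)
  case 0
  show ?case
    by (simp add: W_def eval_ncs_0 \<nu>_zero)
next
  case (Suc N)
  have \<tau>: "0 \<le> W N Z" "W N Z \<le> 3 / 8"
    using W_bch_le[of N] Suc small W_nonneg[OF coef_bch_ncs_Nil] by auto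
  have a: "0 \<le> \<rho> * \<nu> x" "0 \<le> \<rho> * \<nu> y" "\<rho> * \<nu> x + \<rho> * \<nu> y \<le> 1 / 4"
    using \<rho> \<nu>_nonneg[OF x] \<nu>_nonneg[OF y] small by (auto simp: algebra_simps)
  \<comment> \<open>The powers of 2 split off here cancel against the factorials: completely in
    \<open>geo2\<close>, up to a factor 2 in \<open>geo1\<close>.\<close>
  have pow: "W N Z ^ Suc m \<le> 2 ^ Suc m * (3 / 16) ^ Suc m" for m
    using power_mono[OF \<tau>(2,1), of "Suc m"] by (simp add: power_mult_distrib[symmetric])
  have geo1: "(\<Sum>m\<le>N. (1 / fact (Suc m)) * (W N Z ^ Suc m * W N (var_ncs VY)))
      \<le> (\<Sum>m\<le>N. 2 * (3 / 16) ^ Suc m) * (\<rho> * \<nu> y)"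
    unfolding sum_distrib_right
  proof (rule sum_mono)
    fix m
    have "(1 / fact (Suc m)) * W N Z ^ Suc m \<le> (1 / 2 ^ m) * (2 ^ Suc m * (3 / 16) ^ Suc m)"
      using two_power_le_fact[of m] pow[of m] \<tau>(1)
      by (intro mult_mono divide_left_mono) (auto simp del: fact_Suc power_Suc)
    also have "\<dots> = 2 * (3 / 16) ^ Suc m"
      by simp
    finally have "((1 / fact (Suc m)) * W N Z ^ Suc m) * W N (var_ncs VY) \<le> (2 * (3 / 16) ^ Suc m) * (\<rho> * \<nu> y)"
      by (rule mult_mono) (use W_var_le[of N VY] in \<open>simp_all add: W_nonneg var_Nil\<close>)
    then show "(1 / fact (Suc m)) * (W N Z ^ Suc m * W N (var_ncs VY)) \<le> 2 * (3 / 16) ^ Suc m * (\<rho> * \<nu> y)"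
      by (simp only: mult.assoc)
  qed
  have geo2: "(\<Sum>m\<le>N. (1 / fact (Suc (Suc m))) * (W N Z ^ Suc m * W N DZ))
      \<le> (\<Sum>m\<le>N. (3 / 16) ^ Suc m) * (1 / 2)"
    unfolding sum_distrib_right
  proof (rule sum_mono)
    fix m
    have "(1 / fact (Suc (Suc m))) * W N Z ^ Suc m \<le> (1 / 2 ^ Suc m) * (2 ^ Suc m * (3 / 16) ^ Suc m)"
      using two_power_le_fact[of "Suc m"] pow[of m] \<tau>(1)
      by (intro mult_mono divide_left_mono) (auto simp del: fact_Suc power_Suc)
    also have "\<dots> = (3 / 16) ^ Suc m"
      by simp
    finally have "((1 / fact (Suc (Suc m))) * W N Z ^ Suc m) * W N DZ \<le> ((3 / 16) ^ Suc m) * (1 / 2)"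
      by (rule mult_mono) (use Suc in \<open>simp_all add: W_nonneg\<close>)
    then show "(1 / fact (Suc (Suc m))) * (W N Z ^ Suc m * W N DZ) \<le> (3 / 16) ^ Suc m * (1 / 2)"
      by (simp only: mult.assoc)
  qed
  have "(\<Sum>m\<le>N. 2 * (3 / 16 :: real) ^ Suc m) * (\<rho> * \<nu> y) \<le> (2 * (3 / 13)) * (1 / 4)"
  proof (rule mult_mono)
    show "(\<Sum>m\<le>N. 2 * (3 / 16 :: real) ^ Suc m) \<le> 2 * (3 / 13)"
      unfolding sum_distrib_left[symmetric] using geometric_bound[of N] by (rule mult_left_mono) simp
  qed (use a in auto)
  moreover have "W (Suc N) (var_ncs VX) \<le> \<rho> * \<nu> x" "W (Suc N) (var_ncs VY) \<le> \<rho> * \<nu> y"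
    using W_var_le[of "Suc N" VX] W_var_le[of "Suc N" VY] by simp_all
  ultimately show ?case
    using W_DZ_step[of N] geo1 geo2 geometric_bound[of N] a by linarith
qed

lemma W_bch_bounded: "W N Z \<le> 1 / 2"
  using W_bch_le[of N] W_DZ_le[of N] small by simp

end

section \<open>The convex envelope of a quasi-norm\<close>

text \<open>
  For the weak Schatten quasi-norm \<open>q\<close> this still majorizes the operator norm, and it inherits
  bilinear estimates with the same constant while avoiding the quasi-triangle inequality.
\<close>

definition convex_envelope :: "'a::real_vector set \<Rightarrow> ('a \<Rightarrow> real) \<Rightarrow> 'a \<Rightarrow> real" where
  "convex_envelope g q z = Inf {sum_list (map q us) | us. set us \<subseteq> g \<and> sum_list us = z}"

locale nonneg_functional =
  fixes g :: "'a::real_normed_vector set" and q :: "'a \<Rightarrow> real"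
  assumes q_nonneg: "u \<in> g \<Longrightarrow> 0 \<le> q u"
begin

lemma sum_list_q_nonneg: "set us \<subseteq> g \<Longrightarrow> 0 \<le> sum_list (map q us)"
  by (intro sum_list_nonneg) (auto intro: q_nonneg)

lemma convex_envelope_le: "set us \<subseteq> g \<Longrightarrow> convex_envelope g q (sum_list us) \<le> sum_list (map q us)"
  unfolding convex_envelope_def
  by (rule cInf_lower) (auto intro!: bdd_belowI[of _ 0] sum_list_q_nonneg)

lemma convex_envelope_le_self: "u \<in> g \<Longrightarrow> convex_envelope g q u \<le> q u"
  using convex_envelope_le[of "[u]"] by simp

text \<open>The factor \<open>c\<close> lets a bilinear estimate pass to the infimum in one variable
  at a time. For \<open>c = 0\<close> one cannot divide, and the decomposition \<open>[z]\<close> is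
  used instead.\<close>

lemma le_convex_envelope:
  assumes "z \<in> g" "\<And>us. set us \<subseteq> g \<Longrightarrow> sum_list us = z \<Longrightarrow> a \<le> c * sum_list (map q us)" "0 \<le> c"
  shows "a \<le> c * convex_envelope g q z"
proof (cases "c = 0")
  case True
  then show ?thesis
    using assms(1) assms(2)[of "[z]"] by simp
next
  case False
  then have "0 < c" using assms(3) by simp
  have "a / c \<le> convex_envelope g q z"
    unfolding convex_envelope_def
  proof (rule cInf_greatest)
    show "{sum_list (map q us) | us. set us \<subseteq> g \<and> sum_list us = z} \<noteq> {}"
      using assms(1) by (auto intro!: exI[of _ "[z]"])
  qed (use assms(2) \<open>0 < c\<close> in \<open>auto simp: divide_le_eq mult.commute\<close>)
  then show ?thesis
    using \<open>0 < c\<close> by (simp add: divide_le_eq mult.commute)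
qed

lemma convex_envelope_nonneg: "z \<in> g \<Longrightarrow> 0 \<le> convex_envelope g q z"
  using le_convex_envelope[of z 0 1] sum_list_q_nonneg by auto

lemma norm_le_convex_envelope:
  assumes "z \<in> g" "\<And>u. u \<in> g \<Longrightarrow> norm u \<le> q u"
  shows "norm z \<le> convex_envelope g q z"
proof -
  have "norm (sum_list us) \<le> sum_list (map q us)" if "set us \<subseteq> g" for us
    using that
  proof (induction us)
    case (Cons u us)
    then show ?case
      using norm_triangle_ineq[of u "sum_list us"] assms(2)[of u] by auto
  qed simp
  then show ?thesis
    using le_convex_envelope[OF assms(1), of "norm z" 1] by auto
qed

text \<open>Decompositions of \<open>z\<close> and \<open>w\<close> are concatenated, and the two
  infima are taken one after the other.\<close>

lemma convex_envelope_triangle: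
  assumes "z \<in> g" "w \<in> g"
  shows "convex_envelope g q (z + w) \<le> convex_envelope g q z + convex_envelope g q w"
proof -
  have *: "convex_envelope g q (z + w) - sum_list (map q us) \<le> 1 * convex_envelope g q w"
    if "set us \<subseteq> g" "sum_list us = z" for us
  proof (rule le_convex_envelope[OF assms(2)])
    fix vs assume "set vs \<subseteq> g" "sum_list vs = w"
    then show "convex_envelope g q (z + w) - sum_list (map q us) \<le> 1 * sum_list (map q vs)"
      using convex_envelope_le[of "us @ vs"] that by simp
  qed simp
  have "convex_envelope g q (z + w) - convex_envelope g q w \<le> 1 * convex_envelope g q z"
    by (rule le_convex_envelope[OF assms(1)]) (use * in \<open>auto simp: algebra_simps\<close>)
  then show ?thesis by simp
qed

lemma convex_envelope_scaleR_le:
  assumes "subspace g" "z \<in> g" "\<And>u r. u \<in> g \<Longrightarrow> q (r *\<^sub>R u) \<le> \<bar>r\<bar> * q u"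
  shows "convex_envelope g q (r *\<^sub>R z) \<le> \<bar>r\<bar> * convex_envelope g q z"
proof (rule le_convex_envelope[OF assms(2)])
  fix us assume us: "set us \<subseteq> g" "sum_list us = z"
  have "sum_list (map (scaleR r) us) = r *\<^sub>R sum_list us"
    by (induction us) (auto simp: scaleR_add_right)
  moreover have "sum_list (map q (map (scaleR r) us)) \<le> \<bar>r\<bar> * sum_list (map q us)"
    using us(1) by (induction us) (auto simp: distrib_left intro!: add_mono assms(3))
  ultimately show "convex_envelope g q (r *\<^sub>R z) \<le> \<bar>r\<bar> * sum_list (map q us)"
    using convex_envelope_le[of "map (scaleR r) us"] us assms(1) by (force simp: subspace_scale)
qed simp

lemma convex_envelope_scaleR:
  assumes "subspace g" "z \<in> g" "\<And>u r. u \<in> g \<Longrightarrow> q (r *\<^sub>R u) \<le> \<bar>r\<bar> * q u"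
  shows "convex_envelope g q (r *\<^sub>R z) = \<bar>r\<bar> * convex_envelope g q z"
proof (rule antisym)
  show "convex_envelope g q (r *\<^sub>R z) \<le> \<bar>r\<bar> * convex_envelope g q z"
    by (rule convex_envelope_scaleR_le[OF assms])
  show "\<bar>r\<bar> * convex_envelope g q z \<le> convex_envelope g q (r *\<^sub>R z)"
  proof (cases "r = 0")
    case True
    then show ?thesis
      using convex_envelope_nonneg[OF subspace_0[OF assms(1)]] by simp
  next
    case False
    then have "convex_envelope g q z \<le> \<bar>inverse r\<bar> * convex_envelope g q (r *\<^sub>R z)"
      using convex_envelope_scaleR_le[OF assms(1) subspace_scale[OF assms(1,2)] assms(3), of "inverse r" r]
      by simp
    then show ?thesis
      using False by (simp add: field_simps)
  qed
qed

text \<open>Expanding over all pairs of entries decomposes the product, and the sum of the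
  individual bounds factors. No constant is lost, whatever the number of terms.\<close>

lemma convex_envelope_bilinear:
  assumes "bounded_bilinear \<beta>" "z \<in> g" "w \<in> g" "0 \<le> c"
    and mem: "\<And>u v. u \<in> g \<Longrightarrow> v \<in> g \<Longrightarrow> \<beta> u v \<in> g"
    and bound: "\<And>u v. u \<in> g \<Longrightarrow> v \<in> g \<Longrightarrow> q (\<beta> u v) \<le> c * q u * q v"
  shows "convex_envelope g q (\<beta> z w) \<le> c * convex_envelope g q z * convex_envelope g q w"
proof -
  interpret bounded_bilinear \<beta> by fact
  have *: "convex_envelope g q (\<beta> z w) \<le> c * sum_list (map q us) * sum_list (map q vs)"
    if us: "set us \<subseteq> g" "sum_list us = z" and vs: "set vs \<subseteq> g" "sum_list vs = w" for us vs
  proof -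
    define ps where "ps = List.product us vs"
    have right: "\<beta> u (sum_list vs) = (\<Sum>v\<leftarrow>vs. \<beta> u v)" for u and vs :: "'a list"
      by (induction vs) (auto simp: add_right zero_right)
    have "\<beta> (sum_list us) (sum_list vs) = (\<Sum>(u, v)\<leftarrow>List.product us vs. \<beta> u v)"
      by (induction us) (auto simp: add_left zero_left right comp_def sum_list_addf)
    then have sum: "sum_list (map (\<lambda>(u, v). \<beta> u v) ps) = \<beta> z w"
      using us vs by (simp add: ps_def)
    have sub: "set ps \<subseteq> g \<times> g"
      using us vs by (auto simp: ps_def)
    then have "convex_envelope g q (sum_list (map (\<lambda>(u, v). \<beta> u v) ps))
        \<le> sum_list (map q (map (\<lambda>(u, v). \<beta> u v) ps))"
      by (intro convex_envelope_le) (auto intro!: mem)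
    also have "\<dots> \<le> (\<Sum>(u, v)\<leftarrow>ps. c * (q u * q v))"
      using sub bound by (induction ps) (auto intro!: add_mono simp: mult.assoc)
    also have "\<dots> = c * sum_list (map q us) * sum_list (map q vs)"
    proof -
      have row: "(\<Sum>v\<leftarrow>vs. c * (q u * q v)) = c * q u * sum_list (map q vs)" for u and vs :: "'a list"
        by (induction vs) (auto simp: algebra_simps)
      show ?thesis
        unfolding ps_def by (induction us) (auto simp: comp_def row algebra_simps)
    qed
    finally show ?thesis
      using sum by simp
  qed
  have "convex_envelope g q (\<beta> z w) \<le> c * sum_list (map q us) * convex_envelope g q w"
    if us: "set us \<subseteq> g" "sum_list us = z" for us
    by (rule le_convex_envelope[OF assms(3) *[OF us]])
      (use assms(4) sum_list_q_nonneg[OF us(1)] in \<open>auto intro: mult_nonneg_nonneg\<close>)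
  moreover have "0 \<le> c * convex_envelope g q w"
    using assms(3,4) by (simp add: convex_envelope_nonneg)
  ultimately have "convex_envelope g q (\<beta> z w) \<le> c * convex_envelope g q w * convex_envelope g q z"
    by (intro le_convex_envelope[OF assms(2)]) (auto simp: mult_ac)
  then show ?thesis
    by (simp only: mult_ac)
qed

end

section \<open>From operator norm convergence to convergence in the weak Schatten quasi-norm\<close>

lemma blinfun_compose_assoc: "(a o\<^sub>L b) o\<^sub>L c = a o\<^sub>L (b o\<^sub>L c)"
  by (rule blinfun_eqI) simp

lemma convolution_assoc: "convolution (convolution a b) c = convolution a (convolution b c)"
proof
  fix n
  let ?t = "\<lambda>i j l. a i o\<^sub>L (b j o\<^sub>L c l)"
  have "convolution (convolution a b) c n = (\<Sum>j=0..n. \<Sum>i=0..j. ?t i (j - i) (n - j))"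
    by (simp add: convolution_def atLeast0AtMost blinfun_compose.sum_left blinfun_compose_assoc)
  also have "\<dots> = (\<Sum>j=0..n. \<Sum>i=0..n - j. ?t j i (n - j - i))"
    by (rule fps_mult_assoc_lemma)
  also have "\<dots> = convolution a (convolution b c) n"
    by (simp add: convolution_def atLeast0AtMost blinfun_compose.sum_right)
  finally show "convolution (convolution a b) c n = convolution a (convolution b c) n" .
qed

lemma convolution_add_left: "convolution (\<lambda>n. a n + b n) c n = convolution a c n + convolution b c n"
  by (simp add: convolution_def blinfun_compose.add_left sum.distrib)

lemma convolution_add_right: "convolution a (\<lambda>n. b n + c n) n = convolution a b n + convolution a c n"
  by (simp add: convolution_def blinfun_compose.add_right sum.distrib)

lemma convolution_unit_left: "convolution (\<lambda>n. if n = 0 then id_blinfun else 0) c n = c n"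
proof -
  have "convolution (\<lambda>n. if n = 0 then id_blinfun else 0) c n = (\<Sum>i\<le>n. if i = 0 then c n else 0)"
    unfolding convolution_def by (intro sum.cong) (auto intro!: blinfun_eqI)
  then show ?thesis by simp
qed

section \<open>Operator sequences with geometric weights\<close>

definition weighted_norm :: "real \<Rightarrow> nat \<Rightarrow> (nat \<Rightarrow> 'a::real_normed_vector) \<Rightarrow> real" where
  "weighted_norm \<rho> N a = (\<Sum>n\<le>N. \<rho> ^ n * norm (a n))"

lemma weighted_norm_nonneg: "0 \<le> \<rho> \<Longrightarrow> 0 \<le> weighted_norm \<rho> N a"
  by (auto simp: weighted_norm_def intro!: sum_nonneg)

lemma weighted_norm_triangle:
  "0 \<le> \<rho> \<Longrightarrow> weighted_norm \<rho> N (\<lambda>n. a n + b n) \<le> weighted_norm \<rho> N a + weighted_norm \<rho> N b"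
  unfolding weighted_norm_def sum.distrib[symmetric] distrib_left[symmetric]
  by (intro sum_mono mult_left_mono norm_triangle_ineq) auto

lemma weighted_norm_convolution:
  assumes "0 \<le> \<rho>"
  shows "weighted_norm \<rho> N (convolution a b) \<le> weighted_norm \<rho> N a * weighted_norm \<rho> N b"
proof -
  have "\<rho> ^ n * norm (convolution a b n) \<le> (\<Sum>i\<le>n. (\<rho> ^ i * norm (a i)) * (\<rho> ^ (n - i) * norm (b (n - i))))" for n
  proof -
    have "norm (convolution a b n) \<le> (\<Sum>i\<le>n. norm (a i) * norm (b (n - i)))"
      unfolding convolution_def by (intro order_trans[OF norm_sum] sum_mono norm_blinfun_compose)
    then have "\<rho> ^ n * norm (convolution a b n) \<le> \<rho> ^ n * (\<Sum>i\<le>n. norm (a i) * norm (b (n - i)))"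
      using assms by (intro mult_left_mono) auto
    also have "\<dots> = (\<Sum>i\<le>n. (\<rho> ^ i * norm (a i)) * (\<rho> ^ (n - i) * norm (b (n - i))))"
      unfolding sum_distrib_left
    proof (rule sum.cong)
      fix i assume "i \<in> {..n}"
      then have "\<rho> ^ n = \<rho> ^ i * \<rho> ^ (n - i)"
        by (simp add: power_add[symmetric])
      then show "\<rho> ^ n * (norm (a i) * norm (b (n - i)))
          = (\<rho> ^ i * norm (a i)) * (\<rho> ^ (n - i) * norm (b (n - i)))"
        by simp
    qed simp
    finally show ?thesis .
  qed
  then show ?thesis
    unfolding weighted_norm_def
    by (rule order_trans[OF sum_mono sum_convolution_le]) (use assms in auto)
qed

lemma weighted_norm_eval_power:
  assumes "0 \<le> \<rho>" "weighted_norm \<rho> N (eval_ncs x y f) \<le> K"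
  shows "weighted_norm \<rho> N (eval_ncs x y (f ^ k)) \<le> K ^ k"
proof (induction k)
  case 0
  have "weighted_norm \<rho> N (eval_ncs x y 1) = (\<Sum>n\<le>N. if n = 0 then norm (id_blinfun :: 'a \<Rightarrow>\<^sub>L 'a) else 0)"
    unfolding weighted_norm_def by (rule sum.cong) (auto simp: eval_ncs_1)
  \<comment> \<open>The identity has norm 0 on the trivial space, so only the bound by 1 is
    used.\<close>
  then show ?case
    using norm_blinfun_id_le[where 'a='a] by simp
next
  case (Suc k)
  have K: "0 \<le> K"
    using weighted_norm_nonneg[OF assms(1)] assms(2) by (rule order_trans)
  have "weighted_norm \<rho> N (eval_ncs x y (f ^ Suc k))
      = weighted_norm \<rho> N (convolution (eval_ncs x y f) (eval_ncs x y (f ^ k)))"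
    by (simp add: weighted_norm_def eval_ncs_mult)
  also have "\<dots> \<le> weighted_norm \<rho> N (eval_ncs x y f) * weighted_norm \<rho> N (eval_ncs x y (f ^ k))"
    by (rule weighted_norm_convolution[OF assms(1)])
  also have "\<dots> \<le> K * K ^ k"
    by (intro mult_mono assms Suc K weighted_norm_nonneg)
  finally show ?case by simp
qed

lemma weighted_norm_eval_formal_sum:
  assumes "0 \<le> \<rho>" "weighted_norm \<rho> N (eval_ncs x y f) \<le> K" "coef f [] = 0"
    and c: "\<And>k. \<bar>c k\<bar> \<le> 1 / fact k"
  shows "weighted_norm \<rho> N (eval_ncs x y (formal_sum (\<lambda>k. c k *\<^sub>R f ^ k))) \<le> exp K"
proof -
  have K: "0 \<le> K"
    using weighted_norm_nonneg[OF assms(1)] assms(2) by (rule order_trans)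
  have "weighted_norm \<rho> N (eval_ncs x y (formal_sum (\<lambda>k. c k *\<^sub>R f ^ k)))
      \<le> (\<Sum>n\<le>N. \<Sum>k\<le>N. (1 / fact k) * (\<rho> ^ n * norm (eval_ncs x y (f ^ k) n)))"
    unfolding weighted_norm_def
  proof (rule sum_mono)
    fix n assume "n \<in> {..N}"
    then have "eval_ncs x y (formal_sum (\<lambda>k. c k *\<^sub>R f ^ k)) n = (\<Sum>k\<le>N. c k *\<^sub>R eval_ncs x y (f ^ k) n)"
      by (simp add: eval_ncs_formal_sum[OF summable_family_powers[OF assms(3)], of n N] eval_ncs_scaleR)
    also have "norm \<dots> \<le> (\<Sum>k\<le>N. (1 / fact k) * norm (eval_ncs x y (f ^ k) n))"
      by (intro order_trans[OF norm_sum] sum_mono, unfold norm_scaleR) (rule mult_right_mono[OF c norm_ge_zero])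
    finally have "\<rho> ^ n * norm (eval_ncs x y (formal_sum (\<lambda>k. c k *\<^sub>R f ^ k)) n)
        \<le> \<rho> ^ n * (\<Sum>k\<le>N. (1 / fact k) * norm (eval_ncs x y (f ^ k) n))"
      using assms(1) by (intro mult_left_mono) auto
    then show "\<rho> ^ n * norm (eval_ncs x y (formal_sum (\<lambda>k. c k *\<^sub>R f ^ k)) n)
        \<le> (\<Sum>k\<le>N. (1 / fact k) * (\<rho> ^ n * norm (eval_ncs x y (f ^ k) n)))"
      by (simp add: sum_distrib_left mult_ac)
  qed
  also have "\<dots> = (\<Sum>k\<le>N. (1 / fact k) * weighted_norm \<rho> N (eval_ncs x y (f ^ k)))"
    by (subst sum.swap) (simp add: weighted_norm_def sum_distrib_left)
  also have "\<dots> \<le> (\<Sum>k\<le>N. (1 / fact k) * K ^ k)"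
    by (intro sum_mono mult_left_mono weighted_norm_eval_power assms) auto
  also have "\<dots> = (\<Sum>k\<in>{..N}. K ^ k /\<^sub>R fact k)"
    by (simp add: divide_inverse mult.commute)
  also have "\<dots> \<le> (\<Sum>k. K ^ k /\<^sub>R fact k)"
    by (rule sum_le_suminf[OF summable_exp_generic]) (use K in auto)
  finally show ?thesis
    by (simp add: exp_def)
qed

text \<open>Beyond \<open>N\<close> every weight is at least \<open>\<rho> ^ N\<close>, so the
  weighted bound also controls the tails.\<close>

lemma geometric_tail:
  fixes a :: "nat \<Rightarrow> 'a::banach"
  assumes \<rho>: "1 < \<rho>" and K: "\<And>N. weighted_norm \<rho> N a \<le> K"
  obtains L where "\<And>N. norm (L - (\<Sum>n\<le>N. a n)) \<le> K / \<rho> ^ N"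
proof -
  have partial: "norm ((\<Sum>n\<le>M. a n) - (\<Sum>n\<le>N. a n)) \<le> K / \<rho> ^ N" if "N \<le> M" for M N
  proof -
    have "(\<Sum>n\<le>M. a n) - (\<Sum>n\<le>N. a n) = (\<Sum>n\<in>{..M} - {..N}. a n)"
      using that by (subst sum_diff) auto
    also have "norm \<dots> \<le> (\<Sum>n\<in>{..M} - {..N}. \<rho> ^ n * norm (a n) / \<rho> ^ N)"
    proof (intro order_trans[OF norm_sum] sum_mono)
      fix n assume "n \<in> {..M} - {..N}"
      then have "\<rho> ^ N \<le> \<rho> ^ n"
        using \<rho> by (intro power_increasing) auto
      then show "norm (a n) \<le> \<rho> ^ n * norm (a n) / \<rho> ^ N"
        using \<rho> by (simp add: le_divide_eq mult.commute mult_right_mono)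
    qed
    also have "\<dots> \<le> (\<Sum>n\<le>M. \<rho> ^ n * norm (a n) / \<rho> ^ N)"
      using \<rho> by (intro sum_mono2) auto
    also have "\<dots> \<le> K / \<rho> ^ N"
      using K[of M] \<rho> unfolding weighted_norm_def sum_divide_distrib[symmetric]
      by (intro divide_right_mono) auto
    finally show ?thesis .
  qed
  have null: "(\<lambda>N. K / \<rho> ^ N) \<longlonglongrightarrow> 0"
    using \<rho> by real_asymp
  have "Cauchy (\<lambda>N. \<Sum>n\<le>N. a n)"
  proof (rule metric_CauchyI)
    fix e :: real assume "0 < e"
    then obtain N0 where N0: "\<And>N. N0 \<le> N \<Longrightarrow> \<bar>K / \<rho> ^ N\<bar> < e / 2"
      using LIMSEQ_D[OF null, of "e / 2"] by auto
    have "dist (\<Sum>n\<le>M. a n) (\<Sum>n\<le>N. a n) < e" if "N0 \<le> M" "N0 \<le> N" for M N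
    proof -
      have "norm ((\<Sum>n\<le>M. a n) - (\<Sum>n\<le>N0. a n)) < e / 2" "norm ((\<Sum>n\<le>N. a n) - (\<Sum>n\<le>N0. a n)) < e / 2"
        using partial[OF that(1)] partial[OF that(2)] N0[of N0] abs_ge_self[of "K / \<rho> ^ N0"]
        by linarith+
      then show ?thesis
        using norm_triangle_ineq4[of "(\<Sum>n\<le>M. a n) - (\<Sum>n\<le>N0. a n)" "(\<Sum>n\<le>N. a n) - (\<Sum>n\<le>N0. a n)"]
        by (simp add: dist_norm)
    qed
    then show "\<exists>N0. \<forall>M\<ge>N0. \<forall>N\<ge>N0. dist (\<Sum>n\<le>M. a n) (\<Sum>n\<le>N. a n) < e"
      by blast
  qed
  then obtain L where L: "(\<lambda>N. \<Sum>n\<le>N. a n) \<longlonglongrightarrow> L"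
    using Cauchy_convergent convergent_def by blast
  have "norm (L - (\<Sum>n\<le>N. a n)) \<le> K / \<rho> ^ N" for N
  proof (rule Lim_norm_ubound[OF _ tendsto_diff[OF L tendsto_const]])
    show "\<forall>\<^sub>F M in sequentially. norm ((\<Sum>n\<le>M. a n) - (\<Sum>n\<le>N. a n)) \<le> K / \<rho> ^ N"
      unfolding eventually_sequentially using partial by blast
  qed simp
  then show ?thesis by (rule that)
qed

text \<open>Homogeneous coefficients of the left inverse of 1 + u, for
  \<open>u 0 = 0\<close>.\<close>

fun resolvent :: "(nat \<Rightarrow> 'a::real_normed_vector \<Rightarrow>\<^sub>L 'a) \<Rightarrow> nat \<Rightarrow> 'a \<Rightarrow>\<^sub>L 'a" where
  "resolvent u n = (if n = 0 then id_blinfun else - (\<Sum>i<n. resolvent u i o\<^sub>L u (n - i)))"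

declare resolvent.simps [simp del]

lemma resolvent_eq:
  assumes "u 0 = 0"
  shows "resolvent u n + convolution (resolvent u) u n = (if n = 0 then id_blinfun else 0)"
proof -
  have "convolution (resolvent u) u n = (\<Sum>i<n. resolvent u i o\<^sub>L u (n - i)) + (resolvent u n o\<^sub>L u 0)"
    unfolding convolution_def lessThan_Suc_atMost[symmetric] by simp
  then show ?thesis
    using assms resolvent.simps[of u n] by (cases "n = 0") simp_all
qed

text \<open>From V = 1 - V u follows |V| \<le> 1 + |V| / 2, and the last term is absorbed because
  truncated norms are finite.\<close>

lemma weighted_norm_resolvent:
  assumes "0 \<le> \<rho>" "u 0 = 0" "\<And>N. weighted_norm \<rho> N u \<le> 1 / 2"
  shows "weighted_norm \<rho> N (resolvent u) \<le> 2"
proof -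
  let ?\<delta> = "\<lambda>n. if n = 0 then id_blinfun else 0 :: 'a \<Rightarrow>\<^sub>L 'a"
  have "weighted_norm \<rho> N ?\<delta> = (\<Sum>n\<le>N. if n = 0 then norm (id_blinfun :: 'a \<Rightarrow>\<^sub>L 'a) else 0)"
    unfolding weighted_norm_def by (rule sum.cong) auto
  then have \<delta>: "weighted_norm \<rho> N ?\<delta> \<le> 1"
    using norm_blinfun_id_le[where 'a='a] by simp
  have "resolvent u = (\<lambda>n. ?\<delta> n + (- convolution (resolvent u) u n))"
  proof
    fix n
    show "resolvent u n = ?\<delta> n + (- convolution (resolvent u) u n)"
      using resolvent_eq[of u n, OF assms(2)] by (simp only: diff_conv_add_uminus[symmetric] eq_diff_eq)
  qed
  then have "weighted_norm \<rho> N (resolvent u) = weighted_norm \<rho> N (\<lambda>n. ?\<delta> n + (- convolution (resolvent u) u n))"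
    by (rule arg_cong)
  also have "\<dots> \<le> weighted_norm \<rho> N ?\<delta> + weighted_norm \<rho> N (\<lambda>n. - convolution (resolvent u) u n)"
    by (rule weighted_norm_triangle[OF assms(1)])
  also have "weighted_norm \<rho> N (\<lambda>n. - convolution (resolvent u) u n) = weighted_norm \<rho> N (convolution (resolvent u) u)"
    by (simp add: weighted_norm_def)
  also have "\<dots> \<le> weighted_norm \<rho> N (resolvent u) * weighted_norm \<rho> N u"
    by (rule weighted_norm_convolution[OF assms(1)])
  also have "\<dots> \<le> weighted_norm \<rho> N (resolvent u) * (1 / 2)"
    by (intro mult_left_mono assms weighted_norm_nonneg)
  finally show ?thesis
    using \<delta> by simp
qed

lemma power_over_geometric_null:
  fixes \<rho> q :: real
  assumes "1 < \<rho>"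
  shows "(\<lambda>N. C * (real N + 2) / \<rho> ^ N * (real N + 2) powr q) \<longlonglongrightarrow> 0"
proof -
  have "(\<lambda>N. (real N + 2) / \<rho> ^ N * (real N + 2) powr q) \<longlonglongrightarrow> 0"
    using assms by real_asymp
  from tendsto_mult_right_zero[OF this, of C] show ?thesis
    by (simp add: mult.assoc)
qed

section \<open>Convolutions converging in the weak Schatten ideal\<close>

lemma convolution_sum_left: "convolution (\<lambda>n. \<Sum>d\<in>D. a d n) c n = (\<Sum>d\<in>D. convolution (a d) c n)"
  by (simp add: convolution_def blinfun_compose.sum_left) (rule sum.swap)

lemma convolution_var:
  "convolution a (\<lambda>n. if n = 1 then T else 0) n = (if n = 0 then 0 else a (n - 1) o\<^sub>L T)"
proof -
  have "convolution a (\<lambda>n. if n = 1 then T else 0) n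
      = (\<Sum>i\<le>n. if i = n - 1 then (if n = 0 then 0 else a (n - 1) o\<^sub>L T) else 0)"
    unfolding convolution_def by (rule sum.cong) auto
  then show ?thesis by simp
qed

text \<open>Right multiplication by a term of degree 1 shifts the index by one, so \<open>T\<close>
  factors out of the partial sum.\<close>

lemma sum_convolution_var:
  "(\<Sum>n\<le>N. convolution a (\<lambda>n. if n = 1 then T else 0) n) = (\<Sum>n<N. a n) o\<^sub>L T"
proof -
  have "(\<Sum>n\<le>N. convolution a (\<lambda>n. if n = 1 then T else 0) n) = (\<Sum>n<N. a n o\<^sub>L T)"
    unfolding convolution_var by (induction N) auto
  then show ?thesis
    by (simp add: blinfun_compose.sum_left)
qed

text \<open>The right factor \<open>T\<close> stays fixed while the left factors converge in
  operator norm to some \<open>A\<close>; the ideal property gives the limit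
  \<open>A o\<^sub>L T\<close>.\<close>

lemma weak_null_convolution_var:
  fixes T :: "'a::complex_hilbert \<Rightarrow>\<^sub>L 'a"
  assumes "0 < p" "1 < \<rho>" "\<And>N. weighted_norm \<rho> N a \<le> K" "T \<in> weak_schatten p"
  obtains L where "weak_null p (\<lambda>N. (\<Sum>n\<le>N. convolution a (\<lambda>n. if n = 1 then T else 0) n) - L)"
proof -
  obtain A where A: "\<And>N. norm (A - (\<Sum>n\<le>N. a n)) \<le> K / \<rho> ^ N"
    using geometric_tail[OF assms(2,3)] by blast
  have "(\<lambda>N. K / \<rho> ^ N) \<longlonglongrightarrow> 0"
    using assms(2) by real_asymp
  then have "(\<lambda>N. A - (\<Sum>n\<le>N. a n)) \<longlonglongrightarrow> 0"
    by (rule Lim_null_comparison[rotated]) (use A in auto)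
  then have "(\<lambda>N. (\<Sum>n\<le>N. a n)) \<longlonglongrightarrow> A"
    using tendsto_diff[OF tendsto_const[of A]] by fastforce
  then have "(\<lambda>N. (\<Sum>n<Suc N. a n)) \<longlonglongrightarrow> A"
    by (simp add: lessThan_Suc_atMost)
  then have "(\<lambda>N. (\<Sum>n<N. a n)) \<longlonglongrightarrow> A"
    by (rule LIMSEQ_imp_Suc)
  then have "(\<lambda>N. (\<Sum>n<N. a n) - A) \<longlonglongrightarrow> 0"
    by (rule LIM_zero)
  from weak_null_compose[OF this assms(1,4)] show ?thesis
    by (intro that[of "A o\<^sub>L T"]) (simp only: sum_convolution_var blinfun_compose.diff_left)
qed

text \<open>
  The partial sums have rank \<open>O(N)\<close>, which costs only a polynomial factor against the geometric
  decay of the remainder in operator norm.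
\<close>

lemma weak_null_convolution_finite_rank:
  fixes G :: "'a::complex_hilbert \<Rightarrow>\<^sub>L 'a"
  assumes p: "0 < p" and \<rho>: "1 < \<rho>" and a: "\<And>N. weighted_norm \<rho> N a \<le> K" and z: "\<And>N. weighted_norm \<rho> N z \<le> K'"
    and G: "rank_le m G" and lin: "\<And>n. complex_linear (z n)"
  obtains L where "weak_null p (\<lambda>N. (\<Sum>n\<le>N. convolution (\<lambda>n. a n o\<^sub>L G) z n) - L)"
proof -
  obtain A where A: "\<And>N. norm (A - (\<Sum>n\<le>N. a n)) \<le> K / \<rho> ^ N"
    using geometric_tail[OF \<rho> a] by blast
  obtain S where S: "\<And>N. norm (S - (\<Sum>n\<le>N. z n)) \<le> K' / \<rho> ^ N"
    using geometric_tail[OF \<rho> z] by blast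
  have null: "(\<lambda>N. K' / \<rho> ^ N) \<longlonglongrightarrow> 0"
    using \<rho> by real_asymp
  have "(\<lambda>N. S - (\<Sum>n\<le>N. z n)) \<longlonglongrightarrow> 0"
    by (rule Lim_null_comparison[OF _ null]) (use S in auto)
  then have "(\<lambda>N. (\<Sum>n\<le>N. z n)) \<longlonglongrightarrow> S"
    using tendsto_diff[OF tendsto_const[of S]] by fastforce
  then have linS: "complex_linear S"
    by (rule complex_linear_limit) (intro complex_linear_sum lin)
  have K0: "0 \<le> K" "0 \<le> K'"
    using a[of 0] z[of 0] weighted_norm_nonneg[of \<rho> 0 a] weighted_norm_nonneg[of \<rho> 0 z] \<rho> by auto
  define s where "s N = (\<Sum>n\<le>N. z n)" for N
  define R where "R N = (\<Sum>n\<le>N. convolution (\<lambda>n. a n o\<^sub>L G) z n) - (A o\<^sub>L (G o\<^sub>L S))" for N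
  \<comment> \<open>Grouping the pairs \<open>i + j \<le> N\<close> by \<open>i\<close> leaves
    \<open>N + 1\<close> operators of rank at most \<open>m\<close>; with the limit this gives rank
    \<open>(N + 2) * m\<close>.\<close>
  have partial: "(\<Sum>n\<le>N. convolution (\<lambda>n. a n o\<^sub>L G) z n) = (\<Sum>i<Suc N. a i o\<^sub>L (G o\<^sub>L s (N - i)))" for N
  proof -
    have "(\<Sum>n\<le>N. convolution (\<lambda>n. a n o\<^sub>L G) z n) = (\<Sum>n\<le>N. \<Sum>i\<le>n. a i o\<^sub>L (G o\<^sub>L z (n - i)))"
      by (simp add: convolution_def blinfun_compose_assoc)
    also have "\<dots> = (\<Sum>(i, j)\<in>{(i, j). i + j \<le> N}. a i o\<^sub>L (G o\<^sub>L z j))"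
      by (rule sum.triangle_reindex_eq[symmetric])
    also have "{(i, j). i + j \<le> N} = Sigma {..<Suc N} (\<lambda>i. {..N - i})"
      by auto
    also have "(\<Sum>(i, j)\<in>Sigma {..<Suc N} (\<lambda>i. {..N - i}). a i o\<^sub>L (G o\<^sub>L z j))
        = (\<Sum>i<Suc N. \<Sum>j\<le>N - i. a i o\<^sub>L (G o\<^sub>L z j))"
      by (rule sum.Sigma[symmetric]) auto
    finally show ?thesis
      by (simp add: s_def blinfun_compose.sum_right)
  qed
  have rank: "rank_le ((N + 2) * m) (R N)" for N
  proof -
    have "rank_le m (a i o\<^sub>L (G o\<^sub>L s (N - i)))" for i
      unfolding s_def
      by (intro rank_le_compose_left rank_le_compose_right[OF G] complex_linear_sum lin)
    then have "rank_le (Suc N * m) (\<Sum>i<Suc N. a i o\<^sub>L (G o\<^sub>L s (N - i)))"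
      by (rule rank_le_sum)
    moreover have "rank_le m (A o\<^sub>L (G o\<^sub>L S))"
      by (intro rank_le_compose_left rank_le_compose_right[OF G] linS)
    ultimately have "rank_le (Suc N * m + m) (R N)"
      unfolding R_def partial by (rule rank_le_diff)
    then show ?thesis
      by (simp add: algebra_simps)
  qed
  define C where "C = K * norm G * (K' + norm S)"
  have C: "0 \<le> C"
    using K0 by (simp add: C_def)
  have norm: "norm (R N) \<le> C * (real N + 2) / \<rho> ^ N" for N
  proof -
    \<comment> \<open>Both parts are of order rho^(-N): in the i-th summand the tail of
      \<open>z\<close> gives rho^(-(N - i)), and the missing rho^(-i) comes from the weight of
      \<open>a i\<close>.\<close>
    have "R N = - ((\<Sum>i\<le>N. a i o\<^sub>L (G o\<^sub>L (S - s (N - i)))) + ((A - (\<Sum>i\<le>N. a i)) o\<^sub>L (G o\<^sub>L S)))"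
      unfolding R_def partial lessThan_Suc_atMost
      by (simp add: blinfun_compose.diff_right blinfun_compose.diff_left blinfun_compose.sum_left sum_subtractf)
    then have "norm (R N) = norm ((\<Sum>i\<le>N. a i o\<^sub>L (G o\<^sub>L (S - s (N - i)))) + ((A - (\<Sum>i\<le>N. a i)) o\<^sub>L (G o\<^sub>L S)))"
      by (simp only: norm_minus_cancel)
    also have "\<dots> \<le> norm (\<Sum>i\<le>N. a i o\<^sub>L (G o\<^sub>L (S - s (N - i)))) + norm ((A - (\<Sum>i\<le>N. a i)) o\<^sub>L (G o\<^sub>L S))"
      by (rule norm_triangle_ineq)
    also have "norm ((A - (\<Sum>i\<le>N. a i)) o\<^sub>L (G o\<^sub>L S)) \<le> (K / \<rho> ^ N) * (norm G * norm S)"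
      using \<rho> K0 by (intro order_trans[OF norm_blinfun_compose] mult_mono A norm_blinfun_compose) auto
    also have "norm (\<Sum>i\<le>N. a i o\<^sub>L (G o\<^sub>L (S - s (N - i)))) \<le> (\<Sum>i\<le>N. (\<rho> ^ i * norm (a i)) * (norm G * K' / \<rho> ^ N))"
    proof (intro order_trans[OF norm_sum] sum_mono)
      fix i assume "i \<in> {..N}"
      then have \<rho>N: "\<rho> ^ N = \<rho> ^ i * \<rho> ^ (N - i)"
        by (simp add: power_add[symmetric])
      have "norm (a i o\<^sub>L (G o\<^sub>L (S - s (N - i)))) \<le> norm (a i) * (norm G * (K' / \<rho> ^ (N - i)))"
        unfolding s_def
        by (intro order_trans[OF norm_blinfun_compose] mult_mono mult_left_mono S) (use K0 \<rho> in auto)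
      also have "\<dots> = (\<rho> ^ i * norm (a i)) * (norm G * K' / \<rho> ^ N)"
        unfolding \<rho>N using \<rho> by simp
      finally show "norm (a i o\<^sub>L (G o\<^sub>L (S - s (N - i)))) \<le> (\<rho> ^ i * norm (a i)) * (norm G * K' / \<rho> ^ N)" .
    qed
    also have "\<dots> = weighted_norm \<rho> N a * (norm G * K' / \<rho> ^ N)"
      by (simp only: weighted_norm_def sum_distrib_right)
    also have "\<dots> \<le> K * (norm G * K' / \<rho> ^ N)"
      using \<rho> K0 by (intro mult_right_mono a) auto
    finally have "norm (R N) \<le> C / \<rho> ^ N"
      by (simp add: C_def add_divide_distrib algebra_simps)
    also have "\<dots> \<le> C * (real N + 2) / \<rho> ^ N"
      using C \<rho> by (intro divide_right_mono) (auto simp: mult_le_cancel_left1)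
    finally show ?thesis .
  qed
  have "weak_approx p (C * (real N + 2) / \<rho> ^ N * (real N + 2) powr (1 / p) * real m powr (1 / p)) (R N)" for N
  proof (rule weak_approx_mono[OF weak_approx_rank[OF rank p]])
    have "norm (R N) * real ((N + 2) * m) powr (1 / p) = norm (R N) * ((real N + 2) powr (1 / p) * real m powr (1 / p))"
      by (simp add: powr_mult[symmetric] algebra_simps)
    also have "\<dots> \<le> (C * (real N + 2) / \<rho> ^ N) * ((real N + 2) powr (1 / p) * real m powr (1 / p))"
      by (intro mult_right_mono norm) auto
    finally show "norm (R N) * real ((N + 2) * m) powr (1 / p)
        \<le> C * (real N + 2) / \<rho> ^ N * (real N + 2) powr (1 / p) * real m powr (1 / p)"
      by (simp add: mult.assoc)
  qed
  moreover have "(\<lambda>N. C * (real N + 2) / \<rho> ^ N * (real N + 2) powr (1 / p) * real m powr (1 / p)) \<longlonglongrightarrow> 0"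
    by (rule tendsto_mult_left_zero[OF power_over_geometric_null[OF \<rho>]])
  ultimately have "weak_null p R"
    unfolding weak_null_def by blast
  then show ?thesis
    using that unfolding R_def by blast
qed

lemma finite_rank_approximation:
  assumes "0 < p" "T \<in> weak_schatten p" "0 < \<epsilon>"
  obtains k F where "rank_le k F" "norm (T - F) \<le> \<epsilon>"
proof -
  have "(\<lambda>k. real (Suc k) powr (- 1 / p)) \<longlonglongrightarrow> 0"
    using assms(1) by real_asymp
  then have "(\<lambda>k. weak_schatten_norm p T * real (Suc k) powr (- 1 / p)) \<longlonglongrightarrow> 0"
    by (rule tendsto_mult_right_zero)
  then have "\<forall>\<^sub>F k in sequentially. weak_schatten_norm p T * real (Suc k) powr (- 1 / p) < \<epsilon>"
    using assms(3) by (rule order_tendstoD)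
  then obtain k where "weak_schatten_norm p T * real (Suc k) powr (- 1 / p) < \<epsilon>"
    by (auto simp: eventually_sequentially)
  moreover obtain F where "rank_le k F" "norm (T - F) \<le> weak_schatten_norm p T * real (Suc k) powr (- 1 / p)"
    using weak_approx_weak_schatten[OF assms(1,2)] unfolding weak_approx_def by blast
  ultimately show ?thesis
    by (intro that[of k F]) auto
qed

lemma finite_rank_approximation_sequence:
  fixes z :: "nat \<Rightarrow> 'a::complex_hilbert \<Rightarrow>\<^sub>L 'a"
  assumes p: "0 < p" and \<rho>: "1 < \<rho>" and z: "\<And>N. weighted_norm \<rho> N z \<le> K"
    and mem: "\<And>n. z n \<in> weak_schatten p" and z0: "z 0 = 0" and \<epsilon>: "0 < \<epsilon>"
  obtains F k D where "\<And>n. rank_le (k n) (F n)" "F 0 = 0" "\<And>n. D \<le> n \<Longrightarrow> F n = 0"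
    "\<And>N. weighted_norm \<rho> N (\<lambda>n. z n - F n) \<le> \<epsilon>"
proof -
  have "summable (\<lambda>n. \<rho> ^ n * norm (z n))"
    by (rule bounded_imp_summable[of _ K]) (use z \<rho> in \<open>auto simp: weighted_norm_def\<close>)
  then have "\<exists>D. \<forall>m\<ge>D. \<forall>n. norm (\<Sum>i\<in>{m..<n}. \<rho> ^ i * norm (z i)) < \<epsilon> / 2"
    using half_gt_zero[OF \<epsilon>] unfolding summable_Cauchy by (elim allE[of _ "\<epsilon> / 2"]) blast
  then obtain D where D: "\<And>n. norm (\<Sum>i\<in>{D..<n}. \<rho> ^ i * norm (z i)) < \<epsilon> / 2"
    by blast
  \<comment> \<open>The weighted errors of the first \<open>D\<close> terms add up to at most half
    of the tolerance; the other half pays for the tail. \<open>D + 1\<close> guards against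
    \<open>D = 0\<close>.\<close>
  define \<delta> where "\<delta> n = \<epsilon> / (2 * (real D + 1) * \<rho> ^ n)" for n
  have "0 < \<delta> n" for n
    using \<epsilon> \<rho> by (simp add: \<delta>_def)
  then have "\<exists>k F. rank_le k F \<and> norm (z n - F) \<le> \<delta> n" for n
    by (rule finite_rank_approximation[OF p mem]) blast+
  then obtain k F where F: "\<And>n. rank_le (k n) (F n)" "\<And>n. norm (z n - F n) \<le> \<delta> n"
    by metis
  \<comment> \<open>The value 0 at index 0 is kept so that the perturbation built from
    \<open>z - F'\<close> starts in degree 1, as the resolvent requires.\<close>
  define F' where "F' n = (if n = 0 \<or> D \<le> n then 0 else F n)" for n
  have "weighted_norm \<rho> N (\<lambda>n. z n - F' n) \<le> \<epsilon>" for N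
  proof -
    have termwise: "\<rho> ^ n * norm (z n - F' n) \<le> (if n < D then \<epsilon> / (2 * (real D + 1)) else 0)
        + (if D \<le> n then \<rho> ^ n * norm (z n) else 0)" for n
    proof -
      have "\<rho> ^ n * norm (z n - F n) \<le> \<rho> ^ n * \<delta> n"
        using \<rho> F(2) by (intro mult_left_mono) auto
      also have "\<dots> = \<epsilon> / (2 * (real D + 1))"
        using \<rho> by (simp add: \<delta>_def)
      finally show ?thesis
        using \<epsilon> by (auto simp: F'_def z0)
    qed
    have "weighted_norm \<rho> N (\<lambda>n. z n - F' n)
        \<le> (\<Sum>n\<le>N. if n < D then \<epsilon> / (2 * (real D + 1)) else 0) + (\<Sum>n\<le>N. if D \<le> n then \<rho> ^ n * norm (z n) else 0)"
      unfolding weighted_norm_def sum.distrib[symmetric] by (intro sum_mono termwise)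
    also have "(\<Sum>n\<le>N. if n < D then \<epsilon> / (2 * (real D + 1)) else 0) = (\<Sum>n\<in>{..N} \<inter> {..<D}. \<epsilon> / (2 * (real D + 1)))"
      by (subst sum.inter_restrict) auto
    also have "\<dots> \<le> (\<Sum>n<D. \<epsilon> / (2 * (real D + 1)))"
      using \<epsilon> by (intro sum_mono2) auto
    also have "\<dots> \<le> \<epsilon> / 2"
      using \<epsilon> by (simp add: field_simps)
    also have "(\<Sum>n\<le>N. if D \<le> n then \<rho> ^ n * norm (z n) else 0) = (\<Sum>n\<in>{..N} \<inter> {D..}. \<rho> ^ n * norm (z n))"
      by (subst sum.inter_restrict) auto
    also have "{..N} \<inter> {D..} = {D..<Suc N}"
      by auto
    also have "(\<Sum>n\<in>{D..<Suc N}. \<rho> ^ n * norm (z n)) \<le> \<epsilon> / 2"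
      using D[of "Suc N"] by (simp add: abs_less_iff)
    finally show ?thesis by simp
  qed
  moreover have "rank_le (k n) (F' n)" for n
    using F(1) by (simp add: F'_def rank_le_zero)
  ultimately show ?thesis
    using that[of k F' D] by (simp add: F'_def)
qed

lemma weighted_norm_convolution_bound:
  assumes "0 \<le> \<rho>" "\<And>N. weighted_norm \<rho> N a \<le> K" "\<And>N. weighted_norm \<rho> N b \<le> K'"
  shows "weighted_norm \<rho> N (convolution a b) \<le> K * K'"
proof -
  have "weighted_norm \<rho> N (convolution a b) \<le> weighted_norm \<rho> N a * weighted_norm \<rho> N b"
    by (rule weighted_norm_convolution[OF assms(1)])
  also have "\<dots> \<le> K * K'"
    by (intro mult_mono assms weighted_norm_nonneg order_trans[OF weighted_norm_nonneg assms(2)])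
  finally show ?thesis .
qed

section \<open>The equation satisfied by Z and the final assembly\<close>

lemma exp_ncs_eq_1_plus:
  assumes "coef f [] = 0"
  shows "exp_ncs f = 1 + formal_sum (\<lambda>k. (1 / fact (Suc k)) *\<^sub>R f ^ k) * f"
proof -
  have "formal_sum (\<lambda>k. (1 / fact (Suc k)) *\<^sub>R f ^ k) * f = formal_sum (\<lambda>k. (1 / fact (Suc k)) *\<^sub>R f ^ Suc k)"
    by (subst formal_sum_mult_right[OF summable_family_powers[OF assms]])
      (simp add: power_commutes del: fact_Suc)
  then show ?thesis
    unfolding exp_ncs_def by (subst formal_sum_shift[OF summable_family_powers[OF assms]]) simp
qed

text \<open>The second-order form isolates \<open>f\<close> with coefficient 1 and leaves a middle
  factor \<open>f\<close> that can be replaced by its finite rank approximation.\<close>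

lemma exp_ncs_eq_1_plus_plus:
  assumes "coef f [] = 0"
  shows "exp_ncs f = 1 + (f + formal_sum (\<lambda>k. (1 / fact (Suc (Suc k))) *\<^sub>R f ^ k) * f * f)"
proof -
  have "formal_sum (\<lambda>k. (1 / fact (Suc k)) *\<^sub>R f ^ k)
      = 1 + formal_sum (\<lambda>k. (1 / fact (Suc (Suc k))) *\<^sub>R f ^ Suc k)"
    by (subst formal_sum_shift[OF summable_family_powers[OF assms]]) simp
  also have "formal_sum (\<lambda>k. (1 / fact (Suc (Suc k))) *\<^sub>R f ^ Suc k)
      = formal_sum (\<lambda>k. (1 / fact (Suc (Suc k))) *\<^sub>R f ^ k) * f"
    by (subst formal_sum_mult_right[OF summable_family_powers[OF assms]])
      (simp add: power_commutes del: fact_Suc)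
  finally show ?thesis
    using exp_ncs_eq_1_plus[OF assms] by (simp add: algebra_simps)
qed

text \<open>From e^Z - 1 = phi(X) X + e^X phi(Y) Y: every term on the right ends in X or Y, which is
  where the ideal property is applied.\<close>

lemma eval_bch_equation:
  fixes x y :: "'a::real_normed_vector \<Rightarrow>\<^sub>L 'a"
  defines "X \<equiv> \<lambda>n::nat. if n = 1 then x else 0" and "Y \<equiv> \<lambda>n::nat. if n = 1 then y else 0"
  assumes "1 \<le> \<rho>" and K: "\<And>N. weighted_norm \<rho> N (eval_ncs x y bch_ncs) \<le> K"
  obtains l A B K' where
    "\<And>n. eval_ncs x y bch_ncs n + convolution (convolution l (eval_ncs x y bch_ncs)) (eval_ncs x y bch_ncs) n
      = convolution A X n + convolution B Y n"
    "\<And>N. weighted_norm \<rho> N l \<le> exp K" "\<And>N. weighted_norm \<rho> N A \<le> K'" "\<And>N. weighted_norm \<rho> N B \<le> K'"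
proof -
  let ?E = "eval_ncs x y" and ?x = "var_ncs VX" and ?y = "var_ncs VY"
  \<comment> \<open>The series of (e^t - 1) / t.\<close>
  define \<phi> where "\<phi> f = formal_sum (\<lambda>k. (1 / fact (Suc k)) *\<^sub>R f ^ k)" for f :: ncs
  define L where "L = formal_sum (\<lambda>k. (1 / fact (Suc (Suc k))) *\<^sub>R bch_ncs ^ k)"
  have x0: "coef ?x [] = 0" "coef ?y [] = 0"
    by (simp_all add: coef_var_ncs)
  have "1 + (bch_ncs + L * bch_ncs * bch_ncs) = exp_ncs ?x * (1 + \<phi> ?y * ?y)"
    using exp_ncs_eq_1_plus_plus[OF coef_bch_ncs_Nil] exp_bch_ncs exp_ncs_eq_1_plus[OF x0(2)]
    by (simp add: L_def \<phi>_def)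
  also have "\<dots> = 1 + (\<phi> ?x * ?x + exp_ncs ?x * \<phi> ?y * ?y)"
    using exp_ncs_eq_1_plus[OF x0(1)] by (simp add: \<phi>_def algebra_simps)
  finally have "bch_ncs + L * bch_ncs * bch_ncs = \<phi> ?x * ?x + exp_ncs ?x * \<phi> ?y * ?y"
    by simp
  then have "?E (bch_ncs + L * bch_ncs * bch_ncs) n = ?E (\<phi> ?x * ?x + exp_ncs ?x * \<phi> ?y * ?y) n" for n
    by simp
  moreover have "?E (f * h) = convolution (?E f) (?E h)" for f h
    by (rule ext) (rule eval_ncs_mult)
  moreover have var: "?E ?x = X" "?E ?y = Y"
    by (auto simp: eval_ncs_var X_def Y_def)
  ultimately have eq: "?E bch_ncs n + convolution (convolution (?E L) (?E bch_ncs)) (?E bch_ncs) n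
      = convolution (?E (\<phi> ?x)) X n + convolution (convolution (?E (exp_ncs ?x)) (?E (\<phi> ?y))) Y n" for n
    by (simp add: eval_ncs_add)
  define M where "M = \<rho> * (norm x + norm y)"
  have single: "weighted_norm \<rho> N (\<lambda>n. if n = 1 then T else 0) \<le> \<rho> * norm T" for N and T :: "'a \<Rightarrow>\<^sub>L 'a"
  proof -
    have "weighted_norm \<rho> N (\<lambda>n. if n = 1 then T else 0) = (\<Sum>n\<le>N. if n = 1 then \<rho> * norm T else 0)"
      unfolding weighted_norm_def by (rule sum.cong) auto
    also have "\<dots> \<le> \<rho> * norm T"
      using assms(3) by simp
    finally show ?thesis .
  qed
  have M: "weighted_norm \<rho> N (?E ?x) \<le> M" "weighted_norm \<rho> N (?E ?y) \<le> M" "0 \<le> M" for N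
    using single[of N x] single[of N y] assms(3) unfolding var X_def Y_def M_def
    by (auto simp: distrib_left intro: order_trans)
  have fact: "\<bar>1 / fact (Suc (Suc k))\<bar> \<le> 1 / (fact k :: real)" "\<bar>1 / fact (Suc k)\<bar> \<le> 1 / (fact k :: real)" for k
    by (simp_all del: fact_Suc add: frac_le fact_mono)
  have \<rho>0: "0 \<le> \<rho>"
    using assms(3) by simp
  have bounds: "weighted_norm \<rho> N (?E L) \<le> exp K" "weighted_norm \<rho> N (?E (\<phi> ?x)) \<le> exp M"
    "weighted_norm \<rho> N (?E (\<phi> ?y)) \<le> exp M" "weighted_norm \<rho> N (?E (exp_ncs ?x)) \<le> exp M" for N
    unfolding L_def \<phi>_def exp_ncs_def
    by (intro weighted_norm_eval_formal_sum \<rho>0 K M coef_bch_ncs_Nil x0 fact; simp)+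
  have "weighted_norm \<rho> N (convolution (?E (exp_ncs ?x)) (?E (\<phi> ?y))) \<le> exp M * exp M" for N
    by (intro weighted_norm_convolution_bound \<rho>0 bounds)
  moreover have "weighted_norm \<rho> N (?E (\<phi> ?x)) \<le> exp M * exp M" for N
    by (rule order_trans[OF bounds(2)]) (use M(3) in \<open>simp add: mult_le_cancel_left1\<close>)
  ultimately show ?thesis
    using that[OF eq bounds(1)] by blast
qed

theorem bch_converges_weakly:
  fixes g :: "('a::complex_hilbert \<Rightarrow>\<^sub>L 'a) set"
  assumes p: "0 < p" and g: "subspace g" "g \<subseteq> weak_schatten p" "\<And>u v. u \<in> g \<Longrightarrow> v \<in> g \<Longrightarrow> u o\<^sub>L v \<in> g"
    and xy: "x \<in> g" "y \<in> g" and \<rho>: "1 < \<rho>" and K: "\<And>N. weighted_norm \<rho> N (eval_ncs x y bch_ncs) \<le> K"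
  shows "bch_converges p x y"
proof -
  define z where "z = eval_ncs x y bch_ncs"
  define X where "X = (\<lambda>n::nat. if n = 1 then x else 0)"
  define Y where "Y = (\<lambda>n::nat. if n = 1 then y else 0)"
  define \<delta> where "\<delta> d = (\<lambda>n::nat. if n = d then id_blinfun else 0 :: 'a \<Rightarrow>\<^sub>L 'a)" for d :: nat
  have \<rho>0: "0 \<le> \<rho>" "1 \<le> \<rho>"
    using \<rho> by auto
  have zK: "weighted_norm \<rho> N z \<le> K" for N
    using K by (simp add: z_def)
  have zg: "z n \<in> g" for n
    unfolding z_def by (rule eval_ncs_mem[OF g(1) xy g(3) coef_bch_ncs_Nil])
  have z0: "z 0 = 0"
    by (simp add: z_def eval_ncs_0 coef_bch_ncs_Nil)
  obtain l A B K' where eq: "\<And>n. z n + convolution (convolution l z) z n = convolution A X n + convolution B Y n"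
    and l: "\<And>N. weighted_norm \<rho> N l \<le> exp K"
    and A: "\<And>N. weighted_norm \<rho> N A \<le> K'" and B: "\<And>N. weighted_norm \<rho> N B \<le> K'"
    using eval_bch_equation[OF \<rho>0(2) K] unfolding z_def X_def Y_def by blast
  \<comment> \<open>Since \<open>l\<close> is bounded by \<open>exp K\<close>, the tolerance
    \<open>1 / (2 * exp K)\<close> makes \<open>u\<close> at most 1/2.\<close>
  obtain F k D where F: "\<And>n. rank_le (k n) (F n)" "F 0 = 0" "\<And>n. D \<le> n \<Longrightarrow> F n = 0"
    "\<And>N. weighted_norm \<rho> N (\<lambda>n. z n - F n) \<le> 1 / (2 * exp K)"
    by (rule finite_rank_approximation_sequence[OF p \<rho> zK _ z0, of "1 / (2 * exp K)"])
      (use zg g(2) in auto)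
  define u where "u = convolution l (\<lambda>n. z n - F n)"
  have u0: "u 0 = 0"
    by (simp add: u_def convolution_def z0 F(2))
  have "weighted_norm \<rho> N u \<le> exp K * (1 / (2 * exp K))" for N
    unfolding u_def by (intro weighted_norm_convolution_bound \<rho>0 l F)
  then have u: "weighted_norm \<rho> N u \<le> 1 / 2" for N
    by simp
  define V where "V = resolvent u"
  have V: "weighted_norm \<rho> N V \<le> 2" for N
    unfolding V_def by (rule weighted_norm_resolvent[OF \<rho>0(1) u0 u])
  have lz: "convolution l z = (\<lambda>n. u n + convolution l F n)"
    unfolding u_def convolution_add_right[symmetric] by simp
  \<comment> \<open>\<open>V\<close> is a left inverse of 1 + u, so multiplying the equation by
    \<open>V\<close> from the left isolates \<open>z\<close>.\<close>
  have inv: "convolution V (\<lambda>n. z n + convolution u z n) n = z n" for n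
  proof -
    have "convolution V (\<lambda>n. z n + convolution u z n) n = convolution (\<lambda>n. V n + convolution V u n) z n"
      by (simp add: convolution_add_right convolution_add_left convolution_assoc)
    also have "\<dots> = z n"
      unfolding V_def resolvent_eq[of u, OF u0] by (rule convolution_unit_left)
    finally show ?thesis .
  qed
  define W where "W = convolution V l"
  have z_eq: "z n = convolution (convolution V A) X n + convolution (convolution V B) Y n
      - convolution (convolution W F) z n" for n
  proof -
    have "(\<lambda>n. (z n + convolution u z n) + convolution (convolution l F) z n)
        = (\<lambda>n. convolution A X n + convolution B Y n)"
      using eq by (auto simp: lz convolution_add_left fun_eq_iff add.assoc)
    then have "convolution V (\<lambda>n. (z n + convolution u z n) + convolution (convolution l F) z n) n
        = convolution V (\<lambda>n. convolution A X n + convolution B Y n) n"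
      by simp
    then have "z n + convolution V (convolution (convolution l F) z) n
        = convolution V (convolution A X) n + convolution V (convolution B Y) n"
      unfolding convolution_add_right[of V "\<lambda>n. z n + convolution u z n"] inv by (simp add: convolution_add_right)
    then show ?thesis
      by (simp add: W_def convolution_assoc eq_diff_eq)
  qed
  \<comment> \<open>The polynomial \<open>F\<close> is split into its \<open>D\<close> monomials, so
    that each convolution contains one fixed finite rank operator.\<close>
  have F_eq: "F = (\<lambda>n. \<Sum>d<D. \<delta> d n o\<^sub>L F d)"
  proof
    fix n
    have "(\<Sum>d<D. \<delta> d n o\<^sub>L F d) = (\<Sum>d<D. if d = n then F n else 0)"
      by (rule sum.cong) (auto simp: \<delta>_def intro!: blinfun_eqI)
    then show "F n = (\<Sum>d<D. \<delta> d n o\<^sub>L F d)"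
      using F(3)[of n] by auto
  qed
  have "convolution W F n = (\<Sum>d<D. convolution W (\<delta> d) n o\<^sub>L F d)" for n
    by (subst F_eq) (simp add: convolution_def blinfun_compose.sum_left blinfun_compose.sum_right
        blinfun_compose_assoc, rule sum.swap)
  then have WF: "convolution (convolution W F) z n = (\<Sum>d<D. convolution (\<lambda>n. convolution W (\<delta> d) n o\<^sub>L F d) z n)" for n
    unfolding convolution_sum_left[symmetric] by presburger
  have \<delta>: "weighted_norm \<rho> N (\<delta> d) \<le> \<rho> ^ d" for N d
  proof -
    have "weighted_norm \<rho> N (\<delta> d) = (\<Sum>n\<le>N. if n = d then \<rho> ^ d * norm (id_blinfun :: 'a \<Rightarrow>\<^sub>L 'a) else 0)"
      unfolding weighted_norm_def by (rule sum.cong) (auto simp: \<delta>_def)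
    also have "\<dots> \<le> \<rho> ^ d * norm (id_blinfun :: 'a \<Rightarrow>\<^sub>L 'a)"
      using \<rho>0 by simp
    also have "\<dots> \<le> \<rho> ^ d"
      using norm_blinfun_id_le[where 'a='a] \<rho>0 by (intro mult_left_le) auto
    finally show ?thesis .
  qed
  obtain L1 where L1: "weak_null p (\<lambda>N. (\<Sum>n\<le>N. convolution (convolution V A) X n) - L1)"
    unfolding X_def
    by (rule weak_null_convolution_var[OF p \<rho>, of "convolution V A" "2 * K'" x])
      (use xy g(2) in \<open>auto intro: weighted_norm_convolution_bound \<rho>0 V A\<close>)
  obtain L2 where L2: "weak_null p (\<lambda>N. (\<Sum>n\<le>N. convolution (convolution V B) Y n) - L2)"
    unfolding Y_def
    by (rule weak_null_convolution_var[OF p \<rho>, of "convolution V B" "2 * K'" y])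
      (use xy g(2) in \<open>auto intro: weighted_norm_convolution_bound \<rho>0 V B\<close>)
  have "\<exists>L. weak_null p (\<lambda>N. (\<Sum>n\<le>N. convolution (\<lambda>n. convolution W (\<delta> d) n o\<^sub>L F d) z n) - L)" for d
  proof (rule weak_null_convolution_finite_rank[OF p \<rho> _ zK F(1)])
    show "weighted_norm \<rho> N (convolution W (\<delta> d)) \<le> 2 * exp K * \<rho> ^ d" for N
      unfolding W_def by (intro weighted_norm_convolution_bound \<rho>0 V l \<delta>)
    show "complex_linear (z n)" for n
      using zg g(2) by (auto simp: weak_schatten_def)
  qed blast
  then obtain L where L: "\<And>d. weak_null p (\<lambda>N. (\<Sum>n\<le>N. convolution (\<lambda>n. convolution W (\<delta> d) n o\<^sub>L F d) z n) - L d)"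
    by metis
  define S where "S N = (\<Sum>n\<le>N. z n)" for N
  define S' where "S' = L1 + L2 - (\<Sum>d<D. L d)"
  have S_eq: "S N - S' = (((\<Sum>n\<le>N. convolution (convolution V A) X n) - L1)
      + ((\<Sum>n\<le>N. convolution (convolution V B) Y n) - L2))
      + - (\<Sum>d<D. (\<Sum>n\<le>N. convolution (\<lambda>n. convolution W (\<delta> d) n o\<^sub>L F d) z n) - L d)" for N
  proof -
    have "S N = (\<Sum>n\<le>N. convolution (convolution V A) X n) + (\<Sum>n\<le>N. convolution (convolution V B) Y n)
        - (\<Sum>n\<le>N. convolution (convolution W F) z n)"
      unfolding S_def sum.distrib[symmetric] sum_subtractf[symmetric] by (rule sum.cong[OF refl z_eq])
    also have "(\<Sum>n\<le>N. convolution (convolution W F) z n)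
        = (\<Sum>d<D. \<Sum>n\<le>N. convolution (\<lambda>n. convolution W (\<delta> d) n o\<^sub>L F d) z n)"
      unfolding WF by (rule sum.swap)
    finally show ?thesis
      by (simp add: S'_def sum_subtractf algebra_simps)
  qed
  have null: "weak_null p (\<lambda>N. S N - S')"
    unfolding S_eq by (intro weak_null_add weak_null_minus weak_null_sum L1 L2 L p)
  have mem: "S N \<in> weak_schatten p" for N
    unfolding S_def by (rule subsetD[OF g(2) subspace_sum[OF g(1) zg]])
  have "(\<Sum>n=1..N. bch_term n x y) = S N" for N
  proof -
    have "{..N} = insert 0 {1..N}"
      by auto
    then show ?thesis
      by (simp add: S_def bch_term_eq_eval z_def[symmetric] z0)
  qed
  then show ?thesis
    unfolding bch_converges_def using weak_null_limit[OF p mem null] by (intro bexI[of _ S']) auto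
qed

lemma weak_schatten_norm_scaleR_le:
  assumes "0 < p" "T \<in> weak_schatten p"
  shows "weak_schatten_norm p (r *\<^sub>R T) \<le> \<bar>r\<bar> * weak_schatten_norm p T"
  using assms
  by (intro weak_schatten_norm_le_weak_approx complex_linear_scaleR weak_approx_scaleR
      weak_approx_weak_schatten) (auto simp: weak_schatten_def)

lemma bounded_bilinear_op_bracket:
  "bounded_bilinear (op_bracket :: ('a::real_normed_vector \<Rightarrow>\<^sub>L 'a) \<Rightarrow> _)"
proof
  show "\<exists>K. \<forall>a b :: 'a \<Rightarrow>\<^sub>L 'a. norm (op_bracket a b) \<le> norm a * norm b * K"
  proof (intro exI allI)
    fix a b :: "'a \<Rightarrow>\<^sub>L 'a"
    have "norm (op_bracket a b) \<le> norm (a o\<^sub>L b) + norm (b o\<^sub>L a)"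
      unfolding op_bracket_def by (rule norm_triangle_ineq4)
    also have "\<dots> \<le> norm a * norm b * 2"
      using norm_blinfun_compose[of a b] norm_blinfun_compose[of b a] by (simp add: mult.commute)
    finally show "norm (op_bracket a b) \<le> norm a * norm b * 2" .
  qed
qed (simp_all add: op_bracket_def blinfun_compose.add_left blinfun_compose.add_right
    blinfun_compose.scaleR_left blinfun_compose.scaleR_right scaleR_diff_right)

lemma bch_converges_if_envelope_bracket:
  fixes g :: "('a::complex_hilbert \<Rightarrow>\<^sub>L 'a) set" and p :: real
  defines "N \<equiv> convex_envelope g (weak_schatten_norm p)"
  assumes p: "0 < p" and g: "subspace g" "g \<subseteq> weak_schatten p" "\<And>u v. u \<in> g \<Longrightarrow> v \<in> g \<Longrightarrow> u o\<^sub>L v \<in> g"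
    and xy: "x \<in> g" "y \<in> g" and "0 < B"
    and bracket: "\<And>u v. u \<in> g \<Longrightarrow> v \<in> g \<Longrightarrow> N (op_bracket u v) \<le> B * N u * N v"
    and small: "weak_schatten_norm p x + weak_schatten_norm p y < 1 / (4 * B)"
  shows "bch_converges p x y"
proof -
  interpret nonneg_functional g "weak_schatten_norm p"
    by unfold_locales (use g(2) weak_schatten_norm_nonneg[OF p] in auto)
  have scale: "weak_schatten_norm p (r *\<^sub>R u) \<le> \<bar>r\<bar> * weak_schatten_norm p u" if "u \<in> g" for u r
    using weak_schatten_norm_scaleR_le[OF p] that g(2) by auto
  define s where "s = B * N x + B * N y"
  have "N x + N y < 1 / (4 * B)"
    using convex_envelope_le_self[OF xy(1)] convex_envelope_le_self[OF xy(2)] small by (simp add: N_def)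
  then have s: "s < 1 / 4"
    using \<open>0 < B\<close> by (simp add: s_def field_simps)
  have s0: "0 \<le> s"
    using \<open>0 < B\<close> convex_envelope_nonneg xy by (simp add: s_def N_def)
  \<comment> \<open>For \<open>s < 1/4\<close> this choice satisfies both \<open>1 < \<rho>\<close>
    and \<open>\<rho> * s \<le> 1/4\<close>.\<close>
  define \<rho> where "\<rho> = 2 / (1 + 4 * s)"
  have \<rho>1: "1 < \<rho>" "\<rho> * s \<le> 1 / 4"
    using s s0 by (auto simp: \<rho>_def field_simps)
  interpret bch_majorant g "\<lambda>u. B * N u" x y \<rho>
  proof
    fix u v r assume u: "u \<in> g"
    show "0 \<le> B * N u"
      using u \<open>0 < B\<close> convex_envelope_nonneg by (simp add: N_def)
    show "B * N (r *\<^sub>R u) = \<bar>r\<bar> * (B * N u)"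
      using convex_envelope_scaleR[OF g(1) u scale] by (simp add: N_def)
    assume v: "v \<in> g"
    show "u o\<^sub>L v \<in> g"
      by (rule g(3)[OF u v])
    show "B * N (u + v) \<le> B * N u + B * N v"
      using convex_envelope_triangle[OF u v] \<open>0 < B\<close> by (simp add: N_def distrib_left[symmetric])
    show "B * N (op_bracket u v) \<le> B * N u * (B * N v)"
      using mult_left_mono[OF bracket[OF u v], of B] \<open>0 < B\<close> by (simp add: mult_ac)
  qed (use g(1) xy \<rho>1 s_def in auto)
  have "weighted_norm \<rho> M (eval_ncs x y bch_ncs) \<le> 1 / (2 * B)" for M
  proof -
    have "norm (E bch_ncs n) \<le> N (E bch_ncs n)" for n
      unfolding N_def using norm_le_weak_schatten_norm[OF p] g(2)
      by (intro norm_le_convex_envelope E_mem coef_bch_ncs_Nil) auto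
    then have "B * weighted_norm \<rho> M (E bch_ncs) \<le> W M bch_ncs"
      unfolding weighted_norm_def W_def sum_distrib_left using \<rho>1(1) \<open>0 < B\<close>
      by (intro sum_mono) (simp add: mult_left_mono mult.left_commute)
    also have "\<dots> \<le> 1 / 2"
      by (rule W_bch_bounded)
    finally show ?thesis
      using \<open>0 < B\<close> by (simp add: field_simps)
  qed
  from bch_converges_weakly[OF p g xy \<rho>1(1) this] show ?thesis .
qed

text \<open>Two readings of the bound on the bracket constant are proved: for any continuity
  constant \<open>B\<close> below it, and for the bound itself in the role of \<open>B\<close>. The
  envelope makes both instances of one lemma.\<close>

theorem proposition6p1:
  fixes p C_ideal C_tri C_mult :: real
    and g :: "('a::complex_hilbert \<Rightarrow>\<^sub>L 'a) set"
  assumes "0 < p" and "p < 1"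
    and "separable_space (euclidean :: 'a topology)"
    and "lie_subalgebra p g"
    and "\<forall>x\<in>g. \<forall>y\<in>g. x o\<^sub>L y \<in> g"
    and "0 < C_ideal"
    and "\<forall>x\<in>g. \<forall>y\<in>g. weak_schatten_norm p (x o\<^sub>L y)
                        \<le> C_ideal * weak_schatten_norm p x * weak_schatten_norm p y"
    and "C_tri = 2 powr (1 / p - 1)"
    and "C_mult = C_ideal"
  shows "(\<forall>B. bracket_continuity_const p g B \<and> B \<le> 2 * C_tri * C_mult \<longrightarrow>
            (\<forall>x\<in>g. \<forall>y\<in>g. weak_schatten_norm p x + weak_schatten_norm p y < 1 / (4 * B) \<longrightarrow>
               bch_converges p x y)) \<and>
         (\<forall>x\<in>g. \<forall>y\<in>g. weak_schatten_norm p x + weak_schatten_norm p y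
                          < 1 / (4 * (2 * C_tri * C_mult)) \<longrightarrow>
            bch_converges p x y)"
proof -
  let ?q = "weak_schatten_norm p" and ?N = "convex_envelope g (weak_schatten_norm p)"
  have g: "subspace g" "g \<subseteq> weak_schatten p" "\<And>u v. u \<in> g \<Longrightarrow> v \<in> g \<Longrightarrow> op_bracket u v \<in> g"
    using assms(4) by (auto simp: lie_subalgebra_def)
  have mult: "u o\<^sub>L v \<in> g" "?q (u o\<^sub>L v) \<le> C_ideal * ?q u * ?q v" if "u \<in> g" "v \<in> g" for u v
    using assms(5,7) that by auto
  interpret nonneg_functional g ?q
    by unfold_locales (use g(2) weak_schatten_norm_nonneg[OF assms(1)] in auto)
  have scale: "?q (r *\<^sub>R u) \<le> \<bar>r\<bar> * ?q u" if "u \<in> g" for u r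
    using weak_schatten_norm_scaleR_le[OF assms(1)] that g(2) by auto
  show ?thesis
  proof (intro conjI allI impI ballI)
    fix B x y
    assume B: "bracket_continuity_const p g B \<and> B \<le> 2 * C_tri * C_mult" and xy: "x \<in> g" "y \<in> g"
      and small: "?q x + ?q y < 1 / (4 * B)"
    have "0 < B" and bound: "\<And>u v. u \<in> g \<Longrightarrow> v \<in> g \<Longrightarrow> ?q (op_bracket u v) \<le> B * ?q u * ?q v"
      using B by (auto simp: bracket_continuity_const_def)
    show "bch_converges p x y"
      by (rule bch_converges_if_envelope_bracket[OF assms(1) g(1,2) mult(1) xy \<open>0 < B\<close> _ small])
        (use \<open>0 < B\<close> in \<open>auto intro!: convex_envelope_bilinear bounded_bilinear_op_bracket g(3) bound\<close>)
  next
    fix x y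
    assume xy: "x \<in> g" "y \<in> g" and small: "?q x + ?q y < 1 / (4 * (2 * C_tri * C_mult))"
    \<comment> \<open>\<open>2 * C_tri * C_mult\<close> need not be a bracket continuity constant of the quasi-norm, because the
      optimal quasi-triangle constant exceeds \<open>C_tri\<close>; the smaller \<open>2 * C_ideal\<close> is one for the envelope.\<close>
    have envelope: "?N (u o\<^sub>L v) \<le> C_ideal * ?N u * ?N v" if "u \<in> g" "v \<in> g" for u v
      by (rule convex_envelope_bilinear[OF bounded_bilinear_blinfun_compose that])
        (use assms(6) mult in auto)
    have bracket: "?N (op_bracket u v) \<le> 2 * C_ideal * ?N u * ?N v" if "u \<in> g" "v \<in> g" for u v
    proof -
      have "op_bracket u v = (u o\<^sub>L v) + (-1) *\<^sub>R (v o\<^sub>L u)"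
        by (simp add: op_bracket_def)
      then have "?N (op_bracket u v) \<le> ?N (u o\<^sub>L v) + ?N ((-1) *\<^sub>R (v o\<^sub>L u))"
        using that by (simp only:) (intro convex_envelope_triangle subspace_scale g(1) mult(1))
      also have "?N ((-1) *\<^sub>R (v o\<^sub>L u)) = ?N (v o\<^sub>L u)"
        using convex_envelope_scaleR[OF g(1) mult(1)[OF that(2,1)] scale, of "-1"] by simp
      finally show ?thesis
        using envelope[OF that] envelope[OF that(2,1)] by (simp add: mult_ac)
    qed
    have "1 \<le> C_tri"
      using assms(1,2,8) by (simp add: ge_one_powr_ge_zero)
    then have "1 / (4 * (2 * C_tri * C_mult)) \<le> 1 / (4 * (2 * C_ideal))"
      using assms(6,9) by (intro divide_left_mono) auto
    then have "?q x + ?q y < 1 / (4 * (2 * C_ideal))"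
      using small by simp
    then show "bch_converges p x y"
      using assms(6)
      by (intro bch_converges_if_envelope_bracket[OF assms(1) g(1,2) mult(1) xy _ bracket]) auto
  qed
qed

end
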